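(* Let $G$ be a second-countable locally compact group, $A$ a separable $C^*$-algebra and $B$ a $\sigma$-unital $C^*$-algebra. Let $\alpha:G\curvearrowright A$ and $\beta:G\curvearrowright B$ be two continuous actions, and let $(\varphi,\mathbf{u}),(\psi,\mathbf{v}):(A,\alpha)\to(\mathcal{M}(B),\beta)$ be two cocycle representations. Suppose that there exists a norm-continuous path of unitaries $U:[0,\infty)\to\mathcal{U}(D_{(\varphi,\mathbf{u})})$ with $U_0=1$ and $$\lim_{t\to\infty}\Big(\|\psi(a)-U_t\varphi(a)U_t^*\|+\max_{g\in K}\|\mathbf{v}_g-U_t\mathbf{u}_g\beta_g(U_t)^*\|\Big)=0$$ for all $a\in A$ and every compact set $K\subseteq G$. Then $(\varphi,\mathbf{u})$ and $(\psi,\mathbf{v})$ are strongly asymptotically unitarily equivalent.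
   Context: $\mathcal{M}(B)$ is the multiplier algebra, $\mathcal{U}(\cdot)$ the unitary group of a unital $C^*$-algebra, and $\mathcal{U}(1+B)$ the set of unitaries in the (proper) unitization of $B$ with scalar part $1$, viewed inside $\mathcal{U}(\mathcal{M}(B))$. Actions are point-norm continuous; an action $\beta$ on $B$ is extended to $\mathcal{M}(B)$ with the same symbol. A cocycle representation $(\varphi,\mathbf{u}):(A,\alpha)\to(\mathcal{M}(B),\beta)$ consists of a $*$-homomorphism $\varphi:A\to\mathcal{M}(B)$ and a strictly continuous map $\mathbf{u}:G\to\mathcal{U}(\mathcal{M}(B))$ with $\mathbf{u}_{gh}=\mathbf{u}_g\beta_g(\mathbf{u}_h)$ and $\mathrm{Ad}(\mathbf{u}_g)\circ\beta_g\circ\varphi=\varphi\circ\alpha_g$ for all $g,h\in G$. Write $\beta^{\mathbf{u}}_g=\mathrm{Ad}(\mathbf{u}_g)\circ\beta_g$. $D_{(\varphi,\mathbf{u})}=\{x\in\mathcal{M}(B): x-\beta^{\mathbf{u}}_g(x)\in B\ \forall g\in G,\ [x,\varphi(A)]\subseteq B\}$, a unital $C^*$-subalgebra of $\mathcal{M}(B)$. $(\varphi,\mathbf{u})$ and $(\psi,\mathbf{v})$ are strongly asymptotically unitarily equivalent if there is a norm-continuous path $u:[0,\infty)\to\mathcal{U}(1+B)$ with $u_0=1$, $\lim_{t\to\infty}\|\psi(a)-u_t\varphi(a)u_t^*\|=0$ for all $a\in A$, and $\lim_{t\to\infty}\max_{g\in K}\|\mathbf{v}_g-u_t\mathbf{u}_g\beta_g(u_t)^*\|=0$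 for all compact sets $K\subseteq G$. *)

theory Defs
  imports "HOL-Analysis.Analysis"
begin

section \<open>\<open>C\<^sup>*\<close>-algebras\<close>

text \<open>
  \<open>C\<^sup>*\<close>-algebras are complex, not assumed unital and possibly zero.
  The real Banach algebra structure is the library's; the complex structure extends it.
\<close>

class cstar_algebra = real_normed_algebra + banach +
  fixes scaleC :: "complex \<Rightarrow> 'a \<Rightarrow> 'a" (infixr \<open>*\<^sub>C\<close> 75)
    and star :: "'a \<Rightarrow> 'a"
  assumes scaleC_add_right: "c *\<^sub>C (x + y) = c *\<^sub>C x + c *\<^sub>C y"
    and scaleC_add_left: "(c + d) *\<^sub>C x = c *\<^sub>C x + d *\<^sub>C x"
    and scaleC_scaleC: "c *\<^sub>C d *\<^sub>C x = (c * d) *\<^sub>C x"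
    and scaleC_of_real: "complex_of_real r *\<^sub>C x = r *\<^sub>R x"
    and norm_scaleC: "norm (c *\<^sub>C x) = cmod c * norm x"
    and mult_scaleC_left: "(c *\<^sub>C x) * y = c *\<^sub>C (x * y)"
    and mult_scaleC_right: "x * (c *\<^sub>C y) = c *\<^sub>C (x * y)"
    and star_add: "star (x + y) = star x + star y"
    and star_scaleC: "star (c *\<^sub>C x) = cnj c *\<^sub>C star x"
    and star_mult: "star (x * y) = star y * star x"
    and star_star [simp]: "star (star x) = x"
    and cstar_identity: "norm (star x * x) = (norm x)\<^sup>2"

definition star_hom :: "('a::cstar_algebra \<Rightarrow> 'b::cstar_algebra) \<Rightarrow> bool" where
  "star_hom f \<longleftrightarrow>
     (\<forall>x y. f (x + y) = f x + f y) \<and> (\<forall>c x. f (c *\<^sub>C x) = c *\<^sub>C f x) \<and>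
     (\<forall>x y. f (x * y) = f x * f y) \<and> (\<forall>x. f (star x) = star (f x))"

definition star_aut :: "('a::cstar_algebra \<Rightarrow> 'a) \<Rightarrow> bool" where
  "star_aut f \<longleftrightarrow> star_hom f \<and> bij f"

text \<open>The approximate unit is a sequence of positive contractions; it need not be increasing.\<close>

definition sigma_unital :: "'b::cstar_algebra itself \<Rightarrow> bool" where
  "sigma_unital _ \<longleftrightarrow> (\<exists>e :: nat \<Rightarrow> 'b.
     (\<forall>n. (\<exists>x. e n = star x * x) \<and> norm (e n) \<le> 1) \<and>
     (\<forall>b. (\<lambda>n. e n * b) \<longlonglongrightarrow> b \<and> (\<lambda>n. b * e n) \<longlonglongrightarrow> b))"

lemma norm_star [simp]: "norm (star (x::'a::cstar_algebra)) = norm x"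
proof -
  have le: "norm y \<le> norm (star y)" for y :: 'a
  proof (cases "norm y = 0")
    case False
    have "norm y * norm y \<le> norm (star y) * norm y"
      using norm_mult_ineq[of "star y" y] by (simp add: cstar_identity power2_eq_square)
    then show ?thesis using False by (simp add: mult_le_cancel_right)
  qed simp
  show ?thesis using le[of x] le[of "star x"] by simp
qed

lemma star_scaleR: "star (r *\<^sub>R x) = r *\<^sub>R star (x::'a::cstar_algebra)"
  by (metis star_scaleC scaleC_of_real complex_cnj_complex_of_real)

lemma bounded_linear_star: "bounded_linear (star :: 'a::cstar_algebra \<Rightarrow> 'a)"
  by (rule bounded_linear_intro[where K = 1]) (simp_all add: star_add star_scaleR)

lemma scaleC_scaleR_commute: "c *\<^sub>C (r *\<^sub>R x) = r *\<^sub>R (c *\<^sub>C (x::'a::cstar_algebra))"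
  by (metis scaleC_of_real scaleC_scaleC mult.commute)

lemma scaleC_one: "1 *\<^sub>C x = (x::'a::cstar_algebra)"
  using scaleC_of_real[of 1 x] by simp

lemma bounded_linear_scaleC: "bounded_linear ((*\<^sub>C) c :: 'a::cstar_algebra \<Rightarrow> 'a)"
  by (rule bounded_linear_intro[where K = "cmod c"])
    (simp_all add: scaleC_add_right scaleC_scaleR_commute norm_scaleC mult.commute)

lemma eq_zero_if_mult_right: "(\<And>a. a * x = 0) \<Longrightarrow> (x::'a::cstar_algebra) = 0"
  by (metis cstar_identity norm_eq_zero zero_eq_power2)

lemma eq_zero_if_mult_left: "(\<And>a. x * a = 0) \<Longrightarrow> (x::'a::cstar_algebra) = 0"
  by (metis cstar_identity norm_eq_zero zero_eq_power2 star_star norm_star)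

lemma norm_mult_star: "norm (x * star x) = (norm (x::'a::cstar_algebra))\<^sup>2"
  using cstar_identity[of "star x"] by simp

lemma norm_le_if_mult_left:
  assumes "0 \<le> K" "\<And>a. norm (a * x) \<le> norm a * K"
  shows "norm (x::'a::cstar_algebra) \<le> K"
proof (cases "norm x = 0")
  case False
  have "norm x * norm x \<le> norm x * K"
    using assms(2)[of "star x"] by (simp add: cstar_identity power2_eq_square)
  then show ?thesis using False by (simp add: mult_le_cancel_left)
qed (use assms in simp)

lemma norm_le_if_mult_right:
  assumes "0 \<le> K" "\<And>a. norm (x * a) \<le> K * norm a"
  shows "norm (x::'a::cstar_algebra) \<le> K"
proof (cases "norm x = 0")
  case False
  have "norm x * norm x \<le> K * norm x"
    using assms(2)[of "star x"] by (simp add: norm_mult_star power2_eq_square)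
  then show ?thesis using False by (simp add: mult_le_cancel_right)
qed (use assms in simp)


section \<open>The multiplier algebra\<close>

text \<open>
  \<open>M(B)\<close> is the algebra of double centralisers \<open>(L, R)\<close> of \<open>B\<close>. The type of
  bounded operators only records real linearity, so complex linearity is a separate condition.
\<close>

definition double_centraliser ::
    "('b::cstar_algebra \<Rightarrow>\<^sub>L 'b) \<times> ('b \<Rightarrow>\<^sub>L 'b) \<Rightarrow> bool" where
  "double_centraliser = (\<lambda>(L, R).
     (\<forall>c a. L (c *\<^sub>C a) = c *\<^sub>C L a) \<and> (\<forall>c a. R (c *\<^sub>C a) = c *\<^sub>C R a) \<and>
     (\<forall>a b. L (a * b) = L a * b) \<and> (\<forall>a b. R (a * b) = a * R b) \<and>
     (\<forall>a b. a * L b = R a * b))"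

lemma double_centraliserI:
  assumes LR: "\<And>a b. a * blinfun_apply L b = blinfun_apply R a * b"
  shows "double_centraliser (L, R)"
proof -
  have 1: "x = y" if "\<And>a. a * x = a * y" for x y :: 'a
    using eq_zero_if_mult_right[of "x - y"] that by (simp add: right_diff_distrib)
  have 2: "x = y" if "\<And>a. x * a = y * a" for x y :: 'a
    using eq_zero_if_mult_left[of "x - y"] that by (simp add: left_diff_distrib)
  show ?thesis
    unfolding double_centraliser_def
  proof (clarsimp, intro conjI allI)
    show "L (c *\<^sub>C a) = c *\<^sub>C L a" for c a
      by (rule 1) (simp add: LR mult_scaleC_right)
    show "R (c *\<^sub>C a) = c *\<^sub>C R a" for c a
      by (rule 2) (simp add: LR[symmetric] mult_scaleC_left)
    show "L (a * b) = L a * b" for a b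
      by (rule 1) (simp add: LR mult.assoc[symmetric])
    show "R (a * b) = a * R b" for a b
      by (rule 2) (simp add: LR[symmetric] mult.assoc)
    show "a * L b = R a * b" for a b
      by (rule LR)
  qed
qed

typedef (overloaded) 'b multiplier = "{m :: ('b::cstar_algebra \<Rightarrow>\<^sub>L 'b) \<times> ('b \<Rightarrow>\<^sub>L 'b). double_centraliser m}"
  morphisms Rep_multiplier Abs_multiplier
  by (rule exI[of _ "(0, 0)"]) (simp add: double_centraliserI)

definition lmul :: "'b::cstar_algebra multiplier \<Rightarrow> 'b \<Rightarrow>\<^sub>L 'b" where
  "lmul m = fst (Rep_multiplier m)"

definition rmul :: "'b::cstar_algebra multiplier \<Rightarrow> 'b \<Rightarrow>\<^sub>L 'b" where
  "rmul m = snd (Rep_multiplier m)"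

lemma mult_lmul: "a * lmul m b = rmul m a * b"
  using Rep_multiplier[of m] by (auto simp: lmul_def rmul_def double_centraliser_def split: prod.splits)

lemma lmul_mult: "lmul m (a * b) = lmul m a * b"
  using Rep_multiplier[of m] by (auto simp: lmul_def rmul_def double_centraliser_def split: prod.splits)

lemma rmul_mult: "rmul m (a * b) = a * rmul m b"
  using Rep_multiplier[of m] by (auto simp: lmul_def rmul_def double_centraliser_def split: prod.splits)

lemma multiplier_eqI:
  assumes "\<And>b. lmul m b = lmul n b"
  shows "m = n"
proof -
  have "rmul m a * b = rmul n a * b" for a b
    using assms by (simp add: mult_lmul[symmetric])
  then have "rmul m a = rmul n a" for a
    using eq_zero_if_mult_left[of "rmul m a - rmul n a"] by (simp add: left_diff_distrib)
  then have "Rep_multiplier m = Rep_multiplier n"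
    using assms unfolding lmul_def rmul_def by (intro prod_eqI blinfun_eqI) auto
  then show ?thesis by (simp add: Rep_multiplier_inject)
qed

definition mk_multiplier :: "('b::cstar_algebra \<Rightarrow>\<^sub>L 'b) \<Rightarrow> ('b \<Rightarrow>\<^sub>L 'b) \<Rightarrow> 'b multiplier" where
  "mk_multiplier L R = Abs_multiplier (L, R)"

lemma mk_multiplier:
  assumes "\<And>a b. a * blinfun_apply L b = blinfun_apply R a * b"
  shows "lmul (mk_multiplier L R) = L" "rmul (mk_multiplier L R) = R"
  using Abs_multiplier_inverse[of "(L, R)"] double_centraliserI[of L R] assms
  by (auto simp: lmul_def rmul_def mk_multiplier_def)

lemma norm_lmul_eq_norm_rmul: "norm (lmul m) = norm (rmul m)"
proof (rule antisym)
  show "norm (lmul m) \<le> norm (rmul m)"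
  proof (rule norm_blinfun_bound)
    fix b show "norm (lmul m b) \<le> norm (rmul m) * norm b"
    proof (rule norm_le_if_mult_left)
      fix a
      have "norm (a * lmul m b) \<le> norm (rmul m a) * norm b"
        by (simp add: mult_lmul norm_mult_ineq)
      also have "\<dots> \<le> norm (rmul m) * norm a * norm b"
        by (intro mult_right_mono norm_blinfun) simp
      finally show "norm (a * lmul m b) \<le> norm a * (norm (rmul m) * norm b)"
        by (simp add: ac_simps)
    qed simp
  qed simp
  show "norm (rmul m) \<le> norm (lmul m)"
  proof (rule norm_blinfun_bound)
    fix a show "norm (rmul m a) \<le> norm (lmul m) * norm a"
    proof (rule norm_le_if_mult_right)
      fix b
      have "norm (rmul m a * b) \<le> norm a * norm (lmul m b)"
        by (simp add: mult_lmul[symmetric] norm_mult_ineq)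
      also have "\<dots> \<le> norm a * (norm (lmul m) * norm b)"
        by (intro mult_left_mono norm_blinfun) simp
      finally show "norm (rmul m a * b) \<le> norm (lmul m) * norm a * norm b"
        by (simp add: ac_simps)
    qed simp
  qed simp
qed

instantiation multiplier :: (cstar_algebra) real_normed_vector
begin

definition "0 = mk_multiplier 0 (0 :: 'a \<Rightarrow>\<^sub>L 'a)"
definition "m + n = mk_multiplier (lmul m + lmul n) (rmul m + rmul n)"
definition "m - n = mk_multiplier (lmul m - lmul n) (rmul m - rmul n)"
definition "- m = mk_multiplier (- lmul m) (- rmul m)"
definition "r *\<^sub>R m = mk_multiplier (r *\<^sub>R lmul m) (r *\<^sub>R rmul m)"
definition norm_multiplier :: "'a multiplier \<Rightarrow> real" where
  "norm_multiplier m = norm (lmul m)"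
definition dist_multiplier :: "'a multiplier \<Rightarrow> 'a multiplier \<Rightarrow> real" where
  "dist_multiplier m n = norm (m - n)"
definition uniformity_multiplier :: "('a multiplier \<times> 'a multiplier) filter" where
  "uniformity_multiplier = (INF e\<in>{0<..}. principal {(x, y). dist x y < e})"
definition open_multiplier :: "'a multiplier set \<Rightarrow> bool" where
  "open_multiplier S = (\<forall>x\<in>S. \<forall>\<^sub>F (x', y) in uniformity. x' = x \<longrightarrow> y \<in> S)"
definition sgn_multiplier :: "'a multiplier \<Rightarrow> 'a multiplier" where
  "sgn_multiplier m = inverse (norm m) *\<^sub>R m"

lemma lrmul_zero [simp]:
  "lmul (0 :: 'a multiplier) = 0" "rmul (0 :: 'a multiplier) = 0"
  unfolding zero_multiplier_def by (subst mk_multiplier; simp)+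

lemma lrmul_add [simp]:
  "lmul (m + n :: 'a multiplier) = lmul m + lmul n" "rmul (m + n) = rmul m + rmul n"
  unfolding plus_multiplier_def
  by (subst mk_multiplier; simp add: blinfun.bilinear_simps algebra_simps mult_lmul)+

lemma lrmul_diff [simp]:
  "lmul (m - n :: 'a multiplier) = lmul m - lmul n" "rmul (m - n) = rmul m - rmul n"
  unfolding minus_multiplier_def
  by (subst mk_multiplier; simp add: blinfun.bilinear_simps algebra_simps mult_lmul)+

lemma lrmul_uminus [simp]:
  "lmul (- m :: 'a multiplier) = - lmul m" "rmul (- m) = - rmul m"
  unfolding uminus_multiplier_def
  by (subst mk_multiplier; simp add: blinfun.bilinear_simps algebra_simps mult_lmul)+

lemma lrmul_scaleR [simp]:
  "lmul (r *\<^sub>R m :: 'a multiplier) = r *\<^sub>R lmul m" "rmul (r *\<^sub>R m) = r *\<^sub>R rmul m"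
  unfolding scaleR_multiplier_def
  by (subst mk_multiplier; simp add: blinfun.bilinear_simps algebra_simps mult_lmul)+

instance
proof
  fix m n k :: "'a multiplier" and r s :: real
  show "m + n + k = m + (n + k)" "m + n = n + m" "0 + m = m" "- m + m = 0" "m - n = m + - n"
    "r *\<^sub>R (m + n) = r *\<^sub>R m + r *\<^sub>R n" "(r + s) *\<^sub>R m = r *\<^sub>R m + s *\<^sub>R m"
    "r *\<^sub>R s *\<^sub>R m = (r * s) *\<^sub>R m" "1 *\<^sub>R m = m"
    by (rule multiplier_eqI; simp add: algebra_simps)+
  show "norm m = 0 \<longleftrightarrow> m = 0"
    by (auto simp: norm_multiplier_def intro: multiplier_eqI)
  show "norm (m + n) \<le> norm m + norm n"
    by (simp add: norm_multiplier_def norm_triangle_ineq)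
  show "norm (r *\<^sub>R m) = \<bar>r\<bar> * norm m"
    by (simp add: norm_multiplier_def)
qed (simp_all add: dist_multiplier_def sgn_multiplier_def uniformity_multiplier_def
      open_multiplier_def)

end

instantiation multiplier :: (cstar_algebra) real_normed_algebra
begin

definition "m * n = mk_multiplier (lmul m o\<^sub>L lmul n) (rmul n o\<^sub>L rmul m)"

lemma lrmul_mult [simp]:
  "lmul (m * n :: 'a multiplier) = lmul m o\<^sub>L lmul n" "rmul (m * n) = rmul n o\<^sub>L rmul m"
  unfolding times_multiplier_def
  by (subst mk_multiplier; simp add: mult_lmul)+

instance
proof
  fix m n k :: "'a multiplier" and r :: real
  show "m * n * k = m * (n * k)" "(m + n) * k = m * k + n * k" "m * (n + k) = m * n + m * k"
    "r *\<^sub>R m * n = r *\<^sub>R (m * n)" "m * r *\<^sub>R n = r *\<^sub>R (m * n)"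
    by (rule multiplier_eqI; simp add: blinfun.bilinear_simps)+
  show "norm (m * n) \<le> norm m * norm n"
    by (simp add: norm_multiplier_def norm_blinfun_compose)
qed

end

instantiation multiplier :: (cstar_algebra) monoid_mult
begin

definition "1 = mk_multiplier id_blinfun (id_blinfun :: 'a \<Rightarrow>\<^sub>L 'a)"

lemma lrmul_one [simp]:
  "lmul (1 :: 'a multiplier) = id_blinfun" "rmul (1 :: 'a multiplier) = id_blinfun"
  unfolding one_multiplier_def by (subst mk_multiplier; simp)+

instance
  by standard (rule multiplier_eqI; simp)+

end

instance multiplier :: (cstar_algebra) banach
proof
  fix X :: "nat \<Rightarrow> 'a multiplier" assume X: "Cauchy X"
  have nr: "norm m = norm (rmul m)" for m :: "'a multiplier"
    by (simp add: norm_multiplier_def norm_lmul_eq_norm_rmul)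
  have "Cauchy (\<lambda>n. lmul (X n))"
    using X by (simp add: Cauchy_iff norm_multiplier_def)
  then obtain L where L: "(\<lambda>n. lmul (X n)) \<longlonglongrightarrow> L"
    using Cauchy_convergent_iff convergent_def by blast
  have "Cauchy (\<lambda>n. rmul (X n))"
    using X by (simp add: Cauchy_iff nr)
  then obtain R where R: "(\<lambda>n. rmul (X n)) \<longlonglongrightarrow> R"
    using Cauchy_convergent_iff convergent_def by blast
  have "a * blinfun_apply L b = blinfun_apply R a * b" for a b
  proof (rule LIMSEQ_unique)
    show "(\<lambda>n. a * lmul (X n) b) \<longlonglongrightarrow> a * blinfun_apply L b"
      by (intro tendsto_intros L)
    show "(\<lambda>n. a * lmul (X n) b) \<longlonglongrightarrow> blinfun_apply R a * b"
      unfolding mult_lmul by (intro tendsto_intros R)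
  qed
  then have "lmul (mk_multiplier L R) = L" by (rule mk_multiplier)
  moreover have "(\<lambda>n. norm (lmul (X n) - L)) \<longlonglongrightarrow> 0"
    using L by (simp add: LIM_zero_iff tendsto_norm_zero_iff)
  ultimately have "(\<lambda>n. norm (X n - mk_multiplier L R)) \<longlonglongrightarrow> 0"
    by (simp add: norm_multiplier_def)
  then have "X \<longlonglongrightarrow> mk_multiplier L R"
    by (simp add: LIM_zero_iff tendsto_norm_zero_iff)
  then show "convergent X" by (auto simp: convergent_def)
qed

instantiation multiplier :: (cstar_algebra) cstar_algebra
begin

definition "c *\<^sub>C m = mk_multiplier (Blinfun ((*\<^sub>C) c) o\<^sub>L lmul m) (Blinfun ((*\<^sub>C) c) o\<^sub>L rmul m)"

text \<open>\<open>(L, R)\<^sup>* = (b \<mapsto> R(b\<^sup>*)\<^sup>*, b \<mapsto> L(b\<^sup>*)\<^sup>*)\<close>\<close>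

definition "star m = mk_multiplier (Blinfun star o\<^sub>L rmul m o\<^sub>L Blinfun star)
                                   (Blinfun star o\<^sub>L lmul m o\<^sub>L Blinfun star)"

lemma Blinfun_star_apply [simp]: "blinfun_apply (Blinfun star) (x::'a) = star x"
  by (simp add: bounded_linear_Blinfun_apply bounded_linear_star)

lemma Blinfun_scaleC_apply [simp]: "blinfun_apply (Blinfun ((*\<^sub>C) c)) (x::'a) = c *\<^sub>C x"
  by (simp add: bounded_linear_Blinfun_apply bounded_linear_scaleC)

lemma lrmul_scaleC [simp]:
  "blinfun_apply (lmul (c *\<^sub>C m :: 'a multiplier)) b = c *\<^sub>C lmul m b"
  "blinfun_apply (rmul (c *\<^sub>C m)) b = c *\<^sub>C rmul m b"
  unfolding scaleC_multiplier_def
  by (subst mk_multiplier; simp add: mult_scaleC_left mult_scaleC_right mult_lmul)+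

lemma lrmul_star [simp]:
  "blinfun_apply (lmul (star m :: 'a multiplier)) b = star (rmul m (star b))"
  "blinfun_apply (rmul (star m)) b = star (lmul m (star b))"
proof -
  have *: "a * star (rmul m (star b)) = star (lmul m (star a)) * b" for a b :: 'a
    using arg_cong[OF mult_lmul[of "star b" m "star a"], of star] by (simp add: star_mult)
  show "blinfun_apply (lmul (star m :: 'a multiplier)) b = star (rmul m (star b))"
    "blinfun_apply (rmul (star m)) b = star (lmul m (star b))"
    unfolding star_multiplier_def by (subst mk_multiplier; simp add: *)+
qed

lemma lmul_scaleC_arg: "lmul m (c *\<^sub>C b) = c *\<^sub>C lmul m b" for b :: 'a
  using Rep_multiplier[of m] by (auto simp: lmul_def double_centraliser_def split: prod.splits)

lemma rmul_scaleC_arg: "rmul m (c *\<^sub>C b) = c *\<^sub>C rmul m b" for b :: 'a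
  using Rep_multiplier[of m] by (auto simp: rmul_def double_centraliser_def split: prod.splits)

lemma norm_star_multiplier_le: "norm (star m) \<le> norm (m :: 'a multiplier)"
  unfolding norm_multiplier_def norm_lmul_eq_norm_rmul[of m]
proof (rule norm_blinfun_bound)
  fix b show "norm (lmul (star m) b) \<le> norm (rmul m) * norm b"
    using norm_blinfun[of "rmul m" "star b"] by simp
qed simp

instance
proof
  fix m n :: "'a multiplier" and c d :: complex and r :: real
  show "c *\<^sub>C (m + n) = c *\<^sub>C m + c *\<^sub>C n" "(c + d) *\<^sub>C m = c *\<^sub>C m + d *\<^sub>C m"
    "c *\<^sub>C d *\<^sub>C m = (c * d) *\<^sub>C m" "complex_of_real r *\<^sub>C m = r *\<^sub>R m"
    "(c *\<^sub>C m) * n = c *\<^sub>C (m * n)" "m * (c *\<^sub>C n) = c *\<^sub>C (m * n)"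
    by (rule multiplier_eqI; simp add: blinfun.bilinear_simps scaleC_add_right scaleC_add_left
        scaleC_scaleC scaleC_of_real lmul_scaleC_arg)+
  show "star (m + n) = star m + star n" "star (m * n) = star n * star m" "star (star m) = m"
    by (rule multiplier_eqI; simp add: blinfun.bilinear_simps star_add)+
  show "star (c *\<^sub>C m) = cnj c *\<^sub>C star m"
    by (rule multiplier_eqI) (simp add: star_scaleC)
  show ns: "norm (c *\<^sub>C m) = cmod c * norm m"
  proof (rule antisym)
    have le: "norm (d *\<^sub>C k) \<le> cmod d * norm k" for d and k :: "'a multiplier"
      unfolding norm_multiplier_def
    proof (rule norm_blinfun_bound)
      fix b show "norm (lmul (d *\<^sub>C k) b) \<le> cmod d * norm (lmul k) * norm b"
        using mult_left_mono[OF norm_blinfun[of "lmul k" b], of "cmod d"]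
        by (simp add: norm_scaleC mult.assoc)
    qed simp
    show "norm (c *\<^sub>C m) \<le> cmod c * norm m" by (rule le)
    show "cmod c * norm m \<le> norm (c *\<^sub>C m)"
    proof (cases "c = 0")
      case False
      have "m = inverse c *\<^sub>C c *\<^sub>C m"
        using False by (intro multiplier_eqI) (simp add: scaleC_scaleC scaleC_one)
      then have "norm m \<le> cmod (inverse c) * norm (c *\<^sub>C m)"
        using le[of "inverse c" "c *\<^sub>C m"] by simp
      then show ?thesis
        using False by (simp add: norm_divide field_simps)
    qed simp
  qed
  show "norm (star m * m) = (norm m)\<^sup>2"
  proof (rule antisym)
    have "norm (star m * m) \<le> norm (star m) * norm m" by (rule norm_mult_ineq)
    also have "\<dots> \<le> norm m * norm m"
      by (intro mult_right_mono norm_star_multiplier_le) simp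
    finally show "norm (star m * m) \<le> (norm m)\<^sup>2" by (simp add: power2_eq_square)
    have "norm m \<le> sqrt (norm (star m * m))"
      unfolding norm_multiplier_def[of m]
    proof (rule norm_blinfun_bound)
      fix b :: 'a
      have "(norm (lmul m b))\<^sup>2 = norm (star (lmul m b) * lmul m b)"
        by (simp add: cstar_identity)
      also have "star (lmul m b) * lmul m b = star b * lmul (star m * m) b"
        using mult_lmul[of "star b" "star m" "lmul m b"] by simp
      also have "norm \<dots> \<le> norm b * (norm (star m * m) * norm b)"
        unfolding norm_multiplier_def
        by (rule order_trans[OF norm_mult_ineq]) (simp add: mult_left_mono norm_blinfun del: lrmul_mult)
      also have "\<dots> = (sqrt (norm (star m * m)) * norm b)\<^sup>2"
        by (simp add: power_mult_distrib power2_eq_square)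
      finally show "norm (lmul m b) \<le> sqrt (norm (star m * m)) * norm b"
        by (rule power2_le_imp_le) simp
    qed simp
    then show "(norm m)\<^sup>2 \<le> norm (star m * m)"
      using power_mono[of "norm m" "sqrt (norm (star m * m))" 2] by simp
  qed
qed

end

text \<open>The canonical embedding of \<open>B\<close>; below, membership in \<open>B\<close> means membership in its range.\<close>

definition inclM :: "'b::cstar_algebra \<Rightarrow> 'b multiplier" where
  "inclM b = mk_multiplier (blinfun_mult_right b) (blinfun_mult_left b)"

lemma inclM_apply [simp]:
  "blinfun_apply (lmul (inclM b)) x = b * x" "blinfun_apply (rmul (inclM b)) x = x * b"
  unfolding inclM_def by (subst mk_multiplier; simp add: mult.assoc)+

lemma star_hom_inclM: "star_hom inclM"
  unfolding star_hom_def
  by (intro conjI allI; rule multiplier_eqI;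
      simp add: blinfun.bilinear_simps algebra_simps mult_scaleC_left star_mult)

lemma norm_inclM [simp]: "norm (inclM b) = norm b"
proof (rule antisym)
  show "norm (inclM b) \<le> norm b"
    unfolding norm_multiplier_def by (rule norm_blinfun_bound) (simp_all add: norm_mult_ineq)
  show "norm b \<le> norm (inclM b)"
    by (rule norm_le_if_mult_right)
      (use norm_blinfun[of "lmul (inclM b)"] in \<open>simp_all add: norm_multiplier_def\<close>)
qed

text \<open>The strict topology: the coarsest one making all \<open>m \<mapsto> m b\<close> and \<open>m \<mapsto> b m\<close> norm continuous.\<close>

definition strict_topology :: "'b::cstar_algebra multiplier topology" where
  "strict_topology = topology_generated_by
     ({{m. lmul m b \<in> U} | b U. open U} \<union> {{m. rmul m b \<in> U} | b U. open U})"

definition unitaries :: "'m::{cstar_algebra, monoid_mult} set \<Rightarrow> 'm set" where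
  "unitaries D = {u \<in> D. star u * u = 1 \<and> u * star u = 1}"

text \<open>
  \<open>U(1 + B)\<close>: for \<open>b \<in> B\<close>, the element \<open>1 + b\<close> of the proper unitization is unitary iff its image
  in \<open>M(B)\<close> is, and on scalar part \<open>1\<close> the map to \<open>M(B)\<close> is injective and isometric
  on differences (also when \<open>B\<close> is unital).
\<close>

definition unitaries_one_plus :: "'b::cstar_algebra multiplier set" where
  "unitaries_one_plus = unitaries {1 + inclM b | b. True}"


section \<open>Contractivity of \<open>*\<close>-homomorphisms\<close>

text \<open>
  Needed only to know that the extension of an automorphism to \<open>M(B)\<close> defined afterwards is
  well defined, since multipliers are bounded by definition.
\<close>

definition inverse_of :: "'m::monoid_mult \<Rightarrow> 'm \<Rightarrow> bool" where
  "inverse_of X y \<longleftrightarrow> X * y = 1 \<and> y * X = 1"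

lemma star_one: "star 1 = (1::'m::{cstar_algebra, monoid_mult})"
  by (metis mult_1_left mult_1_right star_mult star_star)

lemma norm_one_le: "norm (1::'m::{cstar_algebra, monoid_mult}) \<le> 1"
  using cstar_identity[of "1::'m"]
  by (cases "norm (1::'m) = 0") (simp_all add: star_one power2_eq_square)

lemma inverse_of_average:
  fixes z :: "'m::{cstar_algebra, monoid_mult}"
  assumes "inverse_of X (1 - z)" "inverse_of Y (1 + z)"
  shows "inverse_of ((1/2) *\<^sub>R (X + Y)) (1 - z * z)"
proof -
  have *: "1 - z * z = (1 - z) * (1 + z)" "1 - z * z = (1 + z) * (1 - z)"
    by (simp_all add: algebra_simps)
  have X: "X * (1 - z) = 1" "(1 - z) * X = 1" and Y: "Y * (1 + z) = 1" "(1 + z) * Y = 1"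
    using assms by (simp_all only: inverse_of_def)
  have "X * (1 - z * z) = (X * (1 - z)) * (1 + z)" "(1 - z * z) * X = (1 + z) * ((1 - z) * X)"
    by (simp only: *(1) mult.assoc) (simp only: *(2) mult.assoc)
  then have "X * (1 - z * z) = 1 + z" "(1 - z * z) * X = 1 + z"
    by (simp_all only: X mult_1_left mult_1_right)
  moreover have "Y * (1 - z * z) = (Y * (1 + z)) * (1 - z)" "(1 - z * z) * Y = (1 - z) * ((1 + z) * Y)"
    by (simp only: *(2) mult.assoc) (simp only: *(1) mult.assoc)
  then have "Y * (1 - z * z) = 1 - z" "(1 - z * z) * Y = 1 - z"
    by (simp_all only: Y mult_1_left mult_1_right)
  ultimately show ?thesis
    by (simp add: inverse_of_def distrib_left distrib_right flip: scaleR_add_right)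
qed

lemma scaleC_minus_left: "(- c) *\<^sub>C x = - (c *\<^sub>C (x::'a::cstar_algebra))"
proof -
  have "0 *\<^sub>C x = 0" using scaleC_of_real[of 0 x] by simp
  then show ?thesis using scaleC_add_left[of "- c" c x] by (simp add: eq_neg_iff_add_eq_0)
qed

lemma scaleC_minus_right: "c *\<^sub>C (- x) = - (c *\<^sub>C (x::'a::cstar_algebra))"
  using bounded_linear.linear[OF bounded_linear_scaleC] by (rule linear_neg)

lemma scaleC_diff_left: "(c - d) *\<^sub>C x = c *\<^sub>C x - d *\<^sub>C (x::'a::cstar_algebra)"
  using scaleC_add_left[of c "- d" x] by (simp add: scaleC_minus_left)

lemma continuous_resolvent:
  fixes k :: "'m::{cstar_algebra, monoid_mult}"
  assumes S: "\<And>l. l \<in> D \<Longrightarrow> inverse_of (S l) (1 - l *\<^sub>C k)"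
  shows "continuous_on D S"
  unfolding continuous_on_def
proof
  fix m assume m: "m \<in> D"
  define K where "K = norm (k * S m)"
  have K: "0 \<le> K" by (simp add: K_def)
  have res: "S l - S m = (l - m) *\<^sub>C (S l * (k * S m))" if l: "l \<in> D" for l
  proof -
    have "S l * (P - Q) * S m = S l * (P * S m) - (S l * Q) * S m" for P Q
      by (simp add: right_diff_distrib left_diff_distrib mult.assoc)
    moreover have "S l * (1 - l *\<^sub>C k) = 1" "(1 - m *\<^sub>C k) * S m = 1"
      using S[OF l] S[OF m] by (simp_all only: inverse_of_def)
    ultimately have "S l * ((1 - m *\<^sub>C k) - (1 - l *\<^sub>C k)) * S m = S l * 1 - 1 * S m"
      by presburger
    then have "S l * ((1 - m *\<^sub>C k) - (1 - l *\<^sub>C k)) * S m = S l - S m"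
      by (simp only: mult_1_left mult_1_right)
    moreover have "(1 - m *\<^sub>C k) - (1 - l *\<^sub>C k) = (l - m) *\<^sub>C k"
      by (simp add: scaleC_diff_left)
    ultimately show ?thesis
      by (simp only: mult_scaleC_left mult_scaleC_right mult.assoc)
  qed
  have bound: "norm (S l - S m) \<le> 2 * (cmod (l - m) * (K * norm (S m)))"
    if l: "l \<in> D" and small: "cmod (l - m) * K \<le> 1/2" for l
  proof -
    have "norm (S l - S m) \<le> cmod (l - m) * (norm (S l) * K)"
      by (simp only: res[OF l] norm_scaleC K_def mult_left_mono norm_mult_ineq norm_ge_zero)
    also have "\<dots> = cmod (l - m) * K * norm (S l)" by simp
    also have "\<dots> \<le> cmod (l - m) * K * (norm (S m) + norm (S l - S m))"
      using K norm_triangle_sub[of "S l" "S m"] by (intro mult_left_mono) auto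
    also have "\<dots> \<le> cmod (l - m) * K * norm (S m) + 1/2 * norm (S l - S m)"
      using mult_right_mono[OF small, of "norm (S l - S m)"] by (simp add: algebra_simps)
    finally show ?thesis by simp
  qed
  have "((\<lambda>l. cmod (l - m) * K) \<longlongrightarrow> cmod (m - m) * K) (at m within D)"
    by (intro tendsto_intros)
  then have "\<forall>\<^sub>F l in at m within D. cmod (l - m) * K < 1/2"
    by (rule order_tendstoD) simp
  moreover have "\<forall>\<^sub>F l in at m within D. l \<in> D"
    by (simp add: eventually_at_filter)
  ultimately have "\<forall>\<^sub>F l in at m within D.
      norm (S l - S m) \<le> 2 * (cmod (l - m) * (K * norm (S m)))"
    by eventually_elim (rule bound; simp)
  moreover have "((\<lambda>l. 2 * (cmod (l - m) * (K * norm (S m)))) \<longlongrightarrow>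
      2 * (cmod (m - m) * (K * norm (S m)))) (at m within D)"
    by (intro tendsto_intros)
  ultimately have "((\<lambda>l. S l - S m) \<longlongrightarrow> 0) (at m within D)"
    using Lim_null_comparison[where g = "\<lambda>l. 2 * (cmod (l - m) * (K * norm (S m)))"] by simp
  then show "(S \<longlongrightarrow> S m) (at m within D)" by (simp add: LIM_zero_iff)
qed

lemma self_adjoint_resolvent_contradiction:
  fixes k :: "'m::{cstar_algebra, monoid_mult}"
  assumes k: "norm k = 1" "star k = k"
    and S: "\<And>l. cmod l \<le> 1 \<Longrightarrow> inverse_of (S l) (1 - l *\<^sub>C k)"
  shows False
proof -
  have sp: "star (k ^ n) = k ^ n" for n
    by (induction n) (simp_all add: star_one star_mult k power_commutes)
  have np: "norm (k ^ (2 ^ m)) = 1" for m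
  proof (induction m)
    case (Suc m)
    have "k ^ (2 ^ Suc m) = star (k ^ (2 ^ m)) * k ^ (2 ^ m)"
      by (simp add: sp mult_2 power_add)
    then show ?case using Suc by (simp only: cstar_identity) simp
  qed (simp add: k)
  have "continuous_on (cball 0 1) S"
    by (rule continuous_resolvent[of _ S k]) (simp add: S)
  then have "uniformly_continuous_on (cball 0 1) S"
    by (rule compact_uniformly_continuous) simp
  then obtain d where d: "d > 0"
    "\<And>l m. \<lbrakk>l \<in> cball 0 1; m \<in> cball 0 1; dist m l < d\<rbrakk> \<Longrightarrow> dist (S m) (S l) < 1/8"
    unfolding uniformly_continuous_on_def by (metis zero_less_divide_1_iff zero_less_numeral)
  define t where "t = max (1 - d/2) (1/2)"
  have t: "0 < t" "t < 1" "1 - t < d" using d by (auto simp: t_def)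
  have main: "\<exists>X Y. inverse_of X (1 - l *\<^sub>C k ^ (2 ^ m)) \<and>
      inverse_of Y (1 - (of_real (t ^ (2 ^ m)) * l) *\<^sub>C k ^ (2 ^ m)) \<and> norm (X - Y) \<le> 1/8"
    if "cmod l \<le> 1" for l m
    using that
  proof (induction m arbitrary: l)
    case 0
    have tl: "cmod (of_real t * l) \<le> 1"
      using 0 t by (simp add: norm_mult mult_le_one)
    have "dist (of_real t * l) l = (1 - t) * cmod l"
    proof -
      have "of_real t * l - l = of_real (t - 1) * l" by (simp add: algebra_simps)
      then show ?thesis using t by (simp only: dist_norm norm_mult norm_of_real) simp
    qed
    also have "\<dots> \<le> (1 - t) * 1" using 0 t by (intro mult_left_mono) auto
    finally have "dist (S (of_real t * l)) (S l) < 1/8"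
      using 0 tl t by (intro d(2)) auto
    then show ?case
      using S[OF 0] S[OF tl]
      by (intro exI[of _ "S l"] exI[of _ "S (of_real t * l)"]) (simp add: dist_norm norm_minus_commute)
  next
    case (Suc m)
    define w where "w = csqrt l"
    define z where "z = k ^ (2 ^ m)"
    define r :: complex where "r = of_real (t ^ (2 ^ m))"
    have w: "w * w = l" by (simp add: w_def flip: power2_eq_square)
    have cw: "cmod w \<le> 1" using Suc.prems by (simp add: w_def norm_csqrt)
    obtain X1 Y1 where 1: "inverse_of X1 (1 - w *\<^sub>C z)" "inverse_of Y1 (1 - (r * w) *\<^sub>C z)"
      "norm (X1 - Y1) \<le> 1/8"
      using Suc.IH[OF cw] unfolding z_def r_def by blast
    obtain X2 Y2 where 2: "inverse_of X2 (1 - (- w) *\<^sub>C z)" "inverse_of Y2 (1 - (r * (- w)) *\<^sub>C z)"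
      "norm (X2 - Y2) \<le> 1/8"
      using Suc.IH[of "- w"] cw unfolding z_def r_def by auto
    have zz: "k ^ (2 ^ Suc m) = z * z" by (simp add: z_def mult_2 power_add)
    have rr: "of_real (t ^ (2 ^ Suc m)) = r * r" by (simp add: r_def mult_2 power_add)
    have sq: "(a *\<^sub>C z) * (a *\<^sub>C z) = (a * a) *\<^sub>C (z * z)" for a
      by (simp add: mult_scaleC_left mult_scaleC_right scaleC_scaleC)
    have X: "inverse_of ((1/2) *\<^sub>R (X1 + X2)) (1 - l *\<^sub>C (z * z))"
      using inverse_of_average[OF 1(1), of X2] 2(1) by (simp add: scaleC_minus_left sq w)
    have rw: "(r * w) * (r * w) = r * r * l" by (simp flip: w)
    have Y: "inverse_of ((1/2) *\<^sub>R (Y1 + Y2)) (1 - (r * r * l) *\<^sub>C (z * z))"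
      using inverse_of_average[OF 1(2), of Y2] 2(2) by (simp add: scaleC_minus_left sq rw)
    have "(1/2) *\<^sub>R (X1 + X2) - (1/2) *\<^sub>R (Y1 + Y2) = (1/2) *\<^sub>R ((X1 - Y1) + (X2 - Y2))"
      by (simp add: algebra_simps)
    then have "norm ((1/2) *\<^sub>R (X1 + X2) - (1/2) *\<^sub>R (Y1 + Y2)) = 1/2 * norm ((X1 - Y1) + (X2 - Y2))"
      by simp
    also have "\<dots> \<le> 1/8" using 1(3) 2(3) norm_triangle_ineq[of "X1 - Y1" "X2 - Y2"] by simp
    finally show ?case unfolding zz rr using X Y by blast
  qed
  have "(\<lambda>n. t ^ n) \<longlonglongrightarrow> 0" using t by (simp add: LIMSEQ_power_zero)
  then have "\<forall>\<^sub>F n in sequentially. t ^ n < 1/8" by (rule order_tendstoD) simp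
  then obtain m where "\<And>n. n \<ge> m \<Longrightarrow> t ^ n < 1/8" by (auto simp: eventually_sequentially)
  then have tm: "t ^ (2 ^ m) < 1/8" by (simp add: less_imp_le)
  define z where "z = k ^ (2 ^ m)"
  define e where "e = t ^ (2 ^ m)"
  obtain X Y where X: "inverse_of X (1 - z)" and Y: "inverse_of Y (1 - e *\<^sub>R z)"
    and XY: "norm (X - Y) \<le> 1/8"
    using main[of 1 m, unfolded mult_1_right scaleC_of_real scaleC_one, folded z_def e_def]
    by auto
  have e: "0 \<le> e" "e < 1/8" using tm t by (auto simp: e_def)
  have nz: "norm z = 1" by (simp add: z_def np)
  have "Y - 1 = e *\<^sub>R (Y * z)" using Y by (simp add: inverse_of_def algebra_simps)
  then have "norm (Y - 1) \<le> e * norm Y"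
    using e mult_left_mono[OF norm_mult_ineq[of Y z], of e] nz by simp
  also have "\<dots> \<le> 1/8 * (1 + norm (Y - 1))"
    using e norm_triangle_sub[of Y 1] norm_one_le[where 'm = 'm] by (intro mult_mono) auto
  finally have Y1: "norm (Y - 1) \<le> 1/7" by simp
  have X1: "norm (X - 1) \<le> 1/8 + 1/7"
    using norm_triangle_ineq[of "X - Y" "Y - 1"] XY Y1 by simp
  have "z = (X - 1) - (X - 1) * z" using X by (simp add: inverse_of_def algebra_simps)
  then have "norm z \<le> norm (X - 1) + norm ((X - 1) * z)" by (metis norm_triangle_ineq4)
  also have "\<dots> \<le> norm (X - 1) + norm (X - 1)"
    using norm_mult_ineq[of "X - 1" z] nz by simp
  finally show False using X1 nz by simp
qed

lemma quasi_inverse: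
  fixes z :: "'a::cstar_algebra"
  assumes "norm z < 1"
  obtains r where "r = z + z * r" "r = z + r * z"
proof -
  define p where "p n = (((*) z) ^^ n) z" for n
  have p_Suc: "p (Suc n) = z * p n" for n by (simp add: p_def)
  have p_Suc': "p (Suc n) = p n * z" for n
    by (induction n) (simp add: p_def, metis p_Suc mult.assoc)
  have "norm (p n) \<le> norm z ^ n" for n
  proof (induction n)
    case (Suc n)
    then show ?case
      unfolding p_Suc by (simp add: order_trans[OF norm_mult_ineq] mult_left_mono)
  qed (use assms in \<open>simp add: p_def\<close>)
  then have sm: "summable p"
    using summable_comparison_test'[of "\<lambda>n. norm z ^ n" 0 p] assms by (simp add: summable_geometric)
  have head: "suminf p = z + (\<Sum>n. p (Suc n))"
    using suminf_split_head[OF sm] by (simp add: p_def)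
  show thesis
  proof
    show "suminf p = z + z * suminf p"
      using head bounded_linear.suminf[OF bounded_linear_mult_right sm, of z] by (simp add: p_Suc)
    show "suminf p = z + suminf p * z"
      using head bounded_linear.suminf[OF bounded_linear_mult_left sm, of z] by (simp add: p_Suc')
  qed
qed

lemma star_hom_comp: "star_hom f \<Longrightarrow> star_hom g \<Longrightarrow> star_hom (\<lambda>x. g (f x))"
  by (simp add: star_hom_def)

lemma star_hom_bounded_lemma:
  fixes f :: "'a::cstar_algebra \<Rightarrow> 'b::cstar_algebra"
  assumes f: "star_hom f" and h: "star h = h" "norm h < norm (f h)"
  shows False
proof -
  define F where "F x = inclM (f x)" for x
  have F: "star_hom F" unfolding F_def by (rule star_hom_comp[OF f star_hom_inclM])
  define h' where "h' = inverse (norm (f h)) *\<^sub>R h"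
  have fh: "norm (f h) > 0" using h(2) norm_ge_zero[of h] by linarith
  have h': "norm h' < 1" "star h' = h'"
    using h fh by (simp_all add: h'_def star_scaleR field_simps)
  have FR: "F (r *\<^sub>R x) = r *\<^sub>R F x" for r x
    using F unfolding star_hom_def by (simp flip: scaleC_of_real)
  have "norm (F h') = 1" unfolding h'_def FR using fh by (simp add: F_def)
  moreover have "star (F h') = F h'"
    using F h'(2) unfolding star_hom_def by (auto dest: spec[of _ h'])
  moreover have ex: "\<exists>S. inverse_of S (1 - l *\<^sub>C F h')" if l: "cmod l \<le> 1" for l
  proof -
    have "norm (l *\<^sub>C h') < 1"
      using mult_right_mono[OF l norm_ge_zero[of h']] h'(1) by (simp add: norm_scaleC)
    then obtain r where r: "r = l *\<^sub>C h' + l *\<^sub>C h' * r" "r = l *\<^sub>C h' + r * l *\<^sub>C h'"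
      by (rule quasi_inverse)
    have "F (l *\<^sub>C h' + l *\<^sub>C h' * r) = l *\<^sub>C F h' + l *\<^sub>C F h' * F r"
      "F (l *\<^sub>C h' + r * l *\<^sub>C h') = l *\<^sub>C F h' + F r * l *\<^sub>C F h'"
      using F by (simp_all only: star_hom_def)
    then have "F r = l *\<^sub>C F h' + l *\<^sub>C F h' * F r" "F r = l *\<^sub>C F h' + F r * l *\<^sub>C F h'"
      unfolding r[symmetric] .
    then have "inverse_of (1 + F r) (1 - l *\<^sub>C F h')"
      by (simp add: inverse_of_def algebra_simps)
    then show ?thesis by blast
  qed
  have "inverse_of (SOME S. inverse_of S (1 - l *\<^sub>C F h')) (1 - l *\<^sub>C F h')"
    if "cmod l \<le> 1" for l
    by (rule someI_ex[OF ex[OF that]])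
  ultimately show False
    by (rule self_adjoint_resolvent_contradiction)
qed

lemma star_hom_norm_le:
  fixes f :: "'a::cstar_algebra \<Rightarrow> 'b::cstar_algebra"
  assumes f: "star_hom f"
  shows "norm (f x) \<le> norm x"
proof -
  have "norm (f (star x * x)) \<le> norm (star x * x)"
    using star_hom_bounded_lemma[OF f, of "star x * x"] by (force simp: star_mult)
  moreover have "f (star x * x) = star (f x) * f x" using f by (simp add: star_hom_def)
  ultimately have "(norm (f x))\<^sup>2 \<le> (norm x)\<^sup>2" by (simp add: cstar_identity)
  then show ?thesis by (rule power2_le_imp_le) simp
qed

lemma star_hom_bounded_linear: "star_hom f \<Longrightarrow> bounded_linear f"
  by (rule bounded_linear_intro[where K = 1])
    (auto simp: star_hom_def star_hom_norm_le simp flip: scaleC_of_real)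


section \<open>Actions and cocycle representations\<close>

text \<open>The extension of an automorphism \<open>\<theta>\<close> of \<open>B\<close> to \<open>M(B)\<close>.\<close>

definition extendM :: "('b::cstar_algebra \<Rightarrow> 'b) \<Rightarrow> 'b multiplier \<Rightarrow> 'b multiplier" where
  "extendM \<theta> m = mk_multiplier (Blinfun (\<lambda>b. \<theta> (lmul m (inv \<theta> b))))
                               (Blinfun (\<lambda>b. \<theta> (rmul m (inv \<theta> b))))"

lemma star_aut_inv:
  assumes "star_aut \<theta>"
  shows "star_aut (inv \<theta>)"
proof -
  have b: "bij \<theta>" and h: "star_hom \<theta>" using assms by (auto simp: star_aut_def)
  have i: "inv \<theta> y = x" if "y = \<theta> x" for x y
    using b that by (simp add: bij_is_inj inv_f_f)
  have s: "\<theta> (inv \<theta> y) = y" for y using b by (simp add: bij_is_surj surj_f_inv_f)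
  have "star_hom (inv \<theta>)"
    unfolding star_hom_def by (intro conjI allI; rule i) (use h in \<open>simp_all add: star_hom_def s\<close>)
  then show ?thesis using b by (simp add: star_aut_def bij_imp_bij_inv)
qed

lemma extendM_apply:
  assumes "star_aut \<theta>"
  shows "lmul (extendM \<theta> m) b = \<theta> (lmul m (inv \<theta> b))" "rmul (extendM \<theta> m) b = \<theta> (rmul m (inv \<theta> b))"
proof -
  have bl: "bounded_linear \<theta>" "bounded_linear (inv \<theta>)"
    using assms star_aut_inv[OF assms] by (auto simp: star_aut_def intro: star_hom_bounded_linear)
  have B: "blinfun_apply (Blinfun (\<lambda>b. \<theta> (blinfun_apply T (inv \<theta> b)))) b = \<theta> (T (inv \<theta> b))"
    for T :: "'a \<Rightarrow>\<^sub>L 'a" and b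
    by (rule bounded_linear_Blinfun_apply[THEN fun_cong],
        rule bounded_linear_compose[OF bl(1) bounded_linear_compose[OF blinfun.bounded_linear_right bl(2)]])
  have s: "\<theta> (inv \<theta> y) = y" for y
    using assms by (simp add: star_aut_def bij_is_surj surj_f_inv_f)
  have m: "\<theta> (x * y) = \<theta> x * \<theta> y" for x y
    using assms by (simp add: star_aut_def star_hom_def)
  have c: "a * \<theta> (lmul m (inv \<theta> b)) = \<theta> (rmul m (inv \<theta> a)) * b" for a b
    using arg_cong[OF mult_lmul[of "inv \<theta> a" m "inv \<theta> b"], of \<theta>] by (simp add: m s)
  show "lmul (extendM \<theta> m) b = \<theta> (lmul m (inv \<theta> b))" "rmul (extendM \<theta> m) b = \<theta> (rmul m (inv \<theta> b))"
    unfolding extendM_def by (subst mk_multiplier; simp add: B c)+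
qed

lemma extendM_inclM: "star_aut \<theta> \<Longrightarrow> extendM \<theta> (inclM b) = inclM (\<theta> b)"
  by (rule multiplier_eqI)
    (simp add: extendM_apply, simp add: star_aut_def star_hom_def bij_is_surj surj_f_inv_f)

text \<open>
  Groups are written additively because the library's (not necessarily commutative) topological
  groups are; \<open>g + h\<close> is the product \<open>gh\<close>.
\<close>

definition continuous_action ::
    "('g::topological_group_add \<Rightarrow> 'a::cstar_algebra \<Rightarrow> 'a) \<Rightarrow> bool" where
  "continuous_action \<alpha> \<longleftrightarrow>
     (\<forall>g. star_aut (\<alpha> g)) \<and> (\<forall>g h. \<alpha> (g + h) = \<alpha> g \<circ> \<alpha> h) \<and>
     (\<forall>a. continuous_on UNIV (\<lambda>g. \<alpha> g a))"

definition cocycle_action ::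
    "('g \<Rightarrow> 'b::cstar_algebra \<Rightarrow> 'b) \<Rightarrow> ('g \<Rightarrow> 'b multiplier) \<Rightarrow> 'g \<Rightarrow> 'b multiplier \<Rightarrow> 'b multiplier" where
  "cocycle_action \<beta> u g x = u g * extendM (\<beta> g) x * star (u g)"

definition cocycle_rep ::
    "('g::topological_group_add \<Rightarrow> 'a::cstar_algebra \<Rightarrow> 'a) \<Rightarrow> ('g \<Rightarrow> 'b::cstar_algebra \<Rightarrow> 'b) \<Rightarrow>
     ('a \<Rightarrow> 'b multiplier) \<Rightarrow> ('g \<Rightarrow> 'b multiplier) \<Rightarrow> bool" where
  "cocycle_rep \<alpha> \<beta> \<phi> u \<longleftrightarrow>
     star_hom \<phi> \<and>
     (\<forall>g. u g \<in> unitaries UNIV) \<and> continuous_map euclidean strict_topology u \<and>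
     (\<forall>g h. u (g + h) = u g * extendM (\<beta> g) (u h)) \<and>
     (\<forall>g a. cocycle_action \<beta> u g (\<phi> a) = \<phi> (\<alpha> g a))"

definition D_alg ::
    "('g \<Rightarrow> 'b::cstar_algebra \<Rightarrow> 'b) \<Rightarrow> ('a \<Rightarrow> 'b multiplier) \<Rightarrow> ('g \<Rightarrow> 'b multiplier) \<Rightarrow>
     'b multiplier set" where
  "D_alg \<beta> \<phi> u = {x. (\<forall>g. x - cocycle_action \<beta> u g x \<in> range inclM) \<and>
                    (\<forall>a. x * \<phi> a - \<phi> a * x \<in> range inclM)}"

text \<open>
  The uniform norm on \<open>K\<close>. A supremum, since attainment is not part of the definition; inserting
  \<open>0\<close> only matters for \<open>K = {}\<close>. It is only applied to differences of unitary-valued functions,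
  which are bounded by \<open>2\<close>.
\<close>

definition sup_norm_on :: "'g set \<Rightarrow> ('g \<Rightarrow> 'm::real_normed_vector) \<Rightarrow> real" where
  "sup_norm_on K f = Sup (insert 0 ((\<lambda>g. norm (f g)) ` K))"

definition strongly_asymp_unitarily_equiv ::
    "('g::topological_group_add \<Rightarrow> 'b::cstar_algebra \<Rightarrow> 'b) \<Rightarrow>
     ('a \<Rightarrow> 'b multiplier) \<times> ('g \<Rightarrow> 'b multiplier) \<Rightarrow>
     ('a \<Rightarrow> 'b multiplier) \<times> ('g \<Rightarrow> 'b multiplier) \<Rightarrow> bool" where
  "strongly_asymp_unitarily_equiv \<beta> = (\<lambda>(\<phi>, u) (\<psi>, v).
     \<exists>w :: real \<Rightarrow> 'b multiplier.
       continuous_on {0..} w \<and> (\<forall>t\<ge>0. w t \<in> unitaries_one_plus) \<and> w 0 = 1 \<and>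
       (\<forall>a. ((\<lambda>t. norm (\<psi> a - w t * \<phi> a * star (w t))) \<longlongrightarrow> 0) at_top) \<and>
       (\<forall>K. compact K \<longrightarrow>
         ((\<lambda>t. sup_norm_on K (\<lambda>g. v g - w t * u g * star (extendM (\<beta> g) (w t)))) \<longlongrightarrow> 0) at_top))"

end

theory Submission
  imports Defs
begin

text \<open>
  Write \<open>\<gamma>\<^sub>g = Ad(u\<^sub>g) \<circ> \<beta>\<^sub>g\<close>, an action of \<open>G\<close> on \<open>M(B)\<close>. Since
  \<open>w u\<^sub>g \<beta>\<^sub>g(w)\<^sup>* = w \<gamma>\<^sub>g(w)\<^sup>* u\<^sub>g\<close>, it suffices to find a norm-continuous path \<open>w\<close> in \<open>U(1 + B)\<close> with
  \<open>w\<^sub>0 = 1\<close> such that \<open>w\<^sub>t y \<gamma>\<^sub>g(w\<^sub>t)\<^sup>* - U\<^sub>t y \<gamma>\<^sub>g(U\<^sub>t)\<^sup>*\<close> tends to \<open>0\<close> in two cases: \<open>y = \<phi>(a)\<close> and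
  \<open>g\<close> neutral, for \<open>a\<close> in a dense sequence; and \<open>y = 1\<close>, uniformly for \<open>g\<close> in compact sets.
  In both cases \<open>U\<^sub>t y - y \<gamma>\<^sub>g(U\<^sub>t)\<close> lies in \<open>B\<close>, because \<open>U\<^sub>t\<close> belongs to \<open>D\<close>.

  The path \<open>U\<close> is cut at times \<open>\<tau>\<^sub>n\<close> into increments \<open>V\<close> close to \<open>1\<close>. The Cayley
  transform \<open>C\<close> plays the role of the exponential: \<open>V = C(k)\<close> for a small skew-adjoint \<open>k\<close>. For a
  self-adjoint contraction \<open>E\<close> in \<open>B\<close>, the unitary \<open>C(EkE)\<close> lies in \<open>1 + B\<close>, and \<open>w\<close> is the product
  of these unitaries over all increments up to time \<open>t\<close>. The formula
    \<open>C(k) y C(k')\<^sup>* = y + 2 (1 - k)\<^sup>-\<^sup>1 (k y - y k') (1 + k')\<^sup>-\<^sup>1\<close>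
  with \<open>k' = \<gamma>\<^sub>g(k)\<close> shows that replacing \<open>k\<close> by \<open>EkE\<close> changes the conjugate only slightly
  (\<open>cayley_compression_conj\<close>), provided that \<open>E y\<close> is close to \<open>y \<gamma>\<^sub>g(E)\<close> and \<open>E\<close> acts almost as a
  unit on \<open>k y - y k'\<close> and on two related elements; these elements lie in \<open>B\<close>. By induction on
  the number of increments, all of them can be compressed, uniformly on compact sets of parameters
  (\<open>compressed_conj\<close>).

  Such \<open>E\<close> come from an approximate unit of \<open>B\<close> that asymptotically commutes with \<open>\<phi>(A)\<close> and is
  asymptotically \<open>\<gamma>\<close>-invariant (\<open>qc_set_nonempty\<close>). It consists of convex combinations of a given
  approximate unit: the defects, such as \<open>[e\<^sub>n, \<phi>(a)]\<close> and \<open>\<gamma>\<^sub>g(e\<^sub>n) - e\<^sub>n\<close>, are bounded and tend to \<open>0\<close>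
  strictly, so that sparse subsequences of them are almost orthogonal and their Cesaro means tend to \<open>0\<close>
  in norm (\<open>small_convex_combination\<close>). As the conditions imposed on \<open>E\<close> are convex, elements that
  are good for \<open>t\<close> in successive intervals can be joined by line segments, which makes \<open>w\<close>
  continuous (\<open>exists_asymptotic_path\<close>).

  Uniformity in \<open>g\<close> needs the orbit maps \<open>g \<mapsto> \<gamma>\<^sub>g(U\<^sub>t)\<close> to be norm continuous. They are
  strictly continuous and constant modulo \<open>B\<close>, from which norm continuity follows by the Baire category
  theorem (\<open>continuous_\<gamma>_if_invariant_mod\<close>).
\<close>

section \<open>Norm estimates in unital \<open>C\<^sup>*\<close>-algebras\<close>

lemma star_diff: "star (x - y) = star x - star (y::'a::cstar_algebra)"
  by (rule linear_diff) (rule bounded_linear.linear[OF bounded_linear_star])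

lemma continuous_on_star:
  fixes f :: "'x::topological_space \<Rightarrow> 'a::cstar_algebra"
  shows "continuous_on S f \<Longrightarrow> continuous_on S (\<lambda>s. star (f s))"
  by (rule bounded_linear.continuous_on[OF bounded_linear_star])

lemma norm_mult_le:
  fixes x y :: "'m::real_normed_algebra"
  assumes "norm x \<le> a" "norm y \<le> b"
  shows "norm (x * y) \<le> a * b"
proof -
  have "0 \<le> a" using assms(1) norm_ge_zero[of x] by linarith
  then show ?thesis
    using norm_mult_ineq[of x y] mult_mono[OF assms] by fastforce
qed

lemma norm_unitary_le:
  fixes w :: "'m::{cstar_algebra, monoid_mult}"
  assumes "star w * w = 1"
  shows "norm w \<le> 1"
  using cstar_identity[of w] norm_one_le[where 'm = 'm] unfolding assms
  by (metis norm_ge_zero one_power2 power2_le_imp_le zero_le_one)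

lemma norm_conj_le:
  fixes w w' x :: "'m::{cstar_algebra, monoid_mult}"
  assumes "star w * w = 1" "star w' * w' = 1"
  shows "norm (w * x * star w') \<le> norm x"
  using norm_mult_le[OF norm_mult_le[OF norm_unitary_le[OF assms(1)] order_refl[of "norm x"]], of "star w'" 1]
    norm_unitary_le[OF assms(2)] by simp

section \<open>The Cayley transform\<close>

lemma inverse_of_unique:
  assumes "inverse_of X y" "inverse_of Y y"
  shows "X = Y"
  using assms unfolding inverse_of_def by (metis mult.assoc mult_1_left mult_1_right)

text \<open>
  The inverse \<open>(1 - x)\<^sup>-\<^sup>1\<close>; the choice is only meaningful when that inverse exists, in particular
  for \<open>norm x < 1\<close>.
\<close>

definition resolvent :: "'m::{cstar_algebra, monoid_mult} \<Rightarrow> 'm" where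
  "resolvent x = (SOME r. inverse_of r (1 - x))"

lemma inverse_of_resolvent:
  fixes x :: "'m::{cstar_algebra, monoid_mult}"
  assumes "norm x < 1"
  shows "inverse_of (resolvent x) (1 - x)"
proof -
  obtain r where r: "r = x + x * r" "r = x + r * x"
    using quasi_inverse[OF assms] .
  have "inverse_of (1 + r) (1 - x)"
    using r by (simp add: inverse_of_def algebra_simps)
  then show ?thesis unfolding resolvent_def by (rule someI)
qed

lemma resolvent_eqI:
  assumes "norm x < 1" "inverse_of r (1 - x)"
  shows "resolvent x = r"
  by (rule inverse_of_unique[OF inverse_of_resolvent[OF assms(1)] assms(2)])

lemma resolvent_mult:
  fixes x :: "'m::{cstar_algebra, monoid_mult}"
  assumes "norm x < 1"
  shows "resolvent x * x = resolvent x - 1" "x * resolvent x = resolvent x - 1"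
  using inverse_of_resolvent[OF assms] by (auto simp: inverse_of_def algebra_simps)

lemma norm_resolvent_le:
  fixes x :: "'m::{cstar_algebra, monoid_mult}"
  assumes "norm x \<le> c" "c < 1"
  shows "norm (resolvent x) \<le> 1 / (1 - c)"
proof -
  have "resolvent x = 1 + resolvent x * x"
    using resolvent_mult(1)[of x] assms by simp
  then have "norm (resolvent x) \<le> norm (1::'m) + norm (resolvent x * x)"
    by (metis norm_triangle_ineq)
  also have "norm (resolvent x * x) \<le> norm (resolvent x) * c"
    using norm_mult_ineq[of "resolvent x" x] assms(1) by (meson mult_left_mono norm_ge_zero order_trans)
  finally show ?thesis using assms norm_one_le[where 'm = 'm] by (simp add: field_simps)
qed

lemma resolvent_diff:
  fixes x y :: "'m::{cstar_algebra, monoid_mult}"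
  assumes "norm x < 1" "norm y < 1"
  shows "resolvent x - resolvent y = resolvent x * (x - y) * resolvent y"
proof -
  have "resolvent x * (x - y) * resolvent y = (resolvent x * x) * resolvent y - resolvent x * (y * resolvent y)"
    by (simp only: right_diff_distrib left_diff_distrib mult.assoc)
  then show ?thesis
    by (simp add: resolvent_mult assms right_diff_distrib left_diff_distrib)
qed

lemma resolvent_Lipschitz:
  fixes x y :: "'m::{cstar_algebra, monoid_mult}"
  assumes "norm x \<le> 1/2" "norm y \<le> 1/2"
  shows "norm (resolvent x - resolvent y) \<le> 4 * norm (x - y)"
proof -
  have "norm (resolvent x - resolvent y) = norm (resolvent x * (x - y) * resolvent y)"
    using assms by (subst resolvent_diff) auto
  also have "\<dots> \<le> norm (resolvent x) * norm (x - y) * norm (resolvent y)"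
    by (meson mult_right_mono norm_ge_zero norm_mult_ineq order_trans)
  also have "\<dots> \<le> 2 * norm (x - y) * 2"
    using norm_resolvent_le[OF assms(1)] norm_resolvent_le[OF assms(2)]
    by (intro mult_mono) auto
  finally show ?thesis by simp
qed

lemma continuous_on_resolvent:
  fixes f :: "'x::topological_space \<Rightarrow> 'm::{cstar_algebra, monoid_mult}"
  assumes f: "continuous_on S f" and le: "\<And>s. s \<in> S \<Longrightarrow> norm (f s) \<le> 1/2"
  shows "continuous_on S (\<lambda>s. resolvent (f s))"
proof -
  have "4-lipschitz_on {x::'m. norm x \<le> 1/2} resolvent"
    by (auto intro!: lipschitz_onI simp: dist_norm resolvent_Lipschitz)
  then have "continuous_on {x::'m. norm x \<le> 1/2} resolvent"
    by (rule lipschitz_on_continuous_on)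
  then show ?thesis by (rule continuous_on_compose2) (use f le in auto)
qed

text \<open>The Cayley transform \<open>(1 + k) (1 - k)\<^sup>-\<^sup>1\<close>.\<close>

definition cayley :: "'m::{cstar_algebra, monoid_mult} \<Rightarrow> 'm" where
  "cayley k = 2 *\<^sub>R resolvent k - 1"

text \<open>The inverse Cayley transform \<open>(V - 1) (V + 1)\<^sup>-\<^sup>1 = 1 - ((1 + V)/2)\<^sup>-\<^sup>1\<close>, for \<open>V\<close> close to \<open>1\<close>.\<close>

definition cayley_inv :: "'m::{cstar_algebra, monoid_mult} \<Rightarrow> 'm" where
  "cayley_inv V = 1 - resolvent ((1/2) *\<^sub>R (1 - V))"

lemma resolvent_0: "resolvent 0 = (1::'m::{cstar_algebra, monoid_mult})"
  by (rule resolvent_eqI) (auto simp: inverse_of_def)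

lemma cayley_0 [simp]: "cayley 0 = (1::'m::{cstar_algebra, monoid_mult})"
  by (simp add: cayley_def resolvent_0 scaleR_2)

lemma cayley_inv_1 [simp]: "cayley_inv 1 = (0::'m::{cstar_algebra, monoid_mult})"
  by (simp add: cayley_inv_def resolvent_0)

lemma star_resolvent_skew:
  fixes k :: "'m::{cstar_algebra, monoid_mult}"
  assumes k: "star k = - k" "norm k < 1"
  shows "star (resolvent k) * k = 1 - star (resolvent k)" "k * star (resolvent k) = 1 - star (resolvent k)"
proof -
  have "star (resolvent k * k) = star (resolvent k - 1)" "star (k * resolvent k) = star (resolvent k - 1)"
    using k(2) by (simp_all only: resolvent_mult)
  then have "- (k * star (resolvent k)) = star (resolvent k) - 1" "- (star (resolvent k) * k) = star (resolvent k) - 1"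
    by (simp_all add: star_mult star_diff star_one k(1))
  then show "star (resolvent k) * k = 1 - star (resolvent k)" "k * star (resolvent k) = 1 - star (resolvent k)"
    by (metis minus_diff_eq minus_minus)+
qed

lemma cayley_unitary:
  fixes k :: "'m::{cstar_algebra, monoid_mult}"
  assumes k: "star k = - k" "norm k < 1"
  shows "star (cayley k) * cayley k = 1" "cayley k * star (cayley k) = 1"
proof -
  let ?N = "resolvent k"
  have 1: "star ?N * (1 + k) = 1" "(1 + k) * star ?N = 1"
    using star_resolvent_skew[OF k] by (simp_all add: algebra_simps)
  have c: "cayley k = (1 + k) * ?N" "cayley k = ?N * (1 + k)"
    using resolvent_mult[OF k(2)] by (simp_all add: cayley_def algebra_simps scaleR_2)
  have s: "star (cayley k) = star ?N * (1 - k)" "star (cayley k) = (1 - k) * star ?N"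
    by (simp add: c(1) star_mult star_add star_one k) (simp add: c(2) star_mult star_add star_one k)
  have N: "(1 - k) * ?N = 1" "?N * (1 - k) = 1"
    using inverse_of_resolvent[OF k(2)] by (auto simp: inverse_of_def)
  have "star (cayley k) * cayley k = (1 - k) * (star ?N * (1 + k)) * ?N"
    by (subst s(2), subst c(1)) (simp only: mult.assoc)
  then show "star (cayley k) * cayley k = 1" by (simp add: 1 N)
  have "cayley k * star (cayley k) = ?N * ((1 + k) * star ?N) * (1 - k)"
    by (subst s(1), subst c(2)) (simp only: mult.assoc)
  then show "cayley k * star (cayley k) = 1" by (simp add: 1 N)
qed

context
  fixes V :: "'m::{cstar_algebra, monoid_mult}"
  assumes V: "star V * V = 1" "V * star V = 1" "norm (V - 1) \<le> 1/2"
begin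

lemma norm_cayley_inv: "norm (cayley_inv V) \<le> 1/2"
proof -
  let ?x = "(1/2) *\<^sub>R (1 - V)"
  have x: "norm ?x \<le> 1/4" using V(3) by (simp add: norm_minus_commute)
  have "norm (cayley_inv V) = norm (resolvent ?x * ?x)"
    unfolding cayley_inv_def using resolvent_mult(1)[of ?x] x norm_minus_commute[of 1 "resolvent ?x"]
    by (simp del: norm_scaleR mult_scaleR_right)
  also have "\<dots> \<le> norm (resolvent ?x) * norm ?x" by (rule norm_mult_ineq)
  also have "\<dots> \<le> (4/3) * (1/4)"
    using norm_resolvent_le[OF x] x by (intro mult_mono) auto
  finally show ?thesis by simp
qed

lemma cayley_cayley_inv: "cayley (cayley_inv V) = V"
proof -
  let ?x = "(1/2) *\<^sub>R (1 - V)"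
  have x: "norm ?x < 1" using V(3) by (simp add: norm_minus_commute)
  have h: "1 - ?x = (1/2) *\<^sub>R (1 + V)"
    by (simp add: algebra_simps flip: scaleR_add_left)
  have "inverse_of (1 - ?x) (1 - cayley_inv V)"
    using inverse_of_resolvent[OF x] by (simp add: cayley_inv_def inverse_of_def)
  then have "resolvent (cayley_inv V) = 1 - ?x"
    by (intro resolvent_eqI) (use norm_cayley_inv in auto)
  then show ?thesis by (simp add: cayley_def h)
qed

lemma star_cayley_inv: "star (cayley_inv V) = - cayley_inv V"
proof -
  let ?x = "(1/2) *\<^sub>R (1 - V)"
  let ?A = "resolvent ?x"
  have x: "norm ?x < 1" using V(3) by (simp add: norm_minus_commute)
  have h: "1 - ?x = (1/2) *\<^sub>R (1 + V)"
    by (simp add: algebra_simps flip: scaleR_add_left)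
  have "?A * (1/2) *\<^sub>R (1 + V) = 1" "(1/2) *\<^sub>R (1 + V) * ?A = 1"
    using inverse_of_resolvent[OF x] unfolding h inverse_of_def by auto
  then have "2 *\<^sub>R (?A * (1/2) *\<^sub>R (1 + V)) = 2 *\<^sub>R 1" "2 *\<^sub>R ((1/2) *\<^sub>R (1 + V) * ?A) = 2 *\<^sub>R 1"
    by simp_all
  then have A: "?A * (1 + V) = 2 *\<^sub>R 1" "(1 + V) * ?A = 2 *\<^sub>R 1"
    by (simp_all only: mult_scaleR_left mult_scaleR_right scaleR_scaleR) simp_all
  have "star ((1 + V) * ?A) = 2 *\<^sub>R 1" by (simp only: A star_scaleR star_one)
  then have sA: "star ?A * (1 + star V) = 2 *\<^sub>R 1"
    by (simp add: star_mult star_add star_one)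
  \<comment> \<open>Both sides use \<open>(1 + V\<^sup>*) V = 1 + V\<close>, so \<open>V\<close> turns the inverse of \<open>(1 + V)/2\<close> into its adjoint.\<close>
  have "star ?A * (1 + star V) * (V * ?A) = star ?A * ((1 + V) * ?A)"
    by (simp only: mult.assoc distrib_left distrib_right mult_1_left mult_1_right)
       (simp add: mult.assoc[symmetric] V add.commute)
  then have "V * ?A = star ?A" unfolding sA A by simp
  then have "star ?A = 2 *\<^sub>R 1 - ?A" using A(2) by (simp add: algebra_simps)
  then show ?thesis by (simp add: cayley_inv_def star_diff star_one scaleR_2)
qed

end

lemma continuous_on_cayley:
  assumes "continuous_on S f" "\<And>s. s \<in> S \<Longrightarrow> norm (f s) \<le> 1/2"
  shows "continuous_on S (\<lambda>s. cayley (f s))"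
  unfolding cayley_def by (intro continuous_intros continuous_on_resolvent assms)

lemma continuous_on_cayley_inv:
  fixes f :: "'x::topological_space \<Rightarrow> 'm::{cstar_algebra, monoid_mult}"
  assumes "continuous_on S f" "\<And>s. s \<in> S \<Longrightarrow> norm (f s - 1) \<le> 1/2"
  shows "continuous_on S (\<lambda>s. cayley_inv (f s))"
proof -
  have "norm ((1/2) *\<^sub>R (1 - f s)) \<le> 1/2" if "s \<in> S" for s
    using assms(2)[OF that] by (simp add: norm_minus_commute)
  then show ?thesis
    unfolding cayley_inv_def by (intro continuous_intros continuous_on_resolvent assms)
qed

lemma star_hom_resolvent:
  fixes \<theta> :: "'m::{cstar_algebra, monoid_mult} \<Rightarrow> 'n::{cstar_algebra, monoid_mult}"
  assumes \<theta>: "star_hom \<theta>" "\<theta> 1 = 1" and x: "norm x < 1"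
  shows "\<theta> (resolvent x) = resolvent (\<theta> x)"
proof -
  have l: "\<theta> (a - b) = \<theta> a - \<theta> b" for a b
    by (rule linear_diff) (rule bounded_linear.linear[OF star_hom_bounded_linear[OF \<theta>(1)]])
  have "\<theta> (resolvent x * (1 - x)) = \<theta> 1" "\<theta> ((1 - x) * resolvent x) = \<theta> 1"
    using inverse_of_resolvent[OF x] by (auto simp: inverse_of_def)
  then have "inverse_of (\<theta> (resolvent x)) (1 - \<theta> x)"
    using \<theta> by (simp add: inverse_of_def l star_hom_def)
  then show ?thesis
    using resolvent_eqI[of "\<theta> x"] star_hom_norm_le[OF \<theta>(1), of x] x by simp
qed

lemma star_hom_cayley:
  fixes \<theta> :: "'m::{cstar_algebra, monoid_mult} \<Rightarrow> 'n::{cstar_algebra, monoid_mult}"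
  assumes \<theta>: "star_hom \<theta>" "\<theta> 1 = 1" and x: "norm x < 1"
  shows "\<theta> (cayley x) = cayley (\<theta> x)"
proof -
  have "linear \<theta>" by (rule bounded_linear.linear[OF star_hom_bounded_linear[OF \<theta>(1)]])
  then show ?thesis
    by (simp add: cayley_def linear_diff linear_scale star_hom_resolvent[OF assms] \<theta>)
qed

lemma star_hom_cayley_inv:
  fixes \<theta> :: "'m::{cstar_algebra, monoid_mult} \<Rightarrow> 'n::{cstar_algebra, monoid_mult}"
  assumes \<theta>: "star_hom \<theta>" "\<theta> 1 = 1" and V: "norm (V - 1) \<le> 1/2"
  shows "\<theta> (cayley_inv V) = cayley_inv (\<theta> V)"
proof -
  have "linear \<theta>" by (rule bounded_linear.linear[OF star_hom_bounded_linear[OF \<theta>(1)]])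
  moreover have "norm ((1/2) *\<^sub>R (1 - V)) < 1" using V by (simp add: norm_minus_commute)
  ultimately show ?thesis
    by (simp add: cayley_inv_def linear_diff linear_scale star_hom_resolvent[OF \<theta>] \<theta>(2)
        del: norm_scaleR)
qed

text \<open>
  The conjugate \<open>C(k) y C(k')\<^sup>*\<close> differs from \<open>y\<close> by a two-sided multiple of the twisted
  commutator \<open>k y - y k'\<close>.
\<close>

lemma cayley_conj:
  fixes k k' y :: "'m::{cstar_algebra, monoid_mult}"
  assumes k: "norm k < 1" and k': "star k' = - k'" "norm k' < 1"
  shows "cayley k * y * star (cayley k') =
    y + 2 *\<^sub>R (resolvent k * (k * y - y * k') * star (resolvent k'))"
proof -
  let ?N = "resolvent k" and ?N' = "star (resolvent k')"
  have "?N * (k * y - y * k') * ?N' = (?N * k) * y * ?N' - ?N * y * (k' * ?N')"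
    by (simp only: right_diff_distrib left_diff_distrib mult.assoc)
  also have "\<dots> = 2 *\<^sub>R (?N * y * ?N') - y * ?N' - ?N * y"
    unfolding resolvent_mult[OF k] star_resolvent_skew[OF k']
    by (simp add: algebra_simps scaleR_2)
  finally have *: "?N * (k * y - y * k') * ?N' = 2 *\<^sub>R (?N * y * ?N') - y * ?N' - ?N * y" .
  show ?thesis
    unfolding * cayley_def star_diff star_scaleR star_one by (simp add: algebra_simps)
qed

lemma compression_skew:
  fixes E k :: "'m::cstar_algebra"
  assumes E: "star E = E" "norm E \<le> 1" and k: "star k = - k" "norm k \<le> c"
  shows "star (E * k * E) = - (E * k * E)" "norm (E * k * E) \<le> c"
proof -
  show "star (E * k * E) = - (E * k * E)"
    by (simp add: star_mult E k mult.assoc)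
  have c: "0 \<le> c" using k(2) norm_ge_zero[of k] by linarith
  have "norm (E * k * E) \<le> norm E * norm k * norm E"
    by (meson mult_right_mono norm_ge_zero norm_mult_ineq order_trans)
  also have "\<dots> \<le> 1 * c * 1"
    using E k c by (intro mult_mono) auto
  finally show "norm (E * k * E) \<le> c" by simp
qed

text \<open>
  The key estimate. In the application, \<open>E\<close> is part of an approximate unit, the primed elements are images under
  an automorphism, and all five quantities on the right are small; only \<open>d\<close> and its multiples have to be absorbed
  by \<open>E\<close>, and no commutation of \<open>E\<close> with \<open>k\<close> is required.
\<close>

lemma cayley_compression_conj:
  fixes E E' k k' y :: "'m::{cstar_algebra, monoid_mult}"
  assumes E: "star E = E" "norm E \<le> 1" and E': "star E' = E'" "norm E' \<le> 1"
    and k: "star k = - k" "norm k \<le> 1/2" and k': "star k' = - k'" "norm k' \<le> 1/2"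
  defines "d \<equiv> k * y - y * k'"
  shows "norm (cayley (E * k * E) * y * star (cayley (E' * k' * E')) - cayley k * y * star (cayley k'))
    \<le> 16 * (norm (E * y - y * E') + norm (E * d - d) + norm (d * E' - d)
      + norm (E * (resolvent k * d) - resolvent k * d)
      + norm (d * star (resolvent k') * E' - d * star (resolvent k')))"
    (is "norm ?lhs \<le> 16 * (?c + ?d1 + ?d2 + ?x1 + ?x2)")
proof -
  let ?\<kappa> = "E * k * E" and ?\<kappa>' = "E' * k' * E'"
  let ?M = "resolvent k" and ?M' = "star (resolvent k')"
  let ?Q = "resolvent ?\<kappa>" and ?Q' = "star (resolvent ?\<kappa>')"
  let ?\<delta> = "?\<kappa> * y - y * ?\<kappa>'"
  note \<kappa> = compression_skew[OF E k] and \<kappa>' = compression_skew[OF E' k']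
  have lt: "norm k < 1" "norm k' < 1" "norm ?\<kappa> < 1" "norm ?\<kappa>' < 1"
    using k k' \<kappa>(2) \<kappa>'(2) by auto
  have M: "norm ?M \<le> 2" "norm ?M' \<le> 2" "norm ?Q \<le> 2" "norm ?Q' \<le> 2"
    using norm_resolvent_le[OF k(2)] norm_resolvent_le[OF k'(2)]
      norm_resolvent_le[OF \<kappa>(2)] norm_resolvent_le[OF \<kappa>'(2)] by simp_all
  have Ek: "norm (E * k) \<le> 1/2" "norm (k' * E') \<le> 1/2"
    using norm_mult_le[OF E(2) k(2)] norm_mult_le[OF k'(2) E'(2)] by simp_all
  have lhs: "?lhs = 2 *\<^sub>R (?Q * ?\<delta> * ?Q' - ?M * d * ?M')"
    unfolding cayley_conj[OF lt(3) \<kappa>'(1) lt(4)] cayley_conj[OF lt(1) k'(1) lt(2)] d_def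
    by (simp add: scaleR_diff_right)

  have "?\<delta> - d = (E * k) * (E * y - y * E') + (E * y - y * E') * (k' * E')
      + (E * d - d) * E' + (d * E' - d)"
    by (simp add: d_def algebra_simps)
  then have "norm (?\<delta> - d) \<le> norm ((E * k) * (E * y - y * E')) + norm ((E * y - y * E') * (k' * E'))
      + norm ((E * d - d) * E') + ?d2"
    by (metis norm_triangle_mono norm_triangle_ineq order_refl)
  also have "\<dots> \<le> 1/2 * ?c + ?c * (1/2) + ?d1 * 1 + ?d2"
    by (intro add_mono norm_mult_le Ek E' order_refl)
  finally have 1: "norm (?\<delta> - d) \<le> ?c + ?d1 + ?d2" by simp

  have "?Q * (?\<kappa> - k) * (?M * d) = (?Q - ?M) * d"
    using resolvent_diff[OF lt(3,1)] by (simp add: mult.assoc)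
  moreover have "(?\<kappa> - k) * (?M * d) = (E * k) * (E * (?M * d) - ?M * d)
      + ((E * (?M * d) - ?M * d) - (E * d - d))"
  proof -
    have kx: "k * (?M * d) = ?M * d - d"
      using resolvent_mult(2)[OF lt(1)] by (simp add: mult.assoc[symmetric] left_diff_distrib)
    have "(?\<kappa> - k) * z = (E * k) * (E * z - z) + (E * (k * z) - k * z)" for z
      by (simp add: algebra_simps)
    from this[of "?M * d"] have "(?\<kappa> - k) * (?M * d) = (E * k) * (E * (?M * d) - ?M * d) + (E * (?M * d - d) - (?M * d - d))"
      unfolding kx .
    then show ?thesis by (simp add: right_diff_distrib)
  qed
  ultimately have "(?Q - ?M) * d * ?Q' = ?Q * ((E * k) * (E * (?M * d) - ?M * d)
      + ((E * (?M * d) - ?M * d) - (E * d - d))) * ?Q'"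
    by (metis mult.assoc)
  also have "norm \<dots> \<le> 2 * (1/2 * ?x1 + (?x1 + ?d1)) * 2"
    by (intro norm_mult_le M norm_triangle_mono norm_triangle_ineq4 Ek order_refl)
  finally have 2: "norm ((?Q - ?M) * d * ?Q') \<le> 6 * ?x1 + 4 * ?d1" by simp

  have "star (resolvent ?\<kappa>' - resolvent k') = star (?\<kappa>' * resolvent k' - k' * resolvent k') * ?Q'"
    using resolvent_diff[OF lt(4,2)] by (simp only: star_mult left_diff_distrib mult.assoc)
  also have "star (?\<kappa>' * resolvent k' - k' * resolvent k') = ?M' * (k' - ?\<kappa>')"
    by (simp only: star_diff star_mult[of "_ * _" "resolvent k'"] star_mult[of k' "resolvent k'"] \<kappa>'(1) k'(1))
       (simp add: algebra_simps)
  finally have "d * (?Q' - ?M') = (d * ?M') * (k' - ?\<kappa>') * ?Q'"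
    by (simp only: star_diff mult.assoc)
  moreover have "(d * ?M') * (k' - ?\<kappa>') = (d * ?M' * E' - d * ?M') - (d * E' - d)
      - (d * ?M' * E' - d * ?M') * (k' * E')"
  proof -
    have "d * ?M' * k' = d - d * ?M'"
      using star_resolvent_skew(1)[OF k'(1) lt(2)] by (simp add: mult.assoc right_diff_distrib)
    then have "d * ?M' * k' * E' = d * E' - d * ?M' * E'" "d * ?M' * k' = d - d * ?M'"
      by (simp_all add: left_diff_distrib)
    then show ?thesis by (simp add: right_diff_distrib left_diff_distrib mult.assoc)
  qed
  ultimately have "?M * (d * (?Q' - ?M')) = ?M * (((d * ?M' * E' - d * ?M') - (d * E' - d)
      - (d * ?M' * E' - d * ?M') * (k' * E')) * ?Q')"
    by simp
  also have "norm \<dots> \<le> 2 * (((?x2 + ?d2) + ?x2 * (1/2)) * 2)"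
    by (intro norm_mult_le M order_trans[OF norm_triangle_ineq4] add_mono Ek order_refl)
  finally have 3: "norm (?M * (d * (?Q' - ?M'))) \<le> 6 * ?x2 + 4 * ?d2" by simp

  have "?Q * ?\<delta> * ?Q' - ?M * d * ?M' =
      ?Q * (?\<delta> - d) * ?Q' + (?Q - ?M) * d * ?Q' + ?M * (d * (?Q' - ?M'))"
    by (simp add: algebra_simps)
  also have "norm \<dots> \<le> 2 * (?c + ?d1 + ?d2) * 2 + (6 * ?x1 + 4 * ?d1) + (6 * ?x2 + 4 * ?d2)"
    by (intro norm_triangle_mono norm_mult_le M 1 2 3)
  also have "\<dots> \<le> 8 * (?c + ?d1 + ?d2 + ?x1 + ?x2)" by simp
  finally show ?thesis unfolding lhs by simp
qed

section \<open>The ideal \<open>B\<close> in \<open>M(B)\<close> and the action twisted by a cocycle\<close>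

lemma linear_inclM: "linear inclM"
  by (rule bounded_linear.linear[OF star_hom_bounded_linear[OF star_hom_inclM]])

lemma inclM_simps:
  "inclM (a + b) = inclM a + inclM b" "inclM (a - b) = inclM a - inclM b"
  "inclM (a * b) = inclM a * inclM b" "inclM (star a) = star (inclM a)"
  "inclM (r *\<^sub>R a) = r *\<^sub>R inclM a" "inclM 0 = 0"
  using star_hom_inclM linear_diff[OF linear_inclM] linear_scale[OF linear_inclM] linear_0[OF linear_inclM]
  by (auto simp: star_hom_def)

lemma mult_inclM: "m * inclM b = inclM (lmul m b)" and inclM_mult: "inclM b * m = inclM (rmul m b)"
  by (rule multiplier_eqI; simp add: lmul_mult mult_lmul)+

lemma inclM_range_intros:
  fixes x y :: "'b::cstar_algebra multiplier"
  shows "x \<in> range inclM \<Longrightarrow> y \<in> range inclM \<Longrightarrow> x + y \<in> range inclM"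
    and "x \<in> range inclM \<Longrightarrow> y \<in> range inclM \<Longrightarrow> x - y \<in> range inclM"
    and "x \<in> range inclM \<Longrightarrow> m * x \<in> range inclM"
    and "x \<in> range inclM \<Longrightarrow> x * m \<in> range inclM"
    and "x \<in> range inclM \<Longrightarrow> r *\<^sub>R x \<in> range inclM"
    and "x \<in> range inclM \<Longrightarrow> star x \<in> range inclM"
  by (auto simp: mult_inclM inclM_mult simp flip: inclM_simps)

lemma dist_inclM: "dist (inclM a) (inclM b) = dist a b"
  by (simp add: dist_norm flip: inclM_simps(2))

lemma continuous_on_inclM_iff: "continuous_on S (\<lambda>z. inclM (f z)) \<longleftrightarrow> continuous_on S f"
  by (simp add: continuous_on_def tendsto_iff dist_inclM)

lemma star_aut_inv_simps:
  assumes "star_aut \<theta>"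
  shows "inv \<theta> (\<theta> b) = b" "\<theta> (inv \<theta> b) = b"
  using assms by (simp_all add: star_aut_def bij_is_inj inv_f_f bij_is_surj surj_f_inv_f)

lemma star_hom_extendM:
  assumes \<theta>: "star_aut \<theta>"
  shows "star_hom (extendM \<theta>)"
proof -
  have h: "star_hom \<theta>" "star_hom (inv \<theta>)"
    using \<theta> star_aut_inv[OF \<theta>] by (simp_all add: star_aut_def)
  show ?thesis
    unfolding star_hom_def
    by (intro conjI allI; rule multiplier_eqI)
      (use h in \<open>simp_all add: star_hom_def extendM_apply[OF \<theta>] blinfun.add_left star_aut_inv_simps[OF \<theta>]\<close>)
qed

lemma extendM_1: "star_aut \<theta> \<Longrightarrow> extendM \<theta> 1 = 1"
  by (rule multiplier_eqI) (simp add: extendM_apply star_aut_inv_simps)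

lemma extendM_comp:
  assumes "star_aut \<theta>" "star_aut \<eta>" "star_aut (\<theta> \<circ> \<eta>)"
  shows "extendM (\<theta> \<circ> \<eta>) m = extendM \<theta> (extendM \<eta> m)"
  by (rule multiplier_eqI)
    (use assms in \<open>simp add: extendM_apply o_inv_distrib star_aut_def\<close>)

lemma extendM_id: "extendM id m = m"
proof -
  have "star_aut (id :: 'a \<Rightarrow> 'a)" by (simp add: star_aut_def star_hom_def)
  then show ?thesis by (intro multiplier_eqI) (simp add: extendM_apply)
qed

text \<open>
  Strict continuity means pointwise norm continuity of left and right multiplication.
\<close>

lemma continuous_on_strict:
  assumes "continuous_map euclidean strict_topology f"
  shows "continuous_on UNIV (\<lambda>z. lmul (f z) b)" "continuous_on UNIV (\<lambda>z. rmul (f z) b)"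
proof -
  have "openin strict_topology {m. lmul m b \<in> V}" "openin strict_topology {m. rmul m b \<in> V}" if "open V" for V
    unfolding strict_topology_def using that by (auto intro!: topology_generated_by_Basis)
  then have "open {z. lmul (f z) b \<in> V}" "open {z. rmul (f z) b \<in> V}" if "open V" for V
    using openin_continuous_map_preimage[OF assms] that by fastforce+
  then show "continuous_on UNIV (\<lambda>z. lmul (f z) b)" "continuous_on UNIV (\<lambda>z. rmul (f z) b)"
    by (simp_all add: continuous_on_open_vimage vimage_def)
qed

lemma continuous_on_apply_nonexpansive:
  fixes T :: "'z::topological_space \<Rightarrow> 'v::real_normed_vector \<Rightarrow> 'w::real_normed_vector"
  assumes le: "\<And>z x y. norm (T z x - T z y) \<le> norm (x - y)"
    and T: "\<And>z. z \<in> S \<Longrightarrow> continuous_on S (\<lambda>z'. T z' (c z))"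
    and c: "continuous_on S c"
  shows "continuous_on S (\<lambda>z. T z (c z))"
  unfolding continuous_on_def
proof
  fix z assume z: "z \<in> S"
  have "((\<lambda>z'. T z' (c z)) \<longlongrightarrow> T z (c z)) (at z within S)"
    using T[OF z] z by (simp add: continuous_on_def)
  moreover have "((\<lambda>z'. norm (c z' - c z)) \<longlongrightarrow> 0) (at z within S)"
    using c z by (simp add: continuous_on_def LIM_zero tendsto_norm_zero)
  then have "((\<lambda>z'. T z' (c z') - T z' (c z)) \<longlongrightarrow> 0) (at z within S)"
    by (rule Lim_null_comparison[rotated]) (simp add: le)
  ultimately have "((\<lambda>z'. (T z' (c z') - T z' (c z)) + T z' (c z)) \<longlongrightarrow> 0 + T z (c z)) (at z within S)"
    by (intro tendsto_intros)
  then show "((\<lambda>z. T z (c z)) \<longlongrightarrow> T z (c z)) (at z within S)" by simp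
qed

text \<open>
  An action \<open>\<beta>\<close> together with a strictly continuous unitary \<open>\<beta>\<close>-cocycle \<open>u\<close>.
\<close>

locale unitary_cocycle =
  fixes \<beta> :: "'g::{topological_group_add, second_countable_topology, t2_space} \<Rightarrow> 'b::cstar_algebra \<Rightarrow> 'b"
    and u :: "'g \<Rightarrow> 'b multiplier"
  assumes action: "continuous_action \<beta>"
    and unitary: "star (u g) * u g = 1" "u g * star (u g) = 1"
    and strict: "continuous_map euclidean strict_topology u"
    and cocycle: "u (g + h) = u g * extendM (\<beta> g) (u h)"
begin

text \<open>
  The action \<open>Ad(u\<^sub>g) \<circ> \<beta>\<^sub>g\<close> on \<open>M(B)\<close>.
\<close>

abbreviation \<gamma> :: "'g \<Rightarrow> 'b multiplier \<Rightarrow> 'b multiplier" where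
  "\<gamma> \<equiv> cocycle_action \<beta> u"

lemma aut: "star_aut (\<beta> g)"
  using action by (simp add: continuous_action_def)

lemma \<gamma>_hom: "star_hom (\<gamma> g)"
proof -
  have *: "u g * a * star (u g) * (u g * b * star (u g)) = u g * (a * b) * star (u g)" for a b
  proof -
    have "u g * a * star (u g) * (u g * b * star (u g)) = u g * a * (star (u g) * u g) * b * star (u g)"
      by (simp only: mult.assoc)
    then show ?thesis by (simp add: unitary(1) mult.assoc)
  qed
  have e: "extendM (\<beta> g) (x + y) = extendM (\<beta> g) x + extendM (\<beta> g) y"
    "extendM (\<beta> g) (x * y) = extendM (\<beta> g) x * extendM (\<beta> g) y"
    "extendM (\<beta> g) (c *\<^sub>C x) = c *\<^sub>C extendM (\<beta> g) x"
    "extendM (\<beta> g) (star x) = star (extendM (\<beta> g) x)" for x y c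
    using star_hom_extendM[OF aut[of g]] by (simp_all add: star_hom_def)
  show ?thesis
    unfolding cocycle_action_def star_hom_def e *
    by (simp add: distrib_left distrib_right mult_scaleC_left mult_scaleC_right star_mult mult.assoc)
qed

lemma \<gamma>_linear: "linear (\<gamma> g)"
  by (rule bounded_linear.linear[OF star_hom_bounded_linear[OF \<gamma>_hom]])

lemma \<gamma>_simps:
  "\<gamma> g (x + y) = \<gamma> g x + \<gamma> g y" "\<gamma> g (x - y) = \<gamma> g x - \<gamma> g y"
  "\<gamma> g (x * y) = \<gamma> g x * \<gamma> g y" "\<gamma> g (star x) = star (\<gamma> g x)" "\<gamma> g (r *\<^sub>R x) = r *\<^sub>R \<gamma> g x"
  using \<gamma>_hom[of g] linear_diff[OF \<gamma>_linear] linear_scale[OF \<gamma>_linear] by (simp_all add: star_hom_def)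

lemma \<gamma>_1 [simp]: "\<gamma> g 1 = 1"
  by (simp add: cocycle_action_def extendM_1[OF aut] unitary)

lemma \<gamma>_add: "\<gamma> (g + h) x = \<gamma> g (\<gamma> h x)"
proof -
  have e: "\<beta> (g + h) = \<beta> g \<circ> \<beta> h" using action by (simp add: continuous_action_def)
  have "extendM (\<beta> (g + h)) x = extendM (\<beta> g) (extendM (\<beta> h) x)"
    unfolding e using aut[of g] aut[of h] aut[of "g + h", unfolded e] by (rule extendM_comp)
  then show ?thesis
    using star_hom_extendM[OF aut[of g]] unfolding cocycle_action_def cocycle star_hom_def
    by (simp add: star_mult mult.assoc)
qed

lemma \<gamma>_0 [simp]: "\<gamma> 0 x = x"
proof -
  have "\<beta> 0 (\<beta> 0 b) = \<beta> 0 b" for b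
    using action unfolding continuous_action_def by (metis add_0_right comp_apply)
  moreover have "inj (\<beta> 0)" using aut[of 0] by (simp add: star_aut_def bij_is_inj)
  ultimately have b: "\<beta> 0 = id" by (auto simp: inj_def)
  have "u 0 = u 0 * u 0" using cocycle[of 0 0] by (simp add: b extendM_id)
  then have "star (u 0) * u 0 = star (u 0) * u 0 * u 0" by (metis mult.assoc)
  then have "u 0 = 1" by (simp add: unitary)
  then show ?thesis by (simp add: cocycle_action_def b extendM_id star_one)
qed

lemma \<gamma>_inverse [simp]: "\<gamma> g (\<gamma> (- g) x) = x" "\<gamma> (- g) (\<gamma> g x) = x"
  by (simp_all flip: \<gamma>_add)

lemma norm_\<gamma> [simp]: "norm (\<gamma> g x) = norm x"
  using star_hom_norm_le[OF \<gamma>_hom, of g x] star_hom_norm_le[OF \<gamma>_hom, of "- g" "\<gamma> g x"] by simp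

lemma \<gamma>_inclM: "\<gamma> g (inclM b) \<in> range inclM"
  by (simp add: cocycle_action_def extendM_inclM[OF aut] mult_inclM inclM_mult)

lemma \<gamma>_range: "x \<in> range inclM \<Longrightarrow> \<gamma> g x \<in> range inclM"
  using \<gamma>_inclM by auto

lemma conj_cocycle: "w * u g * star (extendM (\<beta> g) w) = w * star (\<gamma> g w) * u g"
proof -
  have "u g * star (extendM (\<beta> g) w) = star (\<gamma> g w) * u g"
    by (simp add: cocycle_action_def star_mult mult.assoc unitary)
  then show ?thesis by (simp add: mult.assoc)
qed

lemma continuous_on_\<gamma>_apply:
  fixes f :: "'z::topological_space \<Rightarrow> 'g"
  assumes "continuous_on S f" "continuous_on S F"
    and "\<And>z. z \<in> S \<Longrightarrow> continuous_on UNIV (\<lambda>g. \<gamma> g (F z))"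
  shows "continuous_on S (\<lambda>z. \<gamma> (f z) (F z))"
proof (rule continuous_on_apply_nonexpansive[where T = "\<lambda>z. \<gamma> (f z)"])
  show "continuous_on S (\<lambda>z'. \<gamma> (f z') (F z))" if "z \<in> S" for z
    by (rule continuous_on_compose2[OF assms(3)[OF that] assms(1)]) simp
qed (use assms in \<open>simp_all flip: \<gamma>_simps\<close>)

lemma continuous_\<gamma>_inclM:
  assumes "x \<in> range inclM"
  shows "continuous_on UNIV (\<lambda>g. \<gamma> g x)"
proof -
  obtain b where b: "x = inclM b" using assms by auto
  have nexp: "norm (lmul (u g) a - lmul (u g) a') \<le> norm (a - a')"
    "norm (rmul (star (u g)) a - rmul (star (u g)) a') \<le> norm (a - a')" for g a a'
  proof -
    have "norm (u g) \<le> 1" by (rule norm_unitary_le) (rule unitary)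
    then have "norm (u g * inclM (a - a')) \<le> norm (a - a')" "norm (inclM (a - a') * star (u g)) \<le> norm (a - a')"
      using norm_mult_le[of "u g" 1 "inclM (a - a')" "norm (a - a')"]
        norm_mult_le[of "inclM (a - a')" "norm (a - a')" "star (u g)" 1] by simp_all
    then show "norm (lmul (u g) a - lmul (u g) a') \<le> norm (a - a')"
      "norm (rmul (star (u g)) a - rmul (star (u g)) a') \<le> norm (a - a')"
      by (simp_all only: mult_inclM inclM_mult norm_inclM blinfun.diff_right)
  qed
  have "continuous_on UNIV (\<lambda>g. \<beta> g b)" using action by (simp add: continuous_action_def)
  then have "continuous_on UNIV (\<lambda>g. lmul (u g) (\<beta> g b))"
    by (rule continuous_on_apply_nonexpansive[where T = "\<lambda>g. lmul (u g)", rotated 2])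
      (rule nexp continuous_on_strict[OF strict])+
  moreover have "continuous_on UNIV (\<lambda>g. rmul (star (u g)) a)" for a
    by (simp, intro bounded_linear.continuous_on[OF bounded_linear_star] continuous_on_strict[OF strict])
  ultimately have "continuous_on UNIV (\<lambda>g. rmul (star (u g)) (lmul (u g) (\<beta> g b)))"
    by (intro continuous_on_apply_nonexpansive[where T = "\<lambda>g. rmul (star (u g))" and c = "\<lambda>g. lmul (u g) (\<beta> g b)"] nexp)
  then show ?thesis
    unfolding b cocycle_action_def extendM_inclM[OF aut] mult_inclM inclM_mult continuous_on_inclM_iff .
qed

end

section \<open>Norm continuity of orbits that are constant modulo \<open>B\<close>\<close>

lemma norm_multiplier_le_iff:
  fixes m :: "'b::cstar_algebra multiplier"
  assumes "0 \<le> r"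
  shows "norm m \<le> r \<longleftrightarrow> (\<forall>b. norm (m * inclM b) \<le> r * norm b)"
proof
  show "\<forall>b. norm (m * inclM b) \<le> r * norm b" if "norm m \<le> r"
    using norm_mult_le[OF that, of "inclM _"] by auto
  show "norm m \<le> r" if "\<forall>b. norm (m * inclM b) \<le> r * norm b"
    unfolding norm_multiplier_def
    by (rule norm_blinfun_bound) (use that assms in \<open>simp_all add: mult_inclM\<close>)
qed

text \<open>
  The approximate unit acts on \<open>B\<close>, seen inside \<open>M(B)\<close>; positivity is only kept as self-adjointness.
\<close>

lemma sigma_unitalE:
  assumes "sigma_unital TYPE('b::cstar_algebra)"
  obtains e :: "nat \<Rightarrow> 'b::cstar_algebra" where "\<And>n. star (e n) = e n" "\<And>n. norm (e n) \<le> 1"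
    "\<And>x. x \<in> range inclM \<Longrightarrow> (\<lambda>n. inclM (e n) * x) \<longlonglongrightarrow> x"
    "\<And>x. x \<in> range inclM \<Longrightarrow> (\<lambda>n. x * inclM (e n)) \<longlonglongrightarrow> x"
proof -
  obtain e :: "nat \<Rightarrow> 'b" where e: "\<And>n. (\<exists>x. e n = star x * x) \<and> norm (e n) \<le> 1"
    "\<And>b. (\<lambda>n. e n * b) \<longlonglongrightarrow> b \<and> (\<lambda>n. b * e n) \<longlonglongrightarrow> b"
    using assms unfolding sigma_unital_def by metis
  have "star (e n) = e n" for n using e(1)[of n] by (auto simp: star_mult)
  moreover have "(\<lambda>n. inclM (e n) * x) \<longlonglongrightarrow> x" "(\<lambda>n. x * inclM (e n)) \<longlonglongrightarrow> x"
    if x: "x \<in> range inclM" for x :: "'b multiplier"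
  proof -
    obtain b where b: "x = inclM b" using x by auto
    show "(\<lambda>n. inclM (e n) * x) \<longlonglongrightarrow> x" "(\<lambda>n. x * inclM (e n)) \<longlonglongrightarrow> x"
      using e(2)[of b] by (simp_all add: b tendsto_iff dist_inclM flip: inclM_simps)
  qed
  ultimately show thesis using that e(1) by blast
qed

context unitary_cocycle
begin

text \<open>
  If \<open>x\<close> is \<open>\<gamma>\<close>-invariant modulo \<open>B\<close>, then its orbit map is norm continuous. The \<open>B\<close>-valued function
  \<open>f(g) = x - \<gamma>\<^sub>g(x)\<close> has norm separable range: its values are limits of elements \<open>f(d) e\<^sub>n\<close>, with \<open>d\<close> in a countable
  dense set and \<open>e\<^sub>n\<close> an approximate unit. Closed balls around them pull back to closed sets because the norm is
  strictly lower semicontinuous. By Baire, \<open>f\<close> is almost constant on some open set, and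
  \<open>f(gh) - f(g) = \<gamma>\<^sub>g(f(h))\<close> carries this to a neighbourhood of the neutral element.
\<close>

lemma continuous_\<gamma>_if_invariant_mod:
  assumes G: "locally_compact_space (euclidean :: 'g topology)"
    and B: "sigma_unital TYPE('b)"
    and x: "\<And>g. x - \<gamma> g x \<in> range inclM"
  shows "continuous_on UNIV (\<lambda>g. \<gamma> g x)"
proof -
  define f where "f g = x - \<gamma> g x" for g
  have cont: "continuous_on UNIV (\<lambda>g. f g * y)" if y: "y \<in> range inclM" for y
  proof -
    have "f g * y = x * y - \<gamma> g (x * \<gamma> (- g) y)" for g
      by (simp add: f_def left_diff_distrib \<gamma>_simps)
    moreover have "continuous_on UNIV (\<lambda>g. \<gamma> g (x * \<gamma> (- g) y))"
    proof (rule continuous_on_\<gamma>_apply)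
      have "continuous_on UNIV (\<lambda>g. \<gamma> (- g) y)"
        by (rule continuous_on_\<gamma>_apply)
          (use y in \<open>auto intro: continuous_intros continuous_\<gamma>_inclM\<close>)
      then show "continuous_on UNIV (\<lambda>g. x * \<gamma> (- g) y)" by (rule continuous_on_mult_left)
      show "continuous_on UNIV (\<lambda>g. \<gamma> g (x * \<gamma> (- h) y))" for h
        by (intro continuous_\<gamma>_inclM inclM_range_intros \<gamma>_range y)
    qed (rule continuous_on_id)
    ultimately show ?thesis by (simp add: continuous_intros)
  qed
  obtain e :: "nat \<Rightarrow> 'b" where e: "\<And>x. x \<in> range inclM \<Longrightarrow> (\<lambda>n. x * inclM (e n)) \<longlonglongrightarrow> x"
    using sigma_unitalE[OF B] by metis
  obtain D :: "'g set" where D: "countable D" "\<And>X. open X \<Longrightarrow> X \<noteq> {} \<Longrightarrow> \<exists>d\<in>D. d \<in> X"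
    using countable_dense_exists[where 'a = 'g] by auto
  have small: "\<forall>\<^sub>F h in nhds 0. norm (f h) < \<epsilon>" if \<epsilon>: "\<epsilon> > 0" for \<epsilon>
  proof -
    define S where "S = (\<lambda>(d, n). {g. norm (f g - f d * inclM (e n)) \<le> \<epsilon> / 3})"
    have "\<exists>p\<in>D \<times> UNIV. g \<in> S p" for g
    proof -
      have "\<forall>\<^sub>F n in sequentially. dist (f g * inclM (e n)) (f g) < \<epsilon> / 6"
        using e[of "f g"] x[of g] \<epsilon> by (intro tendstoD) (auto simp: f_def)
      then obtain n where n: "dist (f g * inclM (e n)) (f g) < \<epsilon> / 6"
        by (auto dest: eventually_happens)
      have "open {g'. dist (f g' * inclM (e n)) (f g * inclM (e n)) < \<epsilon> / 6}"
        by (intro open_Collect_less continuous_on_dist cont continuous_on_const) auto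
      then obtain d where d: "d \<in> D" "dist (f d * inclM (e n)) (f g * inclM (e n)) < \<epsilon> / 6"
        using D(2)[of "{g'. dist (f g' * inclM (e n)) (f g * inclM (e n)) < \<epsilon> / 6}"] \<epsilon>
        by (metis (mono_tags, lifting) dist_self divide_pos_pos empty_iff mem_Collect_eq zero_less_numeral)
      have "dist (f g) (f d * inclM (e n)) \<le> dist (f g * inclM (e n)) (f g) + dist (f d * inclM (e n)) (f g * inclM (e n))"
        by (metis dist_commute dist_triangle3 add.commute)
      then have "g \<in> S (d, n)"
        using n d(2) by (simp add: S_def dist_norm)
      then show ?thesis using d(1) by blast
    qed
    then have cover: "\<Union> (S ` (D \<times> UNIV)) = UNIV" by auto
    have closed: "closed (S p)" for p
    proof (cases p)
      case (Pair d n)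
      have "S p = (\<Inter>b. {g. norm (f g * inclM b - f d * inclM (e n) * inclM b) \<le> \<epsilon> / 3 * norm b})"
        using norm_multiplier_le_iff[of "\<epsilon> / 3"] \<epsilon> by (fastforce simp: Pair S_def simp flip: left_diff_distrib)
      moreover have "closed {g. norm (f g * inclM b - f d * inclM (e n) * inclM b) \<le> \<epsilon> / 3 * norm b}" for b
        by (intro closed_Collect_le continuous_on_norm continuous_on_diff cont continuous_on_const) auto
      ultimately show ?thesis by auto
    qed
    have "Hausdorff_space (euclidean :: 'g topology)"
      unfolding Hausdorff_space_def using hausdorff by (fastforce simp: disjnt_def)
    then have "regular_space (euclidean :: 'g topology)"
      using G by (simp add: locally_compact_Hausdorff_imp_regular_space)
    moreover have "countable (S ` (D \<times> UNIV))" using D(1) by blast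
    ultimately have Baire: "euclidean interior_of \<Union> (S ` (D \<times> UNIV)) = {}"
      if "\<And>T. T \<in> S ` (D \<times> UNIV) \<Longrightarrow> closedin euclidean T \<and> euclidean interior_of T = {}"
      using Baire_category_alt[OF _ _ that] G by blast
    have "\<exists>p. interior (S p) \<noteq> {}"
    proof (rule ccontr)
      assume "\<nexists>p. interior (S p) \<noteq> {}"
      then have "closedin euclidean T \<and> euclidean interior_of T = {}" if "T \<in> S ` (D \<times> UNIV)" for T
        using that closed by auto
      then have "euclidean interior_of \<Union> (S ` (D \<times> UNIV)) = {}" by (rule Baire)
      then show False by (simp add: cover)
    qed
    then obtain d n g0 where g0: "g0 \<in> interior (S (d, n))" by auto
    have "((\<lambda>h. g0 + h) \<longlongrightarrow> g0 + 0) (nhds 0)" by (intro tendsto_intros filterlim_ident)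
    then have "\<forall>\<^sub>F h in nhds 0. g0 + h \<in> interior (S (d, n))"
      using g0 by (intro topological_tendstoD) auto
    then show ?thesis
    proof eventually_elim
      case (elim h)
      have "f (g0 + h) - f g0 = \<gamma> g0 (f h)" by (simp add: f_def \<gamma>_add \<gamma>_simps)
      then have "norm (f h) = norm (f (g0 + h) - f g0)" by simp
      also have "\<dots> \<le> norm (f (g0 + h) - f d * inclM (e n)) + norm (f g0 - f d * inclM (e n))"
        using norm_triangle_ineq4[of "f (g0 + h) - f d * inclM (e n)" "f g0 - f d * inclM (e n)"] by simp
      also have "\<dots> \<le> \<epsilon> / 3 + \<epsilon> / 3"
        using elim g0 interior_subset[of "S (d, n)"] by (intro add_mono) (auto simp: S_def)
      finally show ?case using \<epsilon> by simp
    qed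
  qed
  show ?thesis
    unfolding continuous_on_def
  proof
    fix g :: 'g
    have lim: "((\<lambda>h. - g + h) \<longlongrightarrow> - g + g) (at g)"
      using tendsto_add[OF tendsto_const[of "- g"] tendsto_ident_at[of g UNIV]] by simp
    show "((\<lambda>h. \<gamma> h x) \<longlongrightarrow> \<gamma> g x) (at g within UNIV)"
    proof (rule tendstoI)
      fix \<epsilon> :: real assume "\<epsilon> > 0"
      have "\<forall>\<^sub>F h in at g. norm (f (- g + h)) < \<epsilon>"
        using eventually_compose_filterlim[OF small[OF \<open>\<epsilon> > 0\<close>], of "\<lambda>h. - g + h" "at g"] lim by simp
      then show "\<forall>\<^sub>F h in at g within UNIV. dist (\<gamma> h x) (\<gamma> g x) < \<epsilon>"
      proof eventually_elim
        case (elim h)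
        have "\<gamma> g x - \<gamma> h x = \<gamma> g (f (- g + h))"
          by (simp add: f_def \<gamma>_simps flip: \<gamma>_add add.assoc)
        then show ?case using elim by (metis dist_commute dist_norm norm_\<gamma>)
      qed
    qed
  qed
qed

end

section \<open>Quasicentral approximate units\<close>

lemma approximate_unit_uniform:
  fixes E :: "'i \<Rightarrow> 'm::real_normed_algebra"
  assumes S: "compact S" and E: "\<forall>\<^sub>F i in F. norm (E i) \<le> 1"
    and lim: "\<And>x. x \<in> S \<Longrightarrow> ((\<lambda>i. E i * x) \<longlongrightarrow> x) F"
    and \<epsilon>: "\<epsilon> > 0"
  shows "\<forall>\<^sub>F i in F. \<forall>x\<in>S. norm (E i * x - x) < \<epsilon>"
proof -
  obtain k where k: "finite k" "k \<subseteq> S" "S \<subseteq> (\<Union>x\<in>k. ball x (\<epsilon> / 3))"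
  proof (rule compactE_image[OF S])
    show "S \<subseteq> (\<Union>x\<in>S. ball x (\<epsilon> / 3))" using \<epsilon> by auto
  qed auto
  have "\<forall>\<^sub>F i in F. \<forall>x\<in>k. norm (E i * x - x) < \<epsilon> / 3"
    using k(1,2) \<epsilon> tendstoD[OF lim, of _ "\<epsilon> / 3"]
    by (intro eventually_ball_finite) (auto simp: dist_norm)
  then show ?thesis
    using E
  proof eventually_elim
    case (elim i)
    show ?case
    proof
      fix x assume "x \<in> S"
      then obtain y where y: "y \<in> k" "norm (y - x) < \<epsilon> / 3" using k(3) by (auto simp: dist_norm)
      have "E i * x - x = (E i * y - y) - E i * (y - x) + (y - x)" by (simp add: algebra_simps)
      then have "norm (E i * x - x) \<le> norm (E i * y - y) + norm (E i * (y - x)) + norm (y - x)"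
        by (metis norm_triangle_ineq4 norm_triangle_mono order_refl)
      also have "\<dots> < \<epsilon> / 3 + \<epsilon> / 3 + \<epsilon> / 3"
        using y elim norm_mult_le[OF elim(2) order_refl, of "y - x"]
        by (intro add_strict_mono) auto
      finally show "norm (E i * x - x) < \<epsilon>" by simp
    qed
  qed
qed

text \<open>
  If the images \<open>T(e\<^sub>n)\<close> are bounded and asymptotically orthogonal to every \<open>T(f)\<close>, uniformly in \<open>T\<close>, then some
  convex combination of a tail of \<open>e\<close> has small image under all \<open>T\<close>.
\<close>

lemma small_convex_combination:
  fixes e :: "nat \<Rightarrow> 'v::real_vector" and X :: "('v \<Rightarrow> 'c::cstar_algebra) set"
  assumes lin: "\<And>T. T \<in> X \<Longrightarrow> linear T"
    and bound: "\<And>T n. T \<in> X \<Longrightarrow> norm (T (e n)) \<le> C"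
    and orth: "\<And>f \<delta>. \<delta> > 0 \<Longrightarrow> \<forall>\<^sub>F n in sequentially. \<forall>T\<in>X. norm (star (T (e n)) * T f) < \<delta>"
    and \<epsilon>: "\<epsilon> > 0"
  shows "\<exists>f \<in> convex hull (e ` {M..}). \<forall>T\<in>X. norm (T f) \<le> \<epsilon>"
proof -
  \<comment> \<open>Running averages along a sparse subsequence: each step adds \<open>C\<^sup>2 + 1\<close> at most to the squared norm of the sum.\<close>
  have main: "\<exists>f \<in> convex hull (e ` {M..}). \<forall>T\<in>X. (norm (T f))\<^sup>2 \<le> (C\<^sup>2 + 1) / real (Suc N)" for N
  proof (induction N)
    case 0
    have "(norm (T (e M)))\<^sup>2 \<le> C\<^sup>2 + 1" if "T \<in> X" for T
      using power_mono[OF bound[OF that, of M], of 2] by simp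
    then show ?case by (intro bexI[of _ "e M"]) (auto intro: hull_inc)
  next
    case (Suc N)
    define n where "n = real (Suc N)"
    have n: "n \<ge> 1" by (simp add: n_def)
    obtain f where f: "f \<in> convex hull (e ` {M..})"
      "\<And>T. T \<in> X \<Longrightarrow> (norm (T f))\<^sup>2 \<le> (C\<^sup>2 + 1) / n"
      using Suc unfolding n_def by blast
    \<comment> \<open>The two cross terms of the next square, each weighted by \<open>n\<close>, add up to at most \<open>1\<close>.\<close>
    have "\<forall>\<^sub>F m in sequentially. (\<forall>T\<in>X. norm (star (T (e m)) * T f) < 1 / (2 * n)) \<and> m \<ge> M"
      using n by (intro eventually_conj orth eventually_ge_at_top) auto
    then obtain m where m: "\<And>T. T \<in> X \<Longrightarrow> norm (star (T (e m)) * T f) < 1 / (2 * n)" "m \<ge> M"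
      by (auto simp: eventually_sequentially)
    let ?f' = "(n / (n + 1)) *\<^sub>R f + (1 / (n + 1)) *\<^sub>R e m"
    have "?f' \<in> convex hull (e ` {M..})"
      using n m(2) f(1) by (intro convexD[OF convex_convex_hull]) (auto intro: hull_inc simp: field_simps)
    moreover have "(norm (T ?f'))\<^sup>2 \<le> (C\<^sup>2 + 1) / (n + 1)" if T: "T \<in> X" for T
    proof -
      define a b where "a = T f" and "b = T (e m)"
      have Tf': "T ?f' = (1 / (n + 1)) *\<^sub>R (n *\<^sub>R a + b)"
        using lin[OF T] by (simp add: linear_add linear_scale a_def b_def scaleR_add_right)
      have ab: "norm (star b * a) \<le> 1 / (2 * n)" using m(1)[OF T] by (simp add: a_def b_def)
      moreover have "star (star b * a) = star a * b" by (simp add: star_mult)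
      then have "norm (star a * b) = norm (star b * a)" by (metis norm_star)
      ultimately have ba: "norm (star a * b) \<le> 1 / (2 * n)" by simp
      have "(norm (n *\<^sub>R a + b))\<^sup>2 = norm (star (n *\<^sub>R a + b) * (n *\<^sub>R a + b))"
        by (simp add: cstar_identity)
      also have "star (n *\<^sub>R a + b) * (n *\<^sub>R a + b) =
          (n * n) *\<^sub>R (star a * a) + n *\<^sub>R (star b * a) + n *\<^sub>R (star a * b) + star b * b"
        by (simp add: star_add star_scaleR algebra_simps)
      also have "norm \<dots> \<le> (n * n) * ((C\<^sup>2 + 1) / n) + n * (1 / (2 * n)) + n * (1 / (2 * n)) + C\<^sup>2"
      proof (intro norm_triangle_mono)
        show "norm ((n * n) *\<^sub>R (star a * a)) \<le> (n * n) * ((C\<^sup>2 + 1) / n)"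
          using mult_left_mono[OF f(2)[OF T], of "n * n"] by (simp add: cstar_identity a_def)
        show "norm (n *\<^sub>R (star b * a)) \<le> n * (1 / (2 * n))" "norm (n *\<^sub>R (star a * b)) \<le> n * (1 / (2 * n))"
          using mult_left_mono[OF ab, of n] mult_left_mono[OF ba, of n] n by simp_all
        show "norm (star b * b) \<le> C\<^sup>2"
          using power_mono[OF bound[OF T, of m], of 2] by (simp add: cstar_identity b_def)
      qed
      also have "\<dots> = (n + 1) * (C\<^sup>2 + 1)" using n by (simp add: field_simps)
      finally have "(norm (n *\<^sub>R a + b))\<^sup>2 / (n + 1)\<^sup>2 \<le> ((n + 1) * (C\<^sup>2 + 1)) / (n + 1)\<^sup>2"
        by (rule divide_right_mono) simp
      also have "\<dots> = (C\<^sup>2 + 1) / (n + 1)" using n by (simp add: power2_eq_square)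
      finally show ?thesis using n by (simp add: Tf' power_divide)
    qed
    ultimately show ?case by (intro bexI[of _ ?f']) (auto simp: n_def add.commute)
  qed
  have "(\<lambda>N. (C\<^sup>2 + 1) / real (Suc N)) \<longlonglongrightarrow> 0"
    by (rule LIMSEQ_Suc, rule lim_const_over_n)
  then have "\<forall>\<^sub>F N in sequentially. (C\<^sup>2 + 1) / real (Suc N) < \<epsilon>\<^sup>2"
    using \<epsilon> by (intro order_tendstoD) auto
  then obtain N where N: "(C\<^sup>2 + 1) / real (Suc N) < \<epsilon>\<^sup>2" by (auto simp: eventually_sequentially)
  obtain f where f: "f \<in> convex hull (e ` {M..})" "\<And>T. T \<in> X \<Longrightarrow> (norm (T f))\<^sup>2 \<le> (C\<^sup>2 + 1) / real (Suc N)"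
    using main by blast
  have "norm (T f) \<le> \<epsilon>" if "T \<in> X" for T
  proof (rule power2_le_imp_le)
    show "(norm (T f))\<^sup>2 \<le> \<epsilon>\<^sup>2" by (rule order_trans[OF f(2)[OF that] less_imp_le[OF N]])
  qed (use \<epsilon> in simp)
  then show ?thesis using f(1) by blast
qed

context unitary_cocycle
begin

text \<open>
  Self-adjoint contractions of \<open>B\<close> that, up to \<open>1/(n+1)\<close>, act as a left unit on \<open>h\<^sub>0, \<dots>, h\<^sub>n\<close>, commute with
  \<open>c\<^sub>0, \<dots>, c\<^sub>n\<close> and are \<open>\<gamma>\<close>-invariant over \<open>K\<^sub>n\<close>. All conditions are convex.
\<close>

definition qc_set :: "(nat \<Rightarrow> 'b) \<Rightarrow> (nat \<Rightarrow> 'b multiplier) \<Rightarrow> (nat \<Rightarrow> 'g set) \<Rightarrow> nat \<Rightarrow> 'b set" where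
  "qc_set h c K n = {e. star e = e \<and> norm e \<le> 1
    \<and> (\<forall>j\<le>n. norm (e * h j - h j) \<le> 1 / Suc n)
    \<and> (\<forall>j\<le>n. norm (inclM e * c j - c j * inclM e) \<le> 1 / Suc n)
    \<and> (\<forall>g\<in>K n. norm (\<gamma> g (inclM e) - inclM e) \<le> 1 / Suc n)}"

lemma qc_set_antimono:
  assumes K: "mono K" and mn: "m \<le> n"
  shows "qc_set h c K n \<subseteq> qc_set h c K m"
proof -
  have "1 / real (Suc n) \<le> 1 / Suc m" using mn by (simp add: frac_le)
  moreover have "K m \<subseteq> K n" using K mn by (rule monoD)
  ultimately show ?thesis
    unfolding qc_set_def using mn by (auto intro: order_trans)
qed

lemma convex_qc_set: "convex (qc_set h c K n)"
proof -
  have affine: "convex {e. norm (L e - b) \<le> r}" if "linear L" for L :: "'b \<Rightarrow> 'c::real_normed_vector" and b r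
  proof -
    have "{e. norm (L e - b) \<le> r} = L -` cball b r"
      by (auto simp: dist_norm norm_minus_commute)
    then show ?thesis using convex_linear_vimage[OF that, of "cball b r"] by simp
  qed
  have 1: "convex {e :: 'b. norm (e * h j - h j) \<le> 1 / Suc n}" for j
    by (rule affine) (rule bounded_linear.linear[OF bounded_linear_mult_left])
  have "linear (\<lambda>e. inclM e * c j - c j * inclM e)" for j
    by (rule linearI) (simp_all add: inclM_simps algebra_simps)
  then have 2: "convex {e. norm (inclM e * c j - c j * inclM e) \<le> 1 / Suc n}" for j
    using affine[of "\<lambda>e. inclM e * c j - c j * inclM e" 0 "1 / Suc n"] by simp
  have "linear (\<lambda>e. \<gamma> g (inclM e) - inclM e)" for g
    by (rule linearI) (simp_all add: inclM_simps \<gamma>_simps algebra_simps)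
  then have 3: "convex {e. norm (\<gamma> g (inclM e) - inclM e) \<le> 1 / Suc n}" for g
    using affine[of "\<lambda>e. \<gamma> g (inclM e) - inclM e" 0 "1 / Suc n"] by simp
  have 4: "convex {e :: 'b. norm e \<le> 1}"
    using affine[OF linear_ident, of 0 1] by simp
  have 5: "convex {e :: 'b. star e = e}"
    by (auto simp: convex_def star_add star_scaleR)
  have "qc_set h c K n = {e. star e = e} \<inter> {e. norm e \<le> 1}
      \<inter> (\<Inter>j\<in>{..n}. {e. norm (e * h j - h j) \<le> 1 / Suc n})
      \<inter> (\<Inter>j\<in>{..n}. {e. norm (inclM e * c j - c j * inclM e) \<le> 1 / Suc n})
      \<inter> (\<Inter>g\<in>K n. {e. norm (\<gamma> g (inclM e) - inclM e) \<le> 1 / Suc n})"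
    unfolding qc_set_def by auto
  then show ?thesis by (simp only:) (intro convex_Int convex_INT 1 2 3 4 5)
qed

text \<open>
  Commutators with the \<open>c\<^sub>j\<close> and the defects of invariance tend to \<open>0\<close> strictly along the approximate unit \<open>h\<close>.
  The unit condition survives convex combinations of a tail of \<open>h\<close>.
\<close>

lemma qc_set_nonempty:
  assumes h: "\<And>n. star (h n) = h n" "\<And>n. norm (h n) \<le> 1"
    and lim: "\<And>x. x \<in> range inclM \<Longrightarrow> (\<lambda>n. inclM (h n) * x) \<longlonglongrightarrow> x"
    and K: "compact (K n)"
  shows "qc_set h c K n \<noteq> {}"
proof -
  let ?\<epsilon> = "1 / real (Suc n)"
  define A where "A = (\<lambda>j e. inclM e * c j - c j * inclM e) ` {..n}"
  define B where "B = (\<lambda>g e. \<gamma> g (inclM e) - inclM e) ` K n"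
  define C where "C = 2 + (\<Sum>j\<le>n. 2 * norm (c j))"
  have lin: "linear T" if "T \<in> A \<union> B" for T
    using that unfolding A_def B_def
    by (auto intro!: linearI simp: inclM_simps \<gamma>_simps algebra_simps)
  have C: "norm (T (h m)) \<le> C" if T: "T \<in> A \<union> B" for T m
    using T
  proof
    assume "T \<in> A"
    then obtain j where j: "j \<le> n" "T = (\<lambda>e. inclM e * c j - c j * inclM e)" by (auto simp: A_def)
    have "norm (T (h m)) \<le> 1 * norm (c j) + norm (c j) * 1"
      unfolding j(2) using h(2)[of m] by (intro order_trans[OF norm_triangle_ineq4] add_mono norm_mult_le) auto
    also have "\<dots> = 2 * norm (c j)" by simp
    also have "\<dots> \<le> (\<Sum>j\<le>n. 2 * norm (c j))" using j(1) by (intro member_le_sum) auto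
    finally show ?thesis by (simp add: C_def)
  next
    assume "T \<in> B"
    then obtain g where g: "T = (\<lambda>e. \<gamma> g (inclM e) - inclM e)" by (auto simp: B_def)
    have "norm (T (h m)) \<le> 2"
      unfolding g using norm_triangle_ineq4[of "\<gamma> g (inclM (h m))" "inclM (h m)"] h(2)[of m] by simp
    also have "\<dots> \<le> C" by (simp add: C_def sum_nonneg)
    finally show ?thesis .
  qed
  have unif: "\<forall>\<^sub>F m in sequentially. \<forall>x\<in>S. norm (inclM (h m) * x - x) < \<delta>"
    if "compact S" "S \<subseteq> range inclM" "\<delta> > 0" for S \<delta>
    using that h(2) by (intro approximate_unit_uniform lim) auto
  have orth: "\<forall>\<^sub>F m in sequentially. \<forall>T\<in>A \<union> B. norm (star (T (h m)) * T f) < \<delta>" if \<delta>: "\<delta> > 0" for f \<delta>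
  proof -
    have "\<forall>\<^sub>F m in sequentially. norm (star (inclM (h m) * c j - c j * inclM (h m)) * b) < \<delta>"
      if b: "b \<in> range inclM" for j b
    proof -
      have e: "star (inclM (h m) * c j - c j * inclM (h m)) * b =
          star (c j) * (inclM (h m) * b) - inclM (h m) * (star (c j) * b)" for m
        by (simp add: star_diff star_mult h(1) left_diff_distrib mult.assoc flip: inclM_simps(4))
      have "(\<lambda>m. star (inclM (h m) * c j - c j * inclM (h m)) * b) \<longlonglongrightarrow> star (c j) * b - star (c j) * b"
        unfolding e by (intro tendsto_diff tendsto_mult_left lim b inclM_range_intros)
      then show ?thesis using \<delta> by (simp add: tendsto_iff)
    qed
    then have "\<forall>\<^sub>F m in sequentially. \<forall>j\<in>{..n}.
        norm (star (inclM (h m) * c j - c j * inclM (h m)) * (inclM f * c j - c j * inclM f)) < \<delta>"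
      by (intro eventually_ball_finite ballI) (simp_all add: inclM_range_intros)
    then have evA: "\<forall>\<^sub>F m in sequentially. \<forall>T\<in>A. norm (star (T (h m)) * T f) < \<delta>"
      by (simp add: A_def)
    \<comment> \<open>The identity \<open>\<gamma>\<^sub>g(e) \<gamma>\<^sub>g(y) = \<gamma>\<^sub>g(e y)\<close> turns multiplication by \<open>\<gamma>\<^sub>g(e)\<close> into multiplication by \<open>e\<close>.\<close>
    define y where "y g = inclM f - \<gamma> (- g) (inclM f)" for g
    have y: "y g \<in> range inclM" for g
      unfolding y_def by (intro inclM_range_intros \<gamma>_range) auto
    have \<gamma>y: "\<gamma> g (y g) = \<gamma> g (inclM f) - inclM f" for g
      by (simp add: y_def \<gamma>_simps)
    have cont: "continuous_on UNIV (\<lambda>g. \<gamma> g (inclM f))" by (rule continuous_\<gamma>_inclM) simp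
    have "continuous_on UNIV y"
      unfolding y_def
      by (intro continuous_on_diff continuous_on_const continuous_on_compose2[OF cont] continuous_on_minus continuous_on_id) auto
    then have "compact (y ` K n)" by (intro compact_continuous_image K) (auto intro: continuous_on_subset)
    moreover have "continuous_on UNIV (\<lambda>g. \<gamma> g (y g))"
      unfolding \<gamma>y by (intro continuous_on_diff cont continuous_on_const)
    then have "compact ((\<lambda>g. \<gamma> g (y g)) ` K n)"
      by (intro compact_continuous_image K) (auto intro: continuous_on_subset)
    ultimately have "\<forall>\<^sub>F m in sequentially.
        \<forall>x \<in> y ` K n \<union> (\<lambda>g. \<gamma> g (y g)) ` K n. norm (inclM (h m) * x - x) < \<delta> / 2"
      using \<delta> y by (intro unif compact_Un) (auto intro: \<gamma>_range)
    then have "\<forall>\<^sub>F m in sequentially. \<forall>T\<in>B. norm (star (T (h m)) * T f) < \<delta>"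
    proof eventually_elim
      case (elim m)
      show ?case
      proof
        fix T assume "T \<in> B"
        then obtain g where g: "g \<in> K n" "T = (\<lambda>e. \<gamma> g (inclM e) - inclM e)" by (auto simp: B_def)
        have "star (T (h m)) * T f = \<gamma> g (inclM (h m) * y g - y g) - (inclM (h m) * \<gamma> g (y g) - \<gamma> g (y g))"
          unfolding g(2) by (simp add: \<gamma>_simps \<gamma>y star_diff h(1) algebra_simps flip: \<gamma>_simps(4) inclM_simps(4))
        then have "norm (star (T (h m)) * T f) \<le> norm (\<gamma> g (inclM (h m) * y g - y g)) + norm (inclM (h m) * \<gamma> g (y g) - \<gamma> g (y g))"
          by (metis norm_triangle_ineq4)
        moreover have "norm (inclM (h m) * y g - y g) < \<delta> / 2" "norm (inclM (h m) * \<gamma> g (y g) - \<gamma> g (y g)) < \<delta> / 2"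
          using elim g(1) by auto
        ultimately show "norm (star (T (h m)) * T f) < \<delta>" by simp
      qed
    qed
    with evA show ?thesis by eventually_elim auto
  qed
  have "(\<lambda>m. h m * h j) \<longlonglongrightarrow> h j" for j
    using lim[of "inclM (h j)"] by (simp add: tendsto_iff dist_inclM flip: inclM_simps(3))
  then have "\<forall>\<^sub>F m in sequentially. norm (h m * h j - h j) < ?\<epsilon>" for j
    by (simp add: tendsto_iff dist_norm)
  then have "\<forall>\<^sub>F m in sequentially. \<forall>j\<in>{..n}. norm (h m * h j - h j) < ?\<epsilon>"
    by (intro eventually_ball_finite) auto
  then obtain M where M: "\<And>m j. m \<ge> M \<Longrightarrow> j \<le> n \<Longrightarrow> norm (h m * h j - h j) < ?\<epsilon>"
    unfolding eventually_sequentially by auto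
  obtain f where f: "f \<in> convex hull (h ` {M..})" "\<And>T. T \<in> A \<union> B \<Longrightarrow> norm (T f) \<le> ?\<epsilon>"
    using small_convex_combination[of "A \<union> B" h C ?\<epsilon> M] lin C orth by auto
  \<comment> \<open>Without commutators and without invariance, the convex set \<open>qc_set\<close> only records the unit condition.\<close>
  have "h ` {M..} \<subseteq> qc_set h (\<lambda>_. 0) (\<lambda>_. {}) n"
    using h M by (auto simp: qc_set_def less_imp_le)
  then have "f \<in> qc_set h (\<lambda>_. 0) (\<lambda>_. {}) n"
    using f(1) hull_minimal[of _ "qc_set h (\<lambda>_. 0) (\<lambda>_. {}) n" convex] convex_qc_set by blast
  moreover have "norm (inclM f * c j - c j * inclM f) \<le> ?\<epsilon>" if "j \<le> n" for j
    using f(2)[of "\<lambda>e. inclM e * c j - c j * inclM e"] that by (auto simp: A_def)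
  moreover have "norm (\<gamma> g (inclM f) - inclM f) \<le> ?\<epsilon>" if "g \<in> K n" for g
    using f(2)[of "\<lambda>e. \<gamma> g (inclM e) - inclM e"] that by (auto simp: B_def)
  ultimately have "f \<in> qc_set h c K n" by (simp add: qc_set_def)
  then show ?thesis by blast
qed

text \<open>
  Along \<open>F\<close>, the elements of \<open>B\<close> form an approximate unit (of self-adjoint contractions) that is asymptotically
  \<open>\<gamma>\<close>-invariant, uniformly over \<open>K\<close>.
\<close>

definition almost_invariant_unit :: "'b filter \<Rightarrow> 'g set \<Rightarrow> bool" where
  "almost_invariant_unit F K \<longleftrightarrow>
     (\<forall>\<^sub>F e in F. star e = e \<and> norm e \<le> 1) \<and>
     (\<forall>x \<in> range inclM. ((\<lambda>e. inclM e * x) \<longlongrightarrow> x) F) \<and>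
     (\<forall>\<epsilon>>0. \<forall>\<^sub>F e in F. \<forall>g\<in>K. norm (\<gamma> g (inclM e) - inclM e) < \<epsilon>)"

text \<open>
  Uniformity in a compact parameter set; on the right the unit may even be translated by the action.
\<close>

lemma almost_invariant_unit_absorbs:
  fixes b :: "'z::topological_space \<Rightarrow> 'b multiplier"
  assumes F: "almost_invariant_unit F K"
    and X: "compact X" and b: "continuous_on X b" "\<forall>z\<in>X. b z \<in> range inclM"
    and g: "\<forall>z\<in>X. g z \<in> K" and \<epsilon>: "\<epsilon> > 0"
  shows "\<forall>\<^sub>F e in F. \<forall>z\<in>X. norm (inclM e * b z - b z) < \<epsilon> \<and> norm (b z * \<gamma> (g z) (inclM e) - b z) < \<epsilon>"
proof -
  have S: "compact (b ` X)" using b(1) X by (rule compact_continuous_image)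
  have S': "compact ((\<lambda>z. star (b z)) ` X)"
    using continuous_on_star[OF b(1)] X by (rule compact_continuous_image)
  obtain B where B: "B > 0" "\<And>z. z \<in> X \<Longrightarrow> norm (b z) \<le> B"
    using compact_imp_bounded[OF S] by (auto simp: bounded_pos)
  have E: "\<forall>\<^sub>F e in F. star e = e \<and> norm e \<le> 1"
    and lim: "x \<in> range inclM \<Longrightarrow> ((\<lambda>e. inclM e * x) \<longlongrightarrow> x) F"
    and inv: "\<delta> > 0 \<Longrightarrow> \<forall>\<^sub>F e in F. \<forall>g\<in>K. norm (\<gamma> g (inclM e) - inclM e) < \<delta>" for x \<delta>
    using F by (auto simp: almost_invariant_unit_def)
  have "\<forall>\<^sub>F e in F. norm (inclM e) \<le> 1" using E by eventually_elim simp
  note unif = approximate_unit_uniform[OF _ this lim]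
  have "\<forall>\<^sub>F e in F. \<forall>x\<in>b ` X. norm (inclM e * x - x) < \<epsilon>"
    using \<epsilon> b(2) by (intro unif S) auto
  moreover have "\<forall>\<^sub>F e in F. \<forall>x\<in>(\<lambda>z. star (b z)) ` X. norm (inclM e * x - x) < \<epsilon> / 2"
    using \<epsilon> b(2) by (intro unif S') (auto intro: inclM_range_intros)
  moreover have "\<forall>\<^sub>F e in F. \<forall>g\<in>K. norm (\<gamma> g (inclM e) - inclM e) < \<epsilon> / (2 * B)"
    using \<epsilon> B(1) by (intro inv) auto
  ultimately show ?thesis
    using E
  proof eventually_elim
    case (elim e)
    show ?case
    proof (intro ballI conjI)
      fix z assume z: "z \<in> X"
      show "norm (inclM e * b z - b z) < \<epsilon>" using elim(1) z by auto
      have "star (b z * inclM e - b z) = inclM e * star (b z) - star (b z)"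
        using elim(4) by (simp add: star_diff star_mult flip: inclM_simps(4))
      then have "norm (b z * inclM e - b z) = norm (inclM e * star (b z) - star (b z))"
        using norm_star[of "b z * inclM e - b z"] by simp
      then have "norm (b z * inclM e - b z) < \<epsilon> / 2" using elim(2) z by auto
      moreover have "norm (b z * (\<gamma> (g z) (inclM e) - inclM e)) \<le> B * (\<epsilon> / (2 * B))"
        using elim(3) bspec[OF g z] by (intro norm_mult_le B z) (auto intro: less_imp_le)
      then have "norm (b z * (\<gamma> (g z) (inclM e) - inclM e)) \<le> \<epsilon> / 2" using B(1) by simp
      moreover have "b z * \<gamma> (g z) (inclM e) - b z =
          b z * (\<gamma> (g z) (inclM e) - inclM e) + (b z * inclM e - b z)"
        by (simp add: right_diff_distrib)
      then have "norm (b z * \<gamma> (g z) (inclM e) - b z) \<le>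
          norm (b z * (\<gamma> (g z) (inclM e) - inclM e)) + norm (b z * inclM e - b z)"
        by (simp only: norm_triangle_ineq)
      ultimately show "norm (b z * \<gamma> (g z) (inclM e) - b z) < \<epsilon>" by linarith
    qed
  qed
qed

text \<open>
  The filter generated by the sets \<open>qc_set h c K n\<close>.
\<close>

definition qc_filter :: "(nat \<Rightarrow> 'b) \<Rightarrow> (nat \<Rightarrow> 'b multiplier) \<Rightarrow> (nat \<Rightarrow> 'g set) \<Rightarrow> 'b filter" where
  "qc_filter h c K = (INF n. principal (qc_set h c K n))"

lemma eventually_qc_filter:
  assumes K: "mono K"
  shows "eventually P (qc_filter h c K) \<longleftrightarrow> (\<exists>n. \<forall>e\<in>qc_set h c K n. P e)"
proof -
  have "\<exists>x. principal (qc_set h c K x) \<le> inf (principal (qc_set h c K a)) (principal (qc_set h c K b))" for a b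
    using qc_set_antimono[OF K, of a "max a b" h c] qc_set_antimono[OF K, of b "max a b" h c]
    by (intro exI[of _ "max a b"]) auto
  then show ?thesis
    unfolding qc_filter_def by (subst eventually_INF_base) (auto simp: eventually_principal)
qed

lemma eventually_qc_filterI:
  assumes K: "mono K" and lim: "\<And>n e. m \<le> n \<Longrightarrow> e \<in> qc_set h c K n \<Longrightarrow> r e \<le> C / Suc n"
    and \<epsilon>: "\<epsilon> > 0"
  shows "\<forall>\<^sub>F e in qc_filter h c K. r e < \<epsilon>"
proof -
  have "(\<lambda>n. C / real (Suc n)) \<longlonglongrightarrow> 0"
    by (rule LIMSEQ_Suc, rule lim_const_over_n)
  then have "\<forall>\<^sub>F n in sequentially. C / Suc n < \<epsilon> \<and> n \<ge> m"
    using \<epsilon> by (intro eventually_conj order_tendstoD eventually_ge_at_top) auto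
  then obtain n where "C / Suc n < \<epsilon>" "n \<ge> m" by (auto simp: eventually_sequentially)
  then show ?thesis
    unfolding eventually_qc_filter[OF K] using lim[of n] by (intro exI[of _ n]) fastforce
qed

lemma qc_filter_commutator:
  assumes "mono K" "\<epsilon> > 0"
  shows "\<forall>\<^sub>F e in qc_filter h c K. norm (inclM e * c j - c j * inclM e) < \<epsilon>"
  using assms by (intro eventually_qc_filterI[where m = j and C = 1]) (auto simp: qc_set_def)

lemma qc_filter_almost_invariant_unit:
  assumes K: "mono K" and h: "\<And>n. norm (h n) \<le> 1"
    and lim: "\<And>x. x \<in> range inclM \<Longrightarrow> (\<lambda>n. inclM (h n) * x) \<longlonglongrightarrow> x"
  shows "almost_invariant_unit (qc_filter h c K) (K m)"
  unfolding almost_invariant_unit_def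
proof (intro conjI ballI allI impI)
  show 1: "\<forall>\<^sub>F e in qc_filter h c K. star e = e \<and> norm e \<le> 1"
    unfolding eventually_qc_filter[OF K] by (intro exI[of _ 0]) (simp add: qc_set_def)
  show "\<forall>\<^sub>F e in qc_filter h c K. \<forall>g\<in>K m. norm (\<gamma> g (inclM e) - inclM e) < \<epsilon>" if "\<epsilon> > 0" for \<epsilon>
  proof -
    have "(\<lambda>n. 1 / real (Suc n)) \<longlonglongrightarrow> 0"
      by (rule LIMSEQ_Suc, rule lim_const_over_n)
    then have "\<forall>\<^sub>F n in sequentially. 1 / Suc n < \<epsilon> \<and> n \<ge> m"
      using that by (intro eventually_conj order_tendstoD eventually_ge_at_top) auto
    then obtain n where n: "1 / Suc n < \<epsilon>" "n \<ge> m" by (auto simp: eventually_sequentially)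
    have "norm (\<gamma> g (inclM e) - inclM e) < \<epsilon>" if "e \<in> qc_set h c K n" "g \<in> K m" for e g
    proof -
      have "norm (\<gamma> g (inclM e) - inclM e) \<le> 1 / Suc n"
        using that monoD[OF K n(2)] unfolding qc_set_def by blast
      then show ?thesis using n(1) by simp
    qed
    then show ?thesis
      unfolding eventually_qc_filter[OF K] by blast
  qed
  show "((\<lambda>e. inclM e * x) \<longlongrightarrow> x) (qc_filter h c K)" if x: "x \<in> range inclM" for x
  proof (rule tendstoI)
    fix \<epsilon> :: real assume \<epsilon>: "\<epsilon> > 0"
    have "\<forall>\<^sub>F n in sequentially. dist (inclM (h n) * x) x < \<epsilon> / 3"
      using lim[OF x] \<epsilon> by (intro tendstoD) auto
    then obtain j where "dist (inclM (h j) * x) x < \<epsilon> / 3" by (auto simp: eventually_sequentially)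
    then have j: "norm (inclM (h j) * x - x) < \<epsilon> / 3" by (simp add: dist_norm)
    have "\<forall>\<^sub>F e in qc_filter h c K. norm (e * h j - h j) * norm x < \<epsilon> / 3"
    proof (rule eventually_qc_filterI[OF K])
      show "norm (e * h j - h j) * norm x \<le> norm x / Suc n" if "j \<le> n" "e \<in> qc_set h c K n" for n e
        using that mult_right_mono[of "norm (e * h j - h j)" "1 / Suc n" "norm x"] by (auto simp: qc_set_def)
    qed (use \<epsilon> in simp)
    with 1 show "\<forall>\<^sub>F e in qc_filter h c K. dist (inclM e * x) x < \<epsilon>"
    proof eventually_elim
      case (elim e)
      let ?y = "inclM (h j) * x - x"
      have "inclM e * x - x = inclM (e * h j - h j) * x + ?y - inclM e * ?y"
        by (simp add: inclM_simps algebra_simps)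
      then have "norm (inclM e * x - x) \<le> norm (inclM (e * h j - h j) * x) + norm ?y + norm (inclM e * ?y)"
        by (simp only:) (rule order_trans[OF norm_triangle_ineq4 add_right_mono[OF norm_triangle_ineq]])
      moreover have "norm (inclM (e * h j - h j) * x) \<le> norm (e * h j - h j) * norm x"
        using norm_mult_ineq[of "inclM (e * h j - h j)" x] by simp
      moreover have "norm (inclM e * ?y) \<le> norm ?y"
        using norm_mult_le[of "inclM e" 1 ?y "norm ?y"] elim by simp
      ultimately show ?case using elim j unfolding dist_norm by linarith
    qed
  qed
qed

end

section \<open>Compressing a path of unitaries into \<open>1 + B\<close>\<close>

text \<open>
  Twisted commutators with the inverse Cayley transform are two-sided multiples of those with \<open>V\<close>, so they stay in
  any ideal.
\<close>

lemma cayley_inv_commutator: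
  fixes V V' y :: "'m::{cstar_algebra, monoid_mult}"
  assumes "norm (V - 1) \<le> 1/2" "norm (V' - 1) \<le> 1/2"
  shows "cayley_inv V * y - y * cayley_inv V' =
    (1/2) *\<^sub>R (resolvent ((1/2) *\<^sub>R (1 - V)) * (V * y - y * V') * resolvent ((1/2) *\<^sub>R (1 - V')))"
proof -
  let ?x = "(1/2) *\<^sub>R (1 - V)" and ?x' = "(1/2) *\<^sub>R (1 - V')"
  let ?N = "resolvent ?x" and ?N' = "resolvent ?x'"
  have lt: "norm ?x < 1" "norm ?x' < 1"
    using assms by (simp_all add: norm_minus_commute)
  have N: "?N * (1 - ?x) = 1" "(1 - ?x') * ?N' = 1"
    using inverse_of_resolvent[OF lt(1)] inverse_of_resolvent[OF lt(2)] by (auto simp: inverse_of_def)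
  have "cayley_inv V * y - y * cayley_inv V' = y * ?N' - ?N * y"
    by (simp add: cayley_inv_def left_diff_distrib right_diff_distrib)
  also have "\<dots> = ?N * (1 - ?x) * (y * ?N') - ?N * y * ((1 - ?x') * ?N')"
    by (simp only: N mult_1_left mult_1_right)
  also have "\<dots> = ?N * ((1 - ?x) * y - y * (1 - ?x')) * ?N'"
    by (simp only: right_diff_distrib left_diff_distrib mult.assoc)
  also have "(1 - ?x) * y - y * (1 - ?x') = (1/2) *\<^sub>R (V * y - y * V')"
    by (simp add: left_diff_distrib right_diff_distrib scaleR_diff_right)
  finally show ?thesis by simp
qed

text \<open>
  A norm-continuous path of unitaries starting at \<open>1\<close>, with norm-continuous orbit maps, together with times \<open>\<tau>\<^sub>n\<close> between which
  it moves by at most \<open>1/2\<close>.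
\<close>

locale unitary_path = unitary_cocycle \<beta> u
  for \<beta> :: "'g::{topological_group_add, second_countable_topology, t2_space} \<Rightarrow> 'b::cstar_algebra \<Rightarrow> 'b"
    and u :: "'g \<Rightarrow> 'b multiplier" +
  fixes U :: "real \<Rightarrow> 'b multiplier" and \<tau> :: "nat \<Rightarrow> real"
  assumes U_cont: "continuous_on {0..} U"
    and U_unitary: "\<And>t. t \<ge> 0 \<Longrightarrow> star (U t) * U t = 1" "\<And>t. t \<ge> 0 \<Longrightarrow> U t * star (U t) = 1"
    and U_0: "U 0 = 1"
    and orbit_cont: "\<And>t. t \<ge> 0 \<Longrightarrow> continuous_on UNIV (\<lambda>g. \<gamma> g (U t))"
    and \<tau>_0: "\<tau> 0 = 0" and \<tau>_mono: "mono \<tau>"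
    and \<tau>_step: "\<And>n t. \<tau> n \<le> t \<Longrightarrow> t \<le> \<tau> (Suc n) \<Longrightarrow> norm (U t * star (U (\<tau> n)) - 1) \<le> 1/2"
begin

text \<open>
  The increment of \<open>U\<close> over \<open>[\<tau>\<^sub>n, \<tau>\<^sub>n\<^sub>+\<^sub>1]\<close> up to time \<open>t\<close>; it is \<open>1\<close> before \<open>\<tau>\<^sub>n\<close> and constant after \<open>\<tau>\<^sub>n\<^sub>+\<^sub>1\<close>. It is
  defined and continuous on all of the real line since the clamped time is nonnegative.
\<close>

definition increment :: "nat \<Rightarrow> real \<Rightarrow> 'b multiplier" where
  "increment n t = U (max (\<tau> n) (min t (\<tau> (Suc n)))) * star (U (\<tau> n))"

text \<open>
  The small skew-adjoint element whose Cayley transform is the increment.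
\<close>

definition log_increment :: "nat \<Rightarrow> real \<Rightarrow> 'b multiplier" where
  "log_increment n t = cayley_inv (increment n t)"

text \<open>
  The product of the Cayley transforms of the first \<open>n\<close> logarithmic increments, each compressed by \<open>E\<close>.
\<close>

primrec compressed :: "nat \<Rightarrow> real \<Rightarrow> 'b multiplier \<Rightarrow> 'b multiplier" where
  "compressed 0 t E = 1"
| "compressed (Suc n) t E = cayley (E * log_increment n t * E) * compressed n t E"

text \<open>
  The path \<open>U\<close> stopped at time \<open>\<tau>\<^sub>n\<close>, that is, the product of the first \<open>n\<close> increments.
\<close>

definition stopped :: "nat \<Rightarrow> real \<Rightarrow> 'b multiplier" where
  "stopped n t = U (min t (\<tau> n))"

lemma \<tau>_nonneg: "\<tau> n \<ge> 0"
  using monoD[OF \<tau>_mono, of 0 n] by (simp add: \<tau>_0)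

lemma \<tau>_Suc: "\<tau> n \<le> \<tau> (Suc n)"
  using monoD[OF \<tau>_mono, of n "Suc n"] by simp

lemma clamp_nonneg: "0 \<le> max (\<tau> n) s"
  using \<tau>_nonneg[of n] by simp

lemma increment_unitary:
  "star (increment n t) * increment n t = 1" "increment n t * star (increment n t) = 1"
proof -
  have "U s * star (U r) * (U r * star (U s)) = 1" if "s \<ge> 0" "r \<ge> 0" for s r
  proof -
    have "U s * star (U r) * (U r * star (U s)) = U s * (star (U r) * U r) * star (U s)"
      by (simp only: mult.assoc)
    then show ?thesis using U_unitary that by simp
  qed
  then show "star (increment n t) * increment n t = 1" "increment n t * star (increment n t) = 1"
    using \<tau>_nonneg clamp_nonneg by (simp_all add: increment_def star_mult)
qed

lemma norm_increment: "norm (increment n t - 1) \<le> 1/2"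
  unfolding increment_def using \<tau>_Suc by (intro \<tau>_step) auto

lemma increment_stopped:
  assumes "t \<ge> 0"
  shows "increment n t * stopped n t = stopped (Suc n) t"
proof (cases "t \<le> \<tau> n")
  case True
  then have "t \<le> \<tau> (Suc n)" using \<tau>_Suc[of n] by simp
  then show ?thesis
    using True U_unitary(2)[OF \<tau>_nonneg] by (simp add: increment_def stopped_def max_def min_def)
next
  case False
  then show ?thesis
    using U_unitary(1)[OF \<tau>_nonneg, of n] \<tau>_Suc[of n] \<tau>_nonneg[of n]
    by (simp add: increment_def stopped_def mult.assoc min_def max_def)
qed

lemma increment_eq_1: "t \<le> \<tau> n \<Longrightarrow> increment n t = 1"
  using U_unitary(2)[OF \<tau>_nonneg] \<tau>_Suc[of n] by (simp add: increment_def max_def min_def)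

lemma stopped_unitary:
  assumes "t \<ge> 0"
  shows "star (stopped n t) * stopped n t = 1" "stopped n t * star (stopped n t) = 1"
  using U_unitary[of "min t (\<tau> n)"] assms \<tau>_nonneg by (simp_all add: stopped_def)

lemma increment_cont: "continuous_on UNIV (increment n)"
proof -
  have "continuous_on UNIV (\<lambda>t. max (\<tau> n) (min t (\<tau> (Suc n))))"
    by (intro continuous_intros)
  then have "continuous_on UNIV (\<lambda>t. U (max (\<tau> n) (min t (\<tau> (Suc n)))))"
    by (rule continuous_on_compose2[OF U_cont]) (auto simp: clamp_nonneg)
  then show ?thesis
    unfolding increment_def by (rule continuous_on_mult_right)
qed

lemma log_increment_cont: "continuous_on UNIV (log_increment n)"
  unfolding log_increment_def by (intro continuous_on_cayley_inv increment_cont norm_increment)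

lemma log_increment:
  "star (log_increment n t) = - log_increment n t" "norm (log_increment n t) \<le> 1/2"
  "cayley (log_increment n t) = increment n t"
  unfolding log_increment_def
  by (rule star_cayley_inv norm_cayley_inv cayley_cayley_inv; rule increment_unitary norm_increment)+

lemma stopped_cont: "continuous_on {0..} (stopped n)"
proof -
  have "continuous_on {0..} (\<lambda>t. min t (\<tau> n))" by (intro continuous_intros)
  then show ?thesis
    unfolding stopped_def by (rule continuous_on_compose2[OF U_cont]) (auto simp: \<tau>_nonneg)
qed

lemma orbit_stopped_cont: "continuous_on ({0..} \<times> UNIV) (\<lambda>(t, g). \<gamma> g (stopped n t))"
  unfolding split_beta
proof (rule continuous_on_\<gamma>_apply)
  show "continuous_on UNIV (\<lambda>g. \<gamma> g (stopped n (fst z)))" if "z \<in> {0..} \<times> UNIV" for z :: "real \<times> 'g"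
    using that \<tau>_nonneg unfolding stopped_def by (intro orbit_cont) auto
  show "continuous_on ({0..} \<times> UNIV) (\<lambda>z :: real \<times> 'g. stopped n (fst z))"
    by (rule continuous_on_compose2[OF stopped_cont continuous_on_fst[OF continuous_on_id]]) auto
qed (rule continuous_on_snd[OF continuous_on_id])

lemma orbit_increment_cont: "continuous_on UNIV (\<lambda>(t, g). \<gamma> g (increment n t))"
  unfolding split_beta
proof (rule continuous_on_\<gamma>_apply)
  show "continuous_on UNIV (\<lambda>g. \<gamma> g (increment n (fst z)))" for z :: "real \<times> 'g"
    unfolding increment_def \<gamma>_simps
    by (intro continuous_on_mult continuous_on_star orbit_cont clamp_nonneg \<tau>_nonneg)
  show "continuous_on UNIV (\<lambda>z :: real \<times> 'g. increment n (fst z))"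
    by (rule continuous_on_compose2[OF increment_cont continuous_on_fst[OF continuous_on_id]]) auto
qed (rule continuous_on_snd[OF continuous_on_id])

lemma \<gamma>_log_increment: "\<gamma> g (log_increment n t) = cayley_inv (\<gamma> g (increment n t))"
  unfolding log_increment_def by (rule star_hom_cayley_inv[OF \<gamma>_hom \<gamma>_1 norm_increment])

lemma norm_\<gamma>_increment: "norm (\<gamma> g (increment n t) - 1) \<le> 1/2"
proof -
  have "\<gamma> g (increment n t) - 1 = \<gamma> g (increment n t - 1)" by (simp add: \<gamma>_simps)
  then show ?thesis using norm_increment by simp
qed

lemma orbit_log_increment_cont: "continuous_on UNIV (\<lambda>(t, g). \<gamma> g (log_increment n t))"
  using orbit_increment_cont[of n] unfolding \<gamma>_log_increment split_beta
  by (intro continuous_on_cayley_inv norm_\<gamma>_increment)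

lemma compressed_unitary:
  assumes E: "star E = E" "norm E \<le> 1"
  shows "star (compressed n t E) * compressed n t E = 1" "compressed n t E * star (compressed n t E) = 1"
proof (induction n)
  case (Suc n)
  let ?W = "cayley (E * log_increment n t * E)" and ?p = "compressed n t E"
  note \<kappa> = compression_skew[OF E log_increment(1,2)[of n t]]
  have W: "star ?W * ?W = 1" "?W * star ?W = 1"
    by (rule cayley_unitary[OF \<kappa>(1)]; use \<kappa>(2) in simp)+
  have "star (compressed (Suc n) t E) * compressed (Suc n) t E = star ?p * (star ?W * ?W) * ?p"
    "compressed (Suc n) t E * star (compressed (Suc n) t E) = ?W * (?p * star ?p) * star ?W"
    by (simp_all only: compressed.simps star_mult mult.assoc)
  then show "star (compressed (Suc n) t E) * compressed (Suc n) t E = 1"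
    "compressed (Suc n) t E * star (compressed (Suc n) t E) = 1"
    by (simp_all add: W Suc)
qed (simp_all add: star_one)

lemma compressed_one_plus:
  assumes E: "star (inclM e) = inclM e" "norm e \<le> 1"
  shows "compressed n t (inclM e) - 1 \<in> range inclM"
proof (induction n)
  case 0
  then show ?case by (simp flip: inclM_simps(6))
next
  case (Suc n)
  let ?\<kappa> = "inclM e * log_increment n t * inclM e" and ?p = "compressed n t (inclM e)"
  have "norm ?\<kappa> < 1"
    using compression_skew(2)[OF E(1) _ log_increment(1,2)[of n t]] E(2) by simp
  then have "cayley ?\<kappa> - 1 = 2 *\<^sub>R (resolvent ?\<kappa> * ?\<kappa>)"
    by (simp only: resolvent_mult cayley_def scaleR_2) (simp add: algebra_simps)
  moreover have "2 *\<^sub>R (resolvent ?\<kappa> * ?\<kappa>) \<in> range inclM"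
    by (intro inclM_range_intros(3,4,5)) simp
  ultimately have "cayley ?\<kappa> - 1 \<in> range inclM" by simp
  then have "(cayley ?\<kappa> - 1) * ?p + (?p - 1) \<in> range inclM"
    by (intro inclM_range_intros(1)[OF inclM_range_intros(4) Suc])
  then show ?case by (simp add: left_diff_distrib)
qed

lemma compressed_stable:
  assumes "t \<le> \<tau> n" "n \<le> m"
  shows "compressed m t E = compressed n t E"
  using assms(2)
proof (induction m rule: dec_induct)
  case (step m)
  have "t \<le> \<tau> m" using assms(1) monoD[OF \<tau>_mono step.hyps(1)] by simp
  then show ?case by (simp add: step log_increment_def increment_eq_1)
qed simp

lemma compressed_cont:
  assumes "continuous_on S f" "continuous_on S E" "\<And>s. s \<in> S \<Longrightarrow> star (E s) = E s \<and> norm (E s) \<le> 1"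
  shows "continuous_on S (\<lambda>s. compressed n (f s) (E s))"
proof (induction n)
  case (Suc n)
  have "continuous_on S (\<lambda>s. E s * log_increment n (f s) * E s)"
    by (intro continuous_on_mult assms continuous_on_compose2[OF log_increment_cont]) auto
  moreover have "norm (E s * log_increment n (f s) * E s) \<le> 1/2" if "s \<in> S" for s
    using compression_skew(2)[OF _ _ log_increment(1,2)] assms(3)[OF that] by blast
  ultimately show ?case
    unfolding compressed.simps by (intro continuous_on_mult[OF continuous_on_cayley Suc])
qed simp

lemma \<gamma>_unitary: "star w * w = 1 \<Longrightarrow> star (\<gamma> g w) * \<gamma> g w = 1"
  by (metis \<gamma>_1 \<gamma>_simps(3,4))

text \<open>
  The twisted conjugate of \<open>y0\<close> by the stopped path.
\<close>

definition conj_stopped :: "'b multiplier \<Rightarrow> nat \<Rightarrow> real \<Rightarrow> 'g \<Rightarrow> 'b multiplier" where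
  "conj_stopped y0 n t g = stopped n t * y0 * star (\<gamma> g (stopped n t))"

text \<open>
  The twisted commutator of the next logarithmic increment with that conjugate, which the compression has to absorb.
\<close>

definition comm_increment :: "'b multiplier \<Rightarrow> nat \<Rightarrow> real \<Rightarrow> 'g \<Rightarrow> 'b multiplier" where
  "comm_increment y0 n t g =
    log_increment n t * conj_stopped y0 n t g - conj_stopped y0 n t g * \<gamma> g (log_increment n t)"

context
  fixes y0 :: "'b multiplier" and K :: "'g set" and F :: "'b filter"
  assumes K: "compact K"
    and comm: "\<And>t g. t \<ge> 0 \<Longrightarrow> g \<in> K \<Longrightarrow> U t * y0 - y0 * \<gamma> g (U t) \<in> range inclM"
    and F: "almost_invariant_unit F K"
    and F_y0: "\<And>\<epsilon>. \<epsilon> > 0 \<Longrightarrow> \<forall>\<^sub>F e in F. \<forall>g\<in>K. norm (inclM e * y0 - y0 * \<gamma> g (inclM e)) < \<epsilon>"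
begin

lemma conj_stopped_mod:
  assumes "t \<ge> 0" "g \<in> K"
  shows "conj_stopped y0 n t g - y0 \<in> range inclM"
proof -
  have s: "\<gamma> g (stopped n t) * star (\<gamma> g (stopped n t)) = 1"
    using stopped_unitary(2)[OF assms(1), of n] by (metis \<gamma>_1 \<gamma>_simps(3,4))
  have "(stopped n t * y0 - y0 * \<gamma> g (stopped n t)) * star (\<gamma> g (stopped n t)) \<in> range inclM"
    unfolding stopped_def using assms \<tau>_nonneg by (intro inclM_range_intros(4) comm) auto
  then show ?thesis
    by (simp add: conj_stopped_def left_diff_distrib mult.assoc s)
qed

lemma conj_stopped_Suc:
  assumes "t \<ge> 0"
  shows "increment n t * conj_stopped y0 n t g * star (\<gamma> g (increment n t)) = conj_stopped y0 (Suc n) t g"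
  by (simp add: conj_stopped_def increment_stopped[OF assms, symmetric] \<gamma>_simps star_mult mult.assoc)

lemma comm_increment_range:
  assumes "t \<ge> 0" "g \<in> K"
  shows "comm_increment y0 n t g \<in> range inclM"
proof -
  let ?V = "increment n t" and ?y = "conj_stopped y0 n t g"
  have "?V * ?y - ?y * \<gamma> g ?V =
    ((conj_stopped y0 (Suc n) t g - y0) - (conj_stopped y0 n t g - y0)) * \<gamma> g ?V"
    using \<gamma>_unitary[OF increment_unitary(1), of g n t]
    by (simp add: conj_stopped_Suc[OF assms(1), symmetric] left_diff_distrib mult.assoc)
  also have "\<dots> \<in> range inclM"
    by (intro inclM_range_intros conj_stopped_mod assms)
  finally show ?thesis
    unfolding comm_increment_def \<gamma>_log_increment
    unfolding log_increment_def
    by (simp only: cayley_inv_commutator[OF norm_increment norm_\<gamma>_increment] inclM_range_intros(3,4,5))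
qed

lemma conj_stopped_cont: "continuous_on ({0..} \<times> K) (\<lambda>(t, g). conj_stopped y0 n t g)"
proof -
  have "continuous_on ({0..} \<times> K) (\<lambda>z. stopped n (fst z))"
    by (rule continuous_on_compose2[OF stopped_cont continuous_on_fst[OF continuous_on_id]]) auto
  moreover have "continuous_on ({0..} \<times> K) (\<lambda>z. \<gamma> (snd z) (stopped n (fst z)))"
    using orbit_stopped_cont[of n] unfolding split_beta by (rule continuous_on_subset) auto
  ultimately show ?thesis
    unfolding conj_stopped_def split_beta
    by (intro continuous_on_mult continuous_on_const continuous_on_star)
qed

lemma log_increment_cont2:
  "continuous_on ({0..} \<times> K) (\<lambda>(t, g). log_increment n t)"
  "continuous_on ({0..} \<times> K) (\<lambda>(t, g). \<gamma> g (log_increment n t))"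
proof -
  show "continuous_on ({0..} \<times> K) (\<lambda>(t, g). log_increment n t)"
    unfolding split_beta
    by (rule continuous_on_compose2[OF log_increment_cont continuous_on_fst[OF continuous_on_id]]) auto
  show "continuous_on ({0..} \<times> K) (\<lambda>(t, g). \<gamma> g (log_increment n t))"
    using orbit_log_increment_cont[of n] by (rule continuous_on_subset) auto
qed

lemma comm_increment_cont: "continuous_on ({0..} \<times> K) (\<lambda>(t, g). comm_increment y0 n t g)"
  using log_increment_cont2[of n] conj_stopped_cont[of n]
  unfolding comm_increment_def split_beta by (intro continuous_on_diff continuous_on_mult)

text \<open>
  The compressed path conjugates \<open>y0\<close> almost as the stopped path does, uniformly on \<open>[0, T]\<close> and \<open>K\<close>. Each
  further increment costs one application of the key estimate.
\<close>

lemma compressed_conj: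
  assumes \<epsilon>: "\<epsilon> > 0"
  shows "\<forall>\<^sub>F e in F. \<forall>t\<in>{0..T}. \<forall>g\<in>K.
    norm (compressed n t (inclM e) * y0 * star (\<gamma> g (compressed n t (inclM e))) - conj_stopped y0 n t g) < \<epsilon>"
  using \<epsilon>
proof (induction n arbitrary: \<epsilon>)
  case 0
  have "conj_stopped y0 0 t g = y0" if "t \<ge> 0" for t g
    using that by (simp add: conj_stopped_def stopped_def \<tau>_0 U_0 star_one)
  then show ?case using 0 by (simp add: star_one)
next
  case (Suc n)
  define X where "X = {0..T} \<times> K"
  have X: "compact X" unfolding X_def by (intro compact_Times K compact_Icc)
  have sub: "X \<subseteq> {0..} \<times> K" by (auto simp: X_def)
  note cont = continuous_on_subset[OF _ sub]
  let ?d = "\<lambda>z. comm_increment y0 n (fst z) (snd z)"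
  let ?M = "\<lambda>z. resolvent (log_increment n (fst z))"
  let ?M' = "\<lambda>z. star (resolvent (\<gamma> (snd z) (log_increment n (fst z))))"
  let ?b = "\<lambda>z. conj_stopped y0 n (fst z) (snd z) - y0"
  \<comment> \<open>The key estimate is applied with total error \<open>16 (3\<delta> + 4\<delta>) = \<epsilon> / 2\<close>.\<close>
  define \<delta> where "\<delta> = \<epsilon> / 224"
  have \<delta>: "\<delta> > 0" using Suc.prems by (simp add: \<delta>_def)
  have d: "continuous_on X ?d" "\<forall>z\<in>X. ?d z \<in> range inclM"
    using cont[OF comm_increment_cont[of n]] comm_increment_range by (auto simp: split_beta X_def)
  have b: "continuous_on X ?b" "\<forall>z\<in>X. ?b z \<in> range inclM"
    using cont[OF conj_stopped_cont[of n]] conj_stopped_mod by (auto simp: split_beta X_def intro!: continuous_intros)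
  have "continuous_on X ?M"
    using cont[OF log_increment_cont2(1)[of n]] log_increment(2)
    by (intro continuous_on_resolvent) (auto simp: split_beta)
  then have Md: "continuous_on X (\<lambda>z. ?M z * ?d z)" "\<forall>z\<in>X. ?M z * ?d z \<in> range inclM"
    using d by (auto intro: continuous_on_mult inclM_range_intros)
  have "continuous_on X ?M'"
    using cont[OF log_increment_cont2(2)[of n]] log_increment(2)
    by (intro continuous_on_star continuous_on_resolvent) (auto simp: split_beta)
  then have dM: "continuous_on X (\<lambda>z. ?d z * ?M' z)" "\<forall>z\<in>X. ?d z * ?M' z \<in> range inclM"
    using d by (auto intro: continuous_on_mult inclM_range_intros)
  have g: "\<forall>z\<in>X. snd z \<in> K" by (auto simp: X_def)
  note absorb = almost_invariant_unit_absorbs[where g = snd, OF F X _ _ g \<delta>]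
  have "\<forall>\<^sub>F e in F. star e = e \<and> norm e \<le> 1" using F by (simp add: almost_invariant_unit_def)
  with absorb[OF d] absorb[OF b] absorb[OF Md] absorb[OF dM] F_y0[OF \<delta>] Suc.IH[OF half_gt_zero[OF Suc.prems]]
  show ?case
  proof eventually_elim
    case (elim e)
    show ?case
    proof (intro ballI)
      fix t g assume t: "t \<in> {0..T}" and g: "g \<in> K"
      then have z: "(t, g) \<in> X" and t0: "t \<ge> 0" by (auto simp: X_def)
      let ?E = "inclM e" and ?E' = "\<gamma> g (inclM e)"
      let ?k = "log_increment n t" and ?y = "conj_stopped y0 n t g" and ?d = "comm_increment y0 n t g"
      let ?p = "compressed n t ?E"
      have E: "star ?E = ?E" "norm ?E \<le> 1" and E': "star ?E' = ?E'" "norm ?E' \<le> 1"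
        using elim(7) by (simp_all flip: inclM_simps(4) \<gamma>_simps(4))
      have k': "star (\<gamma> g ?k) = - \<gamma> g ?k" "norm (\<gamma> g ?k) \<le> 1/2"
        using log_increment[of n t] linear_neg[OF \<gamma>_linear] by (simp_all flip: \<gamma>_simps(4))
      let ?W = "cayley (?E * ?k * ?E)"
      note \<kappa> = compression_skew[OF E log_increment(1,2)[of n t]]
      have W: "star ?W * ?W = 1" by (rule cayley_unitary[OF \<kappa>(1)]) (use \<kappa>(2) in simp)
      have \<gamma>W: "\<gamma> g ?W = cayley (?E' * \<gamma> g ?k * ?E')"
        using star_hom_cayley[OF \<gamma>_hom \<gamma>_1, of "?E * ?k * ?E" g] \<kappa>(2) by (simp add: \<gamma>_simps)
      have \<gamma>V: "cayley (\<gamma> g ?k) = \<gamma> g (increment n t)"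
        using star_hom_cayley[OF \<gamma>_hom \<gamma>_1, of ?k g] log_increment[of n t] by simp
      have "?E * ?y - ?y * ?E' = (?E * y0 - y0 * ?E') + (?E * (?y - y0) - (?y - y0))
          - ((?y - y0) * ?E' - (?y - y0))"
        by (simp add: algebra_simps)
      also have "norm \<dots> \<le> \<delta> + \<delta> + \<delta>"
        using bspec[OF elim(2) z] bspec[OF elim(5) g]
        by (intro order_trans[OF norm_triangle_ineq4 add_mono[OF norm_triangle_mono]]) auto
      finally have c: "norm (?E * ?y - ?y * ?E') \<le> 3 * \<delta>" by simp
      have "norm (?W * ?y * star (\<gamma> g ?W) - cayley ?k * ?y * star (cayley (\<gamma> g ?k))) \<le>
          16 * (norm (?E * ?y - ?y * ?E') + norm (?E * ?d - ?d) + norm (?d * ?E' - ?d)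
            + norm (?E * (resolvent ?k * ?d) - resolvent ?k * ?d)
            + norm (?d * star (resolvent (\<gamma> g ?k)) * ?E' - ?d * star (resolvent (\<gamma> g ?k))))"
        unfolding \<gamma>W comm_increment_def by (rule cayley_compression_conj[OF E E' log_increment(1,2) k'])
      also have "\<dots> \<le> 16 * (3 * \<delta> + \<delta> + \<delta> + \<delta> + \<delta>)"
        using c bspec[OF elim(1) z] bspec[OF elim(3) z] bspec[OF elim(4) z]
        by (intro mult_left_mono add_mono) auto
      also have "\<dots> = \<epsilon> / 2" by (simp add: \<delta>_def)
      finally have 1: "norm (?W * ?y * star (\<gamma> g ?W) - conj_stopped y0 (Suc n) t g) \<le> \<epsilon> / 2"
        unfolding \<gamma>V log_increment(3) conj_stopped_Suc[OF t0] .
      have "norm (?W * (?p * y0 * star (\<gamma> g ?p) - ?y) * star (\<gamma> g ?W)) \<le> norm (?p * y0 * star (\<gamma> g ?p) - ?y)"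
        by (intro norm_conj_le W \<gamma>_unitary)
      also have "\<dots> < \<epsilon> / 2" using elim(6) t g by auto
      finally have 2: "norm (?W * (?p * y0 * star (\<gamma> g ?p) - ?y) * star (\<gamma> g ?W)) < \<epsilon> / 2" .
      have "compressed (Suc n) t ?E * y0 * star (\<gamma> g (compressed (Suc n) t ?E)) - conj_stopped y0 (Suc n) t g
        = ?W * (?p * y0 * star (\<gamma> g ?p) - ?y) * star (\<gamma> g ?W)
          + (?W * ?y * star (\<gamma> g ?W) - conj_stopped y0 (Suc n) t g)"
        by (simp add: \<gamma>_simps star_mult algebra_simps)
      then have "norm (compressed (Suc n) t ?E * y0 * star (\<gamma> g (compressed (Suc n) t ?E)) - conj_stopped y0 (Suc n) t g)
        \<le> norm (?W * (?p * y0 * star (\<gamma> g ?p) - ?y) * star (\<gamma> g ?W))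
          + norm (?W * ?y * star (\<gamma> g ?W) - conj_stopped y0 (Suc n) t g)"
        by (simp only: norm_triangle_ineq)
      then show "norm (compressed (Suc n) t ?E * y0 * star (\<gamma> g (compressed (Suc n) t ?E))
          - conj_stopped y0 (Suc n) t g) < \<epsilon>"
        using 1 2 by linarith
    qed
  qed
qed

end

end

section \<open>Selecting the compressing elements\<close>

lemma continuous_on_half_lineI:
  fixes f :: "real \<Rightarrow> 'v::topological_space"
  assumes "\<And>N :: nat. continuous_on {0..real N} f"
  shows "continuous_on {0..} f"
  unfolding continuous_on_def
proof
  fix t :: real assume t: "t \<in> {0..}"
  obtain N :: nat where N: "t < real N" using reals_Archimedean2 by blast
  have "at t within {0..} = at t within {0..real N}"
    by (rule at_within_nhd[of _ "{..<real N}"]) (use N in auto)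
  moreover have "(f \<longlongrightarrow> f t) (at t within {0..real N})"
    using assms[of N] t N by (simp add: continuous_on_def)
  ultimately show "(f \<longlongrightarrow> f t) (at t within {0..})" by simp
qed

lemma piecewise_linear_interpolation:
  fixes f :: "nat \<Rightarrow> 'v::real_normed_vector"
  obtains e :: "real \<Rightarrow> 'v" where "continuous_on {0..} e"
    "\<And>n t. real n \<le> t \<Longrightarrow> t \<le> real (Suc n) \<Longrightarrow> e t = (1 - (t - real n)) *\<^sub>R f n + (t - real n) *\<^sub>R f (Suc n)"
proof -
  define s where "s N t = f 0 + (\<Sum>i<N. max 0 (min 1 (t - real i)) *\<^sub>R (f (Suc i) - f i))" for N :: nat and t :: real
  have stable: "s M t = s N t" if "N \<le> M" "t \<le> real N" for M N t
  proof -
    have "(\<Sum>i<M. max 0 (min 1 (t - real i)) *\<^sub>R (f (Suc i) - f i)) =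
        (\<Sum>i<N. max 0 (min 1 (t - real i)) *\<^sub>R (f (Suc i) - f i))"
      using that by (intro sum.mono_neutral_right) auto
    then show ?thesis by (simp add: s_def)
  qed
  define e where "e t = s (nat \<lceil>t\<rceil>) t" for t
  have e: "e t = s N t" if "0 \<le> t" "t \<le> real N" for t N
    unfolding e_def using that by (intro stable[symmetric]) linarith+
  have "continuous_on {0..real N} e" for N
  proof -
    have "continuous_on {0..real N} (s N)" unfolding s_def by (intro continuous_intros)
    then show ?thesis using e by (subst continuous_on_cong[OF refl, of _ _ "s N"]) auto
  qed
  then have "continuous_on {0..} e" by (rule continuous_on_half_lineI)
  moreover have "e t = (1 - (t - real n)) *\<^sub>R f n + (t - real n) *\<^sub>R f (Suc n)"
    if t: "real n \<le> t" "t \<le> real (Suc n)" for n t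
  proof -
    have "(\<Sum>i<n. max 0 (min 1 (t - real i)) *\<^sub>R (f (Suc i) - f i)) = (\<Sum>i<n. f (Suc i) - f i)"
      using t by (intro sum.cong) auto
    also have "\<dots> = f n - f 0" by (rule sum_lessThan_telescope)
    finally have "s (Suc n) t = f n + (t - real n) *\<^sub>R (f (Suc n) - f n)"
      using t by (simp add: s_def)
    then show ?thesis using e[of t "Suc n"] t by (simp add: algebra_simps)
  qed
  ultimately show thesis by (rule that)
qed

context unitary_path
begin

lemma compressed_eq:
  assumes "t \<le> \<tau> m" "t \<le> \<tau> n"
  shows "compressed m t E = compressed n t E"
  using compressed_stable[of t m n E] compressed_stable[of t n m E] assms
  by (cases "m \<le> n") auto

text \<open>
  For \<open>t\<close> in \<open>[n, n+1]\<close> the path is \<open>compressed (N n) t e\<^sub>t\<close>, where \<open>\<tau>\<close> has passed \<open>n + 1\<close> at index \<open>N n\<close> and \<open>e\<^sub>t\<close> lies in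
  a convex set of elements that are good for all times up to \<open>n + 1\<close>.
\<close>

lemma exists_asymptotic_path:
  fixes c :: "nat \<Rightarrow> 'b multiplier" and K :: "nat \<Rightarrow> 'g set"
  assumes \<tau>: "\<And>t. \<exists>n. t \<le> \<tau> n"
    and B: "sigma_unital TYPE('b)"
    and c: "\<And>t j. t \<ge> 0 \<Longrightarrow> U t * c j - c j * U t \<in> range inclM"
    and inv: "\<And>t g. t \<ge> 0 \<Longrightarrow> U t - \<gamma> g (U t) \<in> range inclM"
    and K: "mono K" "\<And>n. compact (K n)"
  obtains w where "continuous_on {0..} w" "w 0 = 1"
    "\<And>t. t \<ge> 0 \<Longrightarrow> star (w t) * w t = 1 \<and> w t * star (w t) = 1 \<and> w t - 1 \<in> range inclM"
    "\<And>j \<epsilon>. \<epsilon> > 0 \<Longrightarrow> \<forall>\<^sub>F t in at_top. norm (w t * c j * star (w t) - U t * c j * star (U t)) < \<epsilon>"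
    "\<And>m \<epsilon>. \<epsilon> > 0 \<Longrightarrow> \<forall>\<^sub>F t in at_top. \<forall>g\<in>K m. norm (w t * star (\<gamma> g (w t)) - U t * star (\<gamma> g (U t))) < \<epsilon>"
proof -
  obtain h :: "nat \<Rightarrow> 'b" where h: "\<And>n. star (h n) = h n" "\<And>n. norm (h n) \<le> 1"
    "\<And>x. x \<in> range inclM \<Longrightarrow> (\<lambda>n. inclM (h n) * x) \<longlonglongrightarrow> x"
    using sigma_unitalE[OF B] by metis
  \<comment> \<open>The neutral element covers the untwisted case, in which \<open>\<gamma> 0\<close> is the identity.\<close>
  define K0 where "K0 n = insert 0 (K n)" for n
  have K0: "mono K0" "compact (K0 n)" for n
    using K monoD[OF K(1)] by (auto simp: K0_def mono_def)
  let ?F = "qc_filter h c K0" and ?Q = "qc_set h c K0"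
  have unit: "almost_invariant_unit ?F (K0 m)" for m
    by (rule qc_filter_almost_invariant_unit[OF K0(1) h(2,3)])
  then have unit0: "almost_invariant_unit ?F {0}"
    by (auto simp: almost_invariant_unit_def eventually_mono K0_def)
  have stopped: "stopped n t = U t" if "t \<le> \<tau> n" for n t
    using that by (simp add: stopped_def)

  have "\<forall>n. \<exists>m. real (Suc n) \<le> \<tau> m" using \<tau> by blast
  then obtain N where N: "\<And>n. real (Suc n) \<le> \<tau> (N n)" by metis
  define good where "good n e \<longleftrightarrow> (\<forall>t\<in>{0..real (Suc n)}.
      (\<forall>j\<in>{..n}. norm (compressed (N n) t (inclM e) * c j * star (compressed (N n) t (inclM e))
          - U t * c j * star (U t)) < 1 / Suc n) \<and>
      (\<forall>g\<in>K n. norm (compressed (N n) t (inclM e) * star (\<gamma> g (compressed (N n) t (inclM e)))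
          - U t * star (\<gamma> g (U t))) < 1 / Suc n))" for n e
  have "\<forall>\<^sub>F e in ?F. good n e" for n
  proof -
    have \<epsilon>: "1 / real (Suc n) > 0" by simp
    have "\<forall>\<^sub>F e in ?F. \<forall>t\<in>{0..real (Suc n)}. \<forall>g\<in>{0}. norm (compressed (N n) t (inclM e) * c j
        * star (\<gamma> g (compressed (N n) t (inclM e))) - conj_stopped (c j) (N n) t g) < 1 / Suc n" for j
      using qc_filter_commutator[OF K0(1)] c by (intro compressed_conj unit0 \<epsilon>) auto
    then have "\<forall>\<^sub>F e in ?F. \<forall>j\<in>{..n}. \<forall>t\<in>{0..real (Suc n)}. \<forall>g\<in>{0}. norm (compressed (N n) t (inclM e) * c j
        * star (\<gamma> g (compressed (N n) t (inclM e))) - conj_stopped (c j) (N n) t g) < 1 / Suc n"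
      by (intro eventually_ball_finite) auto
    moreover have "\<forall>\<^sub>F e in ?F. \<forall>t\<in>{0..real (Suc n)}. \<forall>g\<in>K0 n. norm (compressed (N n) t (inclM e) * 1
        * star (\<gamma> g (compressed (N n) t (inclM e))) - conj_stopped 1 (N n) t g) < 1 / Suc n"
    proof (intro compressed_conj unit \<epsilon> K0)
      show "\<forall>\<^sub>F e in ?F. \<forall>g\<in>K0 n. norm (inclM e * 1 - 1 * \<gamma> g (inclM e)) < \<delta>" if "\<delta> > 0" for \<delta>
        using unit[of n] that by (simp add: almost_invariant_unit_def norm_minus_commute)
    qed (use inv in auto)
    ultimately show ?thesis
    proof eventually_elim
      case (elim e)
      have st: "stopped (N n) t = U t" if "t \<in> {0..real (Suc n)}" for t
        using N[of n] that by (intro stopped) simp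
      show ?case
        unfolding good_def
      proof (intro ballI conjI)
        fix t j assume t: "t \<in> {0..real (Suc n)}" and j: "j \<in> {..n}"
        show "norm (compressed (N n) t (inclM e) * c j * star (compressed (N n) t (inclM e))
          - U t * c j * star (U t)) < 1 / Suc n"
          using bspec[OF bspec[OF bspec[OF elim(1) j] t], of 0] by (simp add: conj_stopped_def st[OF t])
      next
        fix t g assume t: "t \<in> {0..real (Suc n)}" and g: "g \<in> K n"
        show "norm (compressed (N n) t (inclM e) * star (\<gamma> g (compressed (N n) t (inclM e)))
          - U t * star (\<gamma> g (U t))) < 1 / Suc n"
          using bspec[OF bspec[OF elim(2) t], of g] g by (simp add: K0_def conj_stopped_def st[OF t])
      qed
    qed
  qed
  then obtain q where q: "\<And>n e. e \<in> ?Q (q n) \<Longrightarrow> good n e"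
    unfolding eventually_qc_filter[OF K0(1)] by metis
  \<comment> \<open>Increasing indices, so that both endpoints of the segment over \<open>[n, n+1]\<close> lie in the \<open>n\<close>-th set.\<close>
  define r where "r n = (\<Sum>i\<le>n. q i)" for n
  have r: "q n \<le> r n" "r n \<le> r (Suc n)" for n
    unfolding r_def by (auto intro: member_le_sum)
  have "?Q (r n) \<noteq> {}" for n
    by (rule qc_set_nonempty) (use h K0(2) in auto)
  then have "\<forall>n. \<exists>f. f \<in> ?Q (r n)" by blast
  then obtain f where f: "\<And>n. f n \<in> ?Q (r n)" by metis
  obtain e where e: "continuous_on {0..} e"
    "\<And>n t. real n \<le> t \<Longrightarrow> t \<le> real (Suc n) \<Longrightarrow> e t = (1 - (t - real n)) *\<^sub>R f n + (t - real n) *\<^sub>R f (Suc n)"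
    by (rule piecewise_linear_interpolation[of f]) blast
  have eQ: "e t \<in> ?Q (r n)" if "real n \<le> t" "t \<le> real (Suc n)" for n t
    unfolding e(2)[OF that]
    using that f[of n] f[of "Suc n"] qc_set_antimono[OF K0(1) r(2)]
    by (intro convexD[OF convex_qc_set]) auto
  have floor: "real (nat \<lfloor>t\<rfloor>) \<le> t" "t \<le> real (Suc (nat \<lfloor>t\<rfloor>))" if "t \<ge> 0" for t
    using that by linarith+
  have e_sa: "star (inclM (e t)) = inclM (e t) \<and> norm (inclM (e t)) \<le> 1" if "t \<ge> 0" for t
    using eQ[OF floor[OF that]] by (simp add: qc_set_def flip: inclM_simps(4))

  define w where "w t = compressed (N (nat \<lfloor>t\<rfloor>)) t (inclM (e t))" for t
  have \<tau>N: "t \<le> \<tau> (N (nat \<lfloor>t\<rfloor>))" if "t \<ge> 0" for t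
    using N[of "nat \<lfloor>t\<rfloor>"] floor[OF that] by linarith
  have good: "good (nat \<lfloor>t\<rfloor>) (e t)" if "t \<ge> 0" for t
    using eQ[OF floor[OF that]] qc_set_antimono[OF K0(1) r(1)] q by blast
  have late: "\<forall>\<^sub>F t :: real in at_top. t \<ge> 0 \<and> m \<le> nat \<lfloor>t\<rfloor> \<and> 1 / Suc (nat \<lfloor>t\<rfloor>) < \<epsilon>" if \<epsilon>: "\<epsilon> > 0" for m \<epsilon>
  proof -
    obtain n where n: "1 / real (Suc n) < \<epsilon>" using \<epsilon> nat_approx_posE by blast
    have "t \<ge> 0 \<and> m \<le> nat \<lfloor>t\<rfloor> \<and> 1 / Suc (nat \<lfloor>t\<rfloor>) < \<epsilon>" if t: "t \<ge> real (max m n)" for t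
    proof -
      have le: "max m n \<le> nat \<lfloor>t\<rfloor>" using t by (simp add: le_nat_floor)
      then have "1 / real (Suc (nat \<lfloor>t\<rfloor>)) \<le> 1 / real (Suc n)" by (intro frac_le) auto
      then have "1 / real (Suc (nat \<lfloor>t\<rfloor>)) < \<epsilon>" using n by (rule order_le_less_trans)
      moreover have "t \<ge> 0" using t by (rule order_trans[OF of_nat_0_le_iff])
      ultimately show ?thesis using le by simp
    qed
    then show ?thesis by (rule eventually_at_top_linorderI)
  qed
  show thesis
  proof (rule that[of w])
    show "continuous_on {0..} w"
    proof (rule continuous_on_half_lineI)
      fix n :: nat
      have "continuous_on {0..real n} (\<lambda>t. compressed (N n) t (inclM (e t)))"
        using e(1) e_sa
        by (intro compressed_cont continuous_on_id) (auto simp: continuous_on_inclM_iff intro: continuous_on_subset)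
      moreover have "w t = compressed (N n) t (inclM (e t))" if "t \<in> {0..real n}" for t
        unfolding w_def using that N[of n] \<tau>N by (intro compressed_eq) auto
      ultimately show "continuous_on {0..real n} w"
        by (subst continuous_on_cong[OF refl, of _ _ "\<lambda>t. compressed (N n) t (inclM (e t))"]) auto
    qed
    show "w 0 = 1"
      unfolding w_def using compressed_eq[of 0 _ 0] \<tau>_nonneg by (simp add: \<tau>_0)
    show "star (w t) * w t = 1 \<and> w t * star (w t) = 1 \<and> w t - 1 \<in> range inclM" if "t \<ge> 0" for t
      using compressed_unitary[of "inclM (e t)"] compressed_one_plus[of "e t"] e_sa[OF that] by (simp add: w_def)
    show "\<forall>\<^sub>F t in at_top. norm (w t * c j * star (w t) - U t * c j * star (U t)) < \<epsilon>" if "\<epsilon> > 0" for j \<epsilon>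
      using late[OF that, of j]
    proof eventually_elim
      case (elim t)
      then have "t \<in> {0..real (Suc (nat \<lfloor>t\<rfloor>))}" "j \<in> {..nat \<lfloor>t\<rfloor>}" using floor[of t] by auto
      then have "norm (w t * c j * star (w t) - U t * c j * star (U t)) < 1 / Suc (nat \<lfloor>t\<rfloor>)"
        using good[of t] elim unfolding good_def w_def by blast
      then show ?case using elim by linarith
    qed
    show "\<forall>\<^sub>F t in at_top. \<forall>g\<in>K m. norm (w t * star (\<gamma> g (w t)) - U t * star (\<gamma> g (U t))) < \<epsilon>" if "\<epsilon> > 0" for m \<epsilon>
      using late[OF that, of m]
    proof eventually_elim
      case (elim t)
      then have t: "t \<in> {0..real (Suc (nat \<lfloor>t\<rfloor>))}" using floor[of t] by auto
      show ?case
      proof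
        fix g assume "g \<in> K m"
        then have "g \<in> K (nat \<lfloor>t\<rfloor>)" using monoD[OF K(1)] elim by blast
        then have "norm (w t * star (\<gamma> g (w t)) - U t * star (\<gamma> g (U t))) < 1 / Suc (nat \<lfloor>t\<rfloor>)"
          using good[of t] elim t unfolding good_def w_def by blast
        then show "norm (w t * star (\<gamma> g (w t)) - U t * star (\<gamma> g (U t))) < \<epsilon>" using elim by linarith
      qed
    qed
  qed
qed

end

section \<open>Strong asymptotic unitary equivalence\<close>

text \<open>
  The step after \<open>\<tau>\<^sub>n\<close> is half a modulus of uniform continuity on \<open>[0, \<lceil>\<tau>\<^sub>n\<rceil> + 1]\<close>, made decreasing in \<open>\<lceil>\<tau>\<^sub>n\<rceil>\<close>, so the
  times cannot stay bounded.
\<close>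

lemma exists_breakpoints:
  fixes f :: "real \<Rightarrow> 'v::metric_space"
  assumes f: "continuous_on {0..} f" and \<epsilon>: "\<epsilon> > 0"
  obtains \<tau> :: "nat \<Rightarrow> real" where "\<tau> 0 = 0" "mono \<tau>" "\<And>t. \<exists>n. t \<le> \<tau> n"
    "\<And>n t. \<tau> n \<le> t \<Longrightarrow> t \<le> \<tau> (Suc n) \<Longrightarrow> dist (f t) (f (\<tau> n)) < \<epsilon>"
proof -
  have "\<exists>\<delta>>0. \<forall>s\<in>{0..real (Suc m)}. \<forall>t\<in>{0..real (Suc m)}. dist t s < \<delta> \<longrightarrow> dist (f t) (f s) < \<epsilon>" for m
  proof -
    have "uniformly_continuous_on {0..real (Suc m)} f"
      by (rule compact_uniformly_continuous) (auto intro: continuous_on_subset[OF f])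
    then show ?thesis using \<epsilon> unfolding uniformly_continuous_on_def by blast
  qed
  then obtain \<delta> where \<delta>: "\<And>m. \<delta> m > 0"
    "\<And>m s t. s \<in> {0..real (Suc m)} \<Longrightarrow> t \<in> {0..real (Suc m)} \<Longrightarrow> dist t s < \<delta> m \<Longrightarrow> dist (f t) (f s) < \<epsilon>"
    by metis
  define \<eta> where "\<eta> m = Min (insert 1 (\<delta> ` {..m})) / 2" for m
  have \<eta>: "\<eta> m > 0" "\<eta> m < 1" "\<eta> m < \<delta> m" for m
  proof -
    have pos: "0 < Min (insert 1 (\<delta> ` {..m}))" using \<delta>(1) by (subst Min_gr_iff) auto
    then show "\<eta> m > 0" by (simp add: \<eta>_def)
    have "Min (insert 1 (\<delta> ` {..m})) \<le> 1" "Min (insert 1 (\<delta> ` {..m})) \<le> \<delta> m"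
      by (rule Min_le; simp)+
    then show "\<eta> m < 1" "\<eta> m < \<delta> m" using pos unfolding \<eta>_def by linarith+
  qed
  have \<eta>_anti: "\<eta> n \<le> \<eta> m" if "m \<le> n" for m n
    unfolding \<eta>_def using that by (intro divide_right_mono Min_antimono) auto
  define \<tau> where "\<tau> = rec_nat 0 (\<lambda>_ t. t + \<eta> (nat \<lceil>t\<rceil>))"
  have \<tau>: "\<tau> 0 = 0" "\<tau> (Suc n) = \<tau> n + \<eta> (nat \<lceil>\<tau> n\<rceil>)" for n by (simp_all add: \<tau>_def)
  have nonneg: "\<tau> n \<ge> 0" for n
    by (induction n) (simp_all add: \<tau> less_imp_le[OF \<eta>(1)])
  show thesis
  proof (rule that[of \<tau>])
    show "\<tau> 0 = 0" by (rule \<tau>)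
    show "mono \<tau>" unfolding mono_iff_le_Suc by (simp add: \<tau> less_imp_le[OF \<eta>(1)])
    show "\<exists>n. t \<le> \<tau> n" for t
    proof (rule ccontr)
      assume "\<nexists>n. t \<le> \<tau> n"
      then have lt: "\<tau> n < t" for n by (simp add: not_le)
      have "real n * \<eta> (nat \<lceil>t\<rceil>) \<le> \<tau> n" for n
      proof (induction n)
        case (Suc n)
        have "\<eta> (nat \<lceil>t\<rceil>) \<le> \<eta> (nat \<lceil>\<tau> n\<rceil>)"
          using lt[of n] by (intro \<eta>_anti nat_mono ceiling_mono) simp
        then show ?case using Suc by (simp add: \<tau> algebra_simps)
      qed (simp add: \<tau>)
      moreover obtain n :: nat where "t < real n * \<eta> (nat \<lceil>t\<rceil>)"
        using reals_Archimedean3[OF \<eta>(1)] by blast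
      ultimately show False using lt[of n] by (meson less_le_trans not_less_iff_gr_or_eq)
    qed
    show "dist (f t) (f (\<tau> n)) < \<epsilon>" if t: "\<tau> n \<le> t" "t \<le> \<tau> (Suc n)" for n t
    proof (rule \<delta>(2)[of _ "nat \<lceil>\<tau> n\<rceil>"])
      have "\<tau> n \<le> real (nat \<lceil>\<tau> n\<rceil>)" by (rule real_nat_ceiling_ge)
      then show "\<tau> n \<in> {0..real (Suc (nat \<lceil>\<tau> n\<rceil>))}" "t \<in> {0..real (Suc (nat \<lceil>\<tau> n\<rceil>))}"
        using t[unfolded \<tau>(2)] nonneg[of n] \<eta>(2)[of "nat \<lceil>\<tau> n\<rceil>"]
        unfolding atLeastAtMost_iff of_nat_Suc by (intro conjI; linarith)+
      show "dist t (\<tau> n) < \<delta> (nat \<lceil>\<tau> n\<rceil>)"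
        using t \<eta>(3)[of "nat \<lceil>\<tau> n\<rceil>"] by (simp add: dist_real_def \<tau>)
    qed
  qed
qed

lemma exists_compact_exhaustion:
  assumes "locally_compact_space (euclidean :: 'g::second_countable_topology topology)"
  obtains K :: "nat \<Rightarrow> 'g::second_countable_topology set"
  where "mono K" "\<And>n. compact (K n)" "\<And>C. compact C \<Longrightarrow> \<exists>n. C \<subseteq> K n"
proof -
  define \<F> where "\<F> = {V :: 'g set. open V \<and> (\<exists>C. compact C \<and> V \<subseteq> C)}"
  obtain \<F>' where \<F>': "\<F>' \<subseteq> \<F>" "countable \<F>'" "\<Union>\<F>' = \<Union>\<F>"
    using Lindelof[of \<F>] by (auto simp: \<F>_def)
  have "x \<in> \<Union>\<F>" for x
    using assms unfolding locally_compact_space_def topspace_euclidean open_openin[symmetric]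
      compactin_euclidean_iff \<F>_def by blast
  then have "\<Union>\<F> = UNIV" by blast
  then have \<F>'_UNIV: "\<Union>\<F>' = UNIV" and ne: "\<F>' \<noteq> {}" using \<F>'(3) by auto
  define V where "V = from_nat_into \<F>'"
  have V: "range V = \<F>'" unfolding V_def by (rule range_from_nat_into[OF ne \<F>'(2)])
  then have "V n \<in> \<F>" for n using \<F>'(1) by blast
  then have VF: "\<forall>n. open (V n)" "\<forall>n. \<exists>C. compact C \<and> V n \<subseteq> C" by (simp_all add: \<F>_def)
  from VF(2) obtain C where C: "\<And>n. compact (C n)" "\<And>n. V n \<subseteq> C n" by metis
  define K where "K n = (\<Union>i\<le>n. C i)" for n
  show thesis
  proof (rule that[of K])
    show "mono K" by (fastforce simp: K_def mono_def)
    show "compact (K n)" for n unfolding K_def using C(1) by (intro compact_UN) auto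
    show "\<exists>n. S \<subseteq> K n" if S: "compact S" for S
    proof -
      have "S \<subseteq> (\<Union>n. V n)" using V \<F>'_UNIV by simp
      moreover have "open (V n)" for n using VF(1) by blast
      ultimately obtain I where I: "finite I" "S \<subseteq> (\<Union>n\<in>I. V n)"
        using compactE_image[OF S, of UNIV V] by metis
      have "S \<subseteq> K (Max (insert 0 I))"
      proof
        fix x assume "x \<in> S"
        then obtain n where n: "n \<in> I" "x \<in> V n" using I(2) by auto
        then have "n \<le> Max (insert 0 I)" using I(1) by (intro Max_ge) auto
        then show "x \<in> K (Max (insert 0 I))" using n(2) C(2) by (auto simp: K_def)
      qed
      then show ?thesis ..
    qed
  qed
qed

lemma separable_dense_sequence:
  assumes "separable_space (euclidean :: 'a::metric_space topology)"
  obtains a :: "nat \<Rightarrow> 'a::metric_space" where "\<And>x \<epsilon>. \<epsilon> > 0 \<Longrightarrow> \<exists>j. dist (a j) x < \<epsilon>"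
proof -
  obtain S :: "'a set" where S: "countable S" "closure S = UNIV"
    using assms by (auto simp: separable_space_def)
  then have "S \<noteq> {}" by auto
  then have "range (from_nat_into S) = S" using S(1) by (rule range_from_nat_into)
  moreover have "\<exists>y\<in>S. dist y x < \<epsilon>" if "\<epsilon> > 0" for x \<epsilon>
    using S(2) that closure_approachable[of x S] by auto
  ultimately show thesis by (intro that[of "from_nat_into S"]) (metis rangeE)
qed

lemma sup_norm_on_le:
  assumes "\<And>g. g \<in> C \<Longrightarrow> norm (f g) \<le> r" "0 \<le> r"
  shows "sup_norm_on C f \<le> r"
  unfolding sup_norm_on_def by (rule cSup_least) (use assms in auto)

lemma sup_norm_on_upper:
  assumes "\<And>g. g \<in> C \<Longrightarrow> norm (f g) \<le> r"
  shows "0 \<le> sup_norm_on C f" "g \<in> C \<Longrightarrow> norm (f g) \<le> sup_norm_on C f"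
proof -
  have "bdd_above (insert 0 ((\<lambda>g. norm (f g)) ` C))"
    using assms by (auto simp: bdd_above_def intro!: exI[of _ "max 0 r"] intro: max.coboundedI2)
  then show "0 \<le> sup_norm_on C f" "g \<in> C \<Longrightarrow> norm (f g) \<le> sup_norm_on C f"
    unfolding sup_norm_on_def by (auto intro: cSup_upper)
qed

theorem corollary4p4:
  fixes \<alpha> :: "'g::{topological_group_add, second_countable_topology, t2_space} \<Rightarrow> 'a::cstar_algebra \<Rightarrow> 'a"
    and \<beta> :: "'g \<Rightarrow> 'b::cstar_algebra \<Rightarrow> 'b"
    and \<phi> \<psi> :: "'a \<Rightarrow> 'b multiplier"
    and u v :: "'g \<Rightarrow> 'b multiplier"
    and U :: "real \<Rightarrow> 'b multiplier"
  assumes G: "locally_compact_space (euclidean :: 'g topology)"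
    and A: "separable_space (euclidean :: 'a topology)"
    and B: "sigma_unital TYPE('b)"
    and actions: "continuous_action \<alpha>" "continuous_action \<beta>"
    and reps: "cocycle_rep \<alpha> \<beta> \<phi> u" "cocycle_rep \<alpha> \<beta> \<psi> v"
    and path: "continuous_on {0..} U" "\<And>t. t \<ge> 0 \<Longrightarrow> U t \<in> unitaries (D_alg \<beta> \<phi> u)" "U 0 = 1"
    and lim: "\<And>a K. compact K \<Longrightarrow>
      ((\<lambda>t. norm (\<psi> a - U t * \<phi> a * star (U t)) +
            sup_norm_on K (\<lambda>g. v g - U t * u g * star (extendM (\<beta> g) (U t)))) \<longlongrightarrow> 0) at_top"
  shows "strongly_asymp_unitarily_equiv \<beta> (\<phi>, u) (\<psi>, v)"
proof -
  interpret unitary_cocycle \<beta> u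
    by unfold_locales
      (use actions(2) reps(1) in \<open>auto simp: cocycle_rep_def unitaries_def\<close>)
  have U: "star (U t) * U t = 1" "U t * star (U t) = 1"
    "\<And>g. U t - \<gamma> g (U t) \<in> range inclM" "\<And>a. U t * \<phi> a - \<phi> a * U t \<in> range inclM" if "t \<ge> 0" for t
    using path(2)[OF that] by (auto simp: unitaries_def D_alg_def)
  have \<phi>: "star_hom \<phi>" using reps(1) by (simp add: cocycle_rep_def)
  have v: "star (v g) * v g = 1" for g using reps(2) by (simp add: cocycle_rep_def unitaries_def)

  obtain \<tau> :: "nat \<Rightarrow> real" where \<tau>: "\<tau> 0 = 0" "mono \<tau>" "\<And>t. \<exists>n. t \<le> \<tau> n"
    "\<And>n t. \<tau> n \<le> t \<Longrightarrow> t \<le> \<tau> (Suc n) \<Longrightarrow> dist (U t) (U (\<tau> n)) < 1/2"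
    by (rule exists_breakpoints[OF path(1), of "1/2"]) (simp, blast)
  interpret unitary_path \<beta> u U \<tau>
  proof unfold_locales
    show "norm (U t * star (U (\<tau> n)) - 1) \<le> 1/2" if t: "\<tau> n \<le> t" "t \<le> \<tau> (Suc n)" for n t
    proof -
      have n: "\<tau> n \<ge> 0" using monoD[OF \<tau>(2), of 0 n] \<tau>(1) by simp
      have "norm ((U t - U (\<tau> n)) * star (U (\<tau> n))) \<le> 1/2 * 1"
        using \<tau>(4)[OF t] norm_unitary_le[OF U(1)[OF n]] by (intro norm_mult_le) (auto simp: dist_norm)
      then show ?thesis by (simp add: left_diff_distrib U(2)[OF n])
    qed
    show "continuous_on UNIV (\<lambda>g. \<gamma> g (U t))" if "t \<ge> 0" for t
      by (rule continuous_\<gamma>_if_invariant_mod[OF G B U(3)[OF that]])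
  qed (use path(1,3) U(1,2) \<tau>(1,2) in auto)

  obtain K :: "nat \<Rightarrow> 'g set" where K: "mono K" "\<And>n. compact (K n)" "\<And>C. compact C \<Longrightarrow> \<exists>n. C \<subseteq> K n"
    using exists_compact_exhaustion[OF G] by blast
  obtain a :: "nat \<Rightarrow> 'a" where a: "\<And>x \<epsilon>. \<epsilon> > 0 \<Longrightarrow> \<exists>j. dist (a j) x < \<epsilon>"
    using separable_dense_sequence[OF A] by blast
  obtain w where w: "continuous_on {0..} w" "w 0 = 1"
    "\<And>t. t \<ge> 0 \<Longrightarrow> star (w t) * w t = 1 \<and> w t * star (w t) = 1 \<and> w t - 1 \<in> range inclM"
    "\<And>j \<epsilon>. \<epsilon> > 0 \<Longrightarrow> \<forall>\<^sub>F t in at_top. norm (w t * \<phi> (a j) * star (w t) - U t * \<phi> (a j) * star (U t)) < \<epsilon>"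
    "\<And>m \<epsilon>. \<epsilon> > 0 \<Longrightarrow> \<forall>\<^sub>F t in at_top. \<forall>g\<in>K m. norm (w t * star (\<gamma> g (w t)) - U t * star (\<gamma> g (U t))) < \<epsilon>"
    by (rule exists_asymptotic_path[OF \<tau>(3) B, of "\<lambda>j. \<phi> (a j)" K]) (use U K in auto)

  have bound: "norm (v g - x * u g * star (extendM (\<beta> g) x)) \<le> 2" if "star x * x = 1" for x g
  proof -
    have "norm (x * u g * star (extendM (\<beta> g) x)) \<le> 1 * 1 * 1"
      using norm_unitary_le[OF that] norm_unitary_le[OF unitary(1)]
        star_hom_norm_le[OF star_hom_extendM[OF aut], of g x]
      by (intro norm_mult_le) auto
    then show ?thesis
      using norm_triangle_ineq4[of "v g" "x * u g * star (extendM (\<beta> g) x)"] norm_unitary_le[OF v[of g]] by simp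
  qed
  let ?\<Delta> = "\<lambda>x g. v g - x * u g * star (extendM (\<beta> g) x)"
  have limU: "\<forall>\<^sub>F t in at_top. t \<ge> 0 \<and> norm (\<psi> x - U t * \<phi> x * star (U t)) < \<epsilon> \<and> sup_norm_on C (?\<Delta> (U t)) < \<epsilon>"
    if C: "compact C" and \<epsilon>: "\<epsilon> > 0" for x C \<epsilon>
    using order_tendstoD(2)[OF lim[OF C, of x] \<epsilon>] eventually_ge_at_top[of 0]
  proof eventually_elim
    case (elim t)
    have "0 \<le> sup_norm_on C (?\<Delta> (U t))"
      by (rule sup_norm_on_upper(1)) (rule bound[OF U(1)[OF elim(2)]])
    then show ?case using elim norm_ge_zero[of "\<psi> x - U t * \<phi> x * star (U t)"] by linarith
  qed

  have "((\<lambda>t. norm (\<psi> x - w t * \<phi> x * star (w t))) \<longlongrightarrow> 0) at_top" for x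
  proof (rule tendstoI)
    fix \<epsilon> :: real assume \<epsilon>: "\<epsilon> > 0"
    then obtain j where "dist (a j) x < \<epsilon> / 4" using a[of "\<epsilon> / 4" x] by auto
    then have "norm (\<phi> (x - a j)) < \<epsilon> / 4"
      using star_hom_norm_le[OF \<phi>, of "x - a j"] by (simp add: dist_norm norm_minus_commute)
    moreover have "\<phi> (x - a j) = \<phi> x - \<phi> (a j)"
      by (rule linear_diff[OF bounded_linear.linear[OF star_hom_bounded_linear[OF \<phi>]]])
    ultimately have j: "norm (\<phi> x - \<phi> (a j)) < \<epsilon> / 4" by simp
    have \<epsilon>4: "\<epsilon> / 4 > 0" using \<epsilon> by simp
    show "\<forall>\<^sub>F t in at_top. dist (norm (\<psi> x - w t * \<phi> x * star (w t))) 0 < \<epsilon>"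
      using limU[OF compact_empty \<epsilon>4, of x] w(4)[OF \<epsilon>4, of j]
    proof eventually_elim
      case (elim t)
      then have t: "t \<ge> 0" by simp
      let ?d = "\<phi> x - \<phi> (a j)"
      have "\<psi> x - w t * \<phi> x * star (w t) = (\<psi> x - U t * \<phi> x * star (U t))
          + U t * ?d * star (U t) - w t * ?d * star (w t)
          - (w t * \<phi> (a j) * star (w t) - U t * \<phi> (a j) * star (U t))"
        by (simp add: algebra_simps)
      then have "norm (\<psi> x - w t * \<phi> x * star (w t)) \<le> norm (\<psi> x - U t * \<phi> x * star (U t))
          + norm (U t * ?d * star (U t)) + norm (w t * ?d * star (w t))
          + norm (w t * \<phi> (a j) * star (w t) - U t * \<phi> (a j) * star (U t))"
        by (simp only:) (rule order_trans[OF norm_triangle_ineq4 add_right_mono[OF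
              order_trans[OF norm_triangle_ineq4 add_right_mono[OF norm_triangle_ineq]]]])
      moreover have "\<dots> < \<epsilon> / 4 + \<epsilon> / 4 + \<epsilon> / 4 + \<epsilon> / 4"
        using elim j norm_conj_le[OF U(1)[OF t] U(1)[OF t], of ?d] norm_conj_le[of "w t" "w t" ?d] w(3)[OF t]
        by (intro add_strict_mono) auto
      ultimately show ?case by simp
    qed
  qed
  moreover have "((\<lambda>t. sup_norm_on C (?\<Delta> (w t))) \<longlongrightarrow> 0) at_top" if C: "compact C" for C
  proof (rule tendstoI)
    fix \<epsilon> :: real assume \<epsilon>: "\<epsilon> > 0"
    obtain m where m: "C \<subseteq> K m" using K(3)[OF C] by blast
    have \<epsilon>4: "\<epsilon> / 4 > 0" using \<epsilon> by simp
    show "\<forall>\<^sub>F t in at_top. dist (sup_norm_on C (?\<Delta> (w t))) 0 < \<epsilon>"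
      using limU[OF C \<epsilon>4, of 0] w(5)[OF \<epsilon>4, of m]
    proof eventually_elim
      case (elim t)
      then have t: "t \<ge> 0" by simp
      have "norm (?\<Delta> (w t) g) \<le> \<epsilon> / 2" if g: "g \<in> C" for g
      proof -
        have "?\<Delta> (w t) g = ?\<Delta> (U t) g - (w t * star (\<gamma> g (w t)) - U t * star (\<gamma> g (U t))) * u g"
          unfolding conj_cocycle by (simp add: left_diff_distrib)
        then have "norm (?\<Delta> (w t) g) \<le> norm (?\<Delta> (U t) g)
            + norm ((w t * star (\<gamma> g (w t)) - U t * star (\<gamma> g (U t))) * u g)"
          by (simp only: norm_triangle_ineq4)
        also have "norm (?\<Delta> (U t) g) \<le> sup_norm_on C (?\<Delta> (U t))"
          by (rule sup_norm_on_upper(2)[OF bound[OF U(1)[OF t]] g])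
        also have "norm ((w t * star (\<gamma> g (w t)) - U t * star (\<gamma> g (U t))) * u g) \<le> \<epsilon> / 4 * 1"
          using elim(2) g m norm_unitary_le[OF unitary(1)] by (intro norm_mult_le) (auto intro: less_imp_le)
        finally show ?thesis using elim(1) by simp
      qed
      then have "sup_norm_on C (?\<Delta> (w t)) \<le> \<epsilon> / 2" using \<epsilon> by (intro sup_norm_on_le) auto
      moreover have "0 \<le> sup_norm_on C (?\<Delta> (w t))"
        by (rule sup_norm_on_upper(1), rule bound) (use w(3)[OF t] in simp)
      ultimately show ?case using \<epsilon> by simp
    qed
  qed
  moreover have "w t \<in> unitaries_one_plus" if t: "t \<ge> 0" for t
  proof -
    obtain b where "w t - 1 = inclM b" using w(3)[OF t] by auto
    then have "w t = 1 + inclM b" by (simp add: algebra_simps)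
    then show ?thesis using w(3)[OF t] by (auto simp: unitaries_one_plus_def unitaries_def)
  qed
  ultimately show ?thesis
    unfolding strongly_asymp_unitarily_equiv_def using w(1,2) by auto
qed

end
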